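(* Let $\lambda,\mu>0$ with $\lambda\mu<1$, and let $t\mapsto L_{\lambda,\mu}(\cdot,t)$ be the Hammersley process with sources of intensity $\lambda$, sinks of intensity $\mu$ and $\alpha$-points of intensity $1$. Let $a>0$. Consider the random particle configuration with counting process $$y\mapsto L_{\lambda,\mu}(x+y,ax)-L_{\lambda,\mu}(x,ax),\qquad y\ge -x.$$ Then: (i) If $a>1/\mu^2$, the process converges in distribution, as $x\to\infty$, to a homogeneous Poisson process on $\mathbb{R}$ with intensity $1/\mu$. (ii) If $1/\mu^2>a>\lambda^2$, the process converges in distribution, as $x\to\infty$, to a homogeneous Poisson process on $\mathbb{R}$ with intensity $\sqrt{a}$. (iii) If $\lambda^2>a$, the process converges in distribution, as $x\to\infty$, to a homogeneous Poisson process on $\mathbb{R}$ with intensity $\lambda$.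
   Context: Hammersley process with sources and sinks. Take three independent homogeneous Poisson processes: a process of "sources" on the positive $x$-axis $(0,\infty)\times\{0\}$ with intensity $\lambda$, a process of "sinks" on the positive $t$-axis $\{0\}\times(0,\infty)$ with intensity $\mu$, and a process of "$\alpha$-points" in $(0,\infty)^2$ with intensity $1$ (Lebesgue measure). The vertical coordinate $t$ is time. The Hammersley process is the evolving (locally finite) particle configuration $\eta_t$ on $(0,\infty)$ defined as follows. At time $0$ the particles are located at the sources. When an $\alpha$-point $(u,s)$ occurs, the particle immediately to the right of $u$ jumps at time $s$ to $u$. When a sink $(0,s)$ occurs, the leftmost particle disappears at time $s$ (it exits through the $t$-axis). Nothing else changes. This is well defined because for each $R>0$ the restriction of $\eta_t$ to $(0,R]$ evolves autonomously: at an $\alpha$-point $(u,s)$ with $u\le R$, the leftmost particle in $(u,R]$, if any, is removed and a particle is put at $u$; at a sink, the leftmost particle in $(0,R]$, if any, is removed; these restrictions are consistent as $R$ varies. $L_{\lambda,\mu}(x,t)$ denotes the number of particles of $\eta_t$ in $(0,x]$. Convergence in distribution is convergence in distribution of point processes (equivalently, joint convergence in law of the numbers of points in finitely many bounded intervals). *)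

theory Defs
  imports "HOL-Probability.Probability"
begin

section \<open>Poisson processes\<close>

text \<open>
  A point configuration is a set of points, and a point process assigns to every outcome a locally
  finite configuration in such a way that the number of points in each bounded Borel set is a
  random variable.  Bounded means bounded in the ambient space: for a domain such as
  \<open>{0<..}\<close> the points do not accumulate at the boundary either.
\<close>

definition locally_finite :: "'a::metric_space set \<Rightarrow> bool" where
  "locally_finite X \<longleftrightarrow> (\<forall>B. bounded B \<longrightarrow> finite (X \<inter> B))"

definition point_process ::
    "'w measure \<Rightarrow> 'a::euclidean_space set \<Rightarrow> ('w \<Rightarrow> 'a set) \<Rightarrow> bool" where
  "point_process M D X \<longleftrightarrow>
     (\<forall>\<omega>\<in>space M. X \<omega> \<subseteq> D \<and> locally_finite (X \<omega>)) \<and>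
     (\<forall>B\<in>sets borel. bounded B \<longrightarrow>
        (\<lambda>\<omega>. card (X \<omega> \<inter> B)) \<in> measurable M (count_space UNIV))"

text \<open>
  The Poisson probabilities are written out because \<open>poisson_pmf\<close> is unspecified at
  rate \<open>0\<close>, which occurs for null sets \<open>B\<close>.
\<close>

definition poisson_process ::
    "'w measure \<Rightarrow> 'a::euclidean_space set \<Rightarrow> real \<Rightarrow> ('w \<Rightarrow> 'a set) \<Rightarrow> bool" where
  "poisson_process M D c X \<longleftrightarrow>
     prob_space M \<and> point_process M D X \<and>
     (\<forall>B\<in>sets borel. bounded B \<longrightarrow> B \<subseteq> D \<longrightarrow>
        (\<forall>k. measure M {\<omega> \<in> space M. card (X \<omega> \<inter> B) = k} =
             (c * measure lborel B) ^ k / fact k * exp (- (c * measure lborel B)))) \<and>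
     (\<forall>(n::nat) B. (\<forall>i<n. B i \<in> sets borel \<and> bounded (B i) \<and> B i \<subseteq> D) \<longrightarrow>
        disjoint_family_on B {..<n} \<longrightarrow>
        prob_space.indep_vars M (\<lambda>_. count_space UNIV) (\<lambda>i \<omega>. card (X \<omega> \<inter> B i)) {..<n})"

definition generated_sigma ::
    "'w measure \<Rightarrow> ('w \<Rightarrow> 'a::euclidean_space set) \<Rightarrow> 'w set set" where
  "generated_sigma M X =
     sigma_sets (space M)
       {{\<omega> \<in> space M. card (X \<omega> \<inter> B) = k} | B k. B \<in> sets borel \<and> bounded B}"

definition independent_processes ::
    "'w measure \<Rightarrow> ('w \<Rightarrow> 'a::euclidean_space set) \<Rightarrow> ('w \<Rightarrow> 'b::euclidean_space set) \<Rightarrow>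
     ('w \<Rightarrow> 'c::euclidean_space set) \<Rightarrow> bool" where
  "independent_processes M X Y Z \<longleftrightarrow>
     prob_space.indep_sets M
       (\<lambda>i. [generated_sigma M X, generated_sigma M Y, generated_sigma M Z] ! i) {..<(3::nat)}"

section \<open>The Hammersley process\<close>

text \<open>
  Sources are given by their abscissae \<open>S\<close>, sinks by their times \<open>T\<close>, and an \<open>\<alpha>\<close>-point
  \<open>(u, s) \<in> A\<close> has position \<open>u\<close> and time \<open>s\<close>.  The process is first constructed in a window
  \<open>(0, R]\<close>, where there are only finitely many events up to each time.

  Almost surely no two events are simultaneous; in the exceptional case the sink is processed
  first and then the \<open>\<alpha>\<close>-points from left to right.  This makes everything defined (and consistent
  in \<open>R\<close>) for all locally finite \<open>S\<close>, \<open>T\<close>, \<open>A\<close>.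
\<close>

definition remove_next :: "real \<Rightarrow> real set \<Rightarrow> real set" where
  "remove_next u C = (if \<exists>p\<in>C. u < p then C - {Min {p\<in>C. u < p}} else C)"

definition alpha_step :: "real \<Rightarrow> real set \<Rightarrow> real set" where
  "alpha_step u C = insert u (remove_next u C)"

definition sink_step :: "real set \<Rightarrow> real set" where
  "sink_step C = remove_next 0 C"

definition alpha_at :: "(real \<times> real) set \<Rightarrow> real \<Rightarrow> real \<Rightarrow> real set" where
  "alpha_at A R s = {u. 0 < u \<and> u \<le> R \<and> (u, s) \<in> A}"

definition event_times :: "real set \<Rightarrow> (real \<times> real) set \<Rightarrow> real \<Rightarrow> real \<Rightarrow> real set" where
  "event_times T A R t = {s. 0 < s \<and> s \<le> t \<and> (s \<in> T \<or> alpha_at A R s \<noteq> {})}"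

definition update :: "real set \<Rightarrow> (real \<times> real) set \<Rightarrow> real \<Rightarrow> real \<Rightarrow> real set \<Rightarrow> real set" where
  "update T A R s C =
     fold alpha_step (sorted_list_of_set (alpha_at A R s)) (if s \<in> T then sink_step C else C)"

definition window ::
    "real set \<Rightarrow> real set \<Rightarrow> (real \<times> real) set \<Rightarrow> real \<Rightarrow> real \<Rightarrow> real set" where
  "window S T A R t =
     fold (update T A R) (sorted_list_of_set (event_times T A R t)) (S \<inter> {0<..R})"

definition hammersley ::
    "real set \<Rightarrow> real set \<Rightarrow> (real \<times> real) set \<Rightarrow> real \<Rightarrow> real set" where
  "hammersley S T A t = (\<Union>R\<in>{0<..}. window S T A R t)"

definition hammersley_count ::
    "real set \<Rightarrow> real set \<Rightarrow> (real \<times> real) set \<Rightarrow> real \<Rightarrow> real \<Rightarrow> nat" where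
  "hammersley_count S T A x t = card (hammersley S T A t \<inter> {0<..x})"

section \<open>Configurations and convergence in distribution\<close>

text \<open>
  The configuration on \<open>(l, \<infinity>)\<close> with counting process \<open>F\<close>, for \<open>F\<close> an integer-valued,
  nondecreasing, right-continuous function on \<open>[l, \<infinity>)\<close>: its particles are the points where \<open>F\<close>
  jumps.
\<close>

definition particles_of :: "real \<Rightarrow> (real \<Rightarrow> int) \<Rightarrow> real set" where
  "particles_of l F = {y. l < y \<and> (\<forall>z. l \<le> z \<and> z < y \<longrightarrow> F z < F y)}"

text \<open>
  Joint convergence in law, as \<open>x \<rightarrow> \<infinity>\<close>, of the numbers of points in finitely many bounded
  intervals.  These vectors take values in a discrete space, on which every function is continuous,
  so the test functions are all bounded \<open>f\<close>.
\<close>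

definition converges_in_distribution ::
    "'w measure \<Rightarrow> (real \<Rightarrow> 'w \<Rightarrow> real set) \<Rightarrow> 'v measure \<Rightarrow> ('v \<Rightarrow> real set) \<Rightarrow> bool" where
  "converges_in_distribution M X M' N \<longleftrightarrow>
     (\<forall>(Is :: real set list) (f :: nat list \<Rightarrow> real).
        (\<forall>I\<in>set Is. is_interval I \<and> bounded I) \<longrightarrow> bounded (range f) \<longrightarrow>
        ((\<lambda>x. \<integral>\<omega>. f (map (\<lambda>I. card (X x \<omega> \<inter> I)) Is) \<partial>M) \<longlongrightarrow>
           (\<integral>\<omega>. f (map (\<lambda>I. card (N \<omega> \<inter> I)) Is) \<partial>M')) at_top)"

section \<open>Consistency of the windows\<close>

lemma remove_next_props:
  assumes "finite C" "C \<subseteq> {0<..}"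
  shows "finite (remove_next u C)" "remove_next u C \<subseteq> {0<..}"
  using assms by (auto simp: remove_next_def)

lemma remove_next_restrict:
  assumes "finite C" "C \<subseteq> {0<..}"
  shows "remove_next u C \<inter> {0<..R} = remove_next u (C \<inter> {0<..R})"
proof -
  let ?P = "{p\<in>C. u < p}"
  have fin: "finite ?P" using assms by auto
  show ?thesis
  proof (cases "\<exists>p\<in>C. u < p")
    case True
    then have ne: "?P \<noteq> {}" by auto
    have m: "Min ?P \<in> ?P" using Min_in[OF fin ne] .
    show ?thesis
    proof (cases "Min ?P \<le> R")
      case le: True
      have "Min {p \<in> C \<inter> {0<..R}. u < p} = Min ?P"
        using m le fin assms by (intro Min_eqI) auto
      moreover have "\<exists>p\<in>C \<inter> {0<..R}. u < p"
        using m le assms by (intro bexI[of _ "Min ?P"]) auto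
      ultimately show ?thesis using True by (auto simp: remove_next_def)
    next
      case gt: False
      have no: "\<not> (\<exists>p\<in>C \<inter> {0<..R}. u < p)"
      proof
        assume "\<exists>p\<in>C \<inter> {0<..R}. u < p"
        then obtain p where p: "p \<in> ?P" "p \<le> R" by auto
        with Min_le[OF fin p(1)] gt show False by linarith
      qed
      have "remove_next u C = C - {Min ?P}" using True by (simp add: remove_next_def)
      moreover have "remove_next u (C \<inter> {0<..R}) = C \<inter> {0<..R}"
        using no unfolding remove_next_def by (simp only: if_False)
      ultimately show ?thesis using gt by auto
    qed
  next
    case False
    then show ?thesis by (auto simp: remove_next_def)
  qed
qed

lemma remove_next_beyond:
  assumes "R < u"
  shows "remove_next u (C \<inter> {0<..R}) = C \<inter> {0<..R}"
  using assms by (auto simp: remove_next_def)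

lemma fold_alpha_restrict:
  assumes "finite C" "C \<subseteq> {0<..}" "set us \<subseteq> {0<..}"
  shows "finite (fold alpha_step us C) \<and> fold alpha_step us C \<subseteq> {0<..} \<and>
         fold alpha_step us C \<inter> {0<..R} =
         fold alpha_step (filter (\<lambda>u. u \<le> R) us) (C \<inter> {0<..R})"
  using assms
proof (induction us arbitrary: C)
  case (Cons u us)
  let ?C = "alpha_step u C"
  have C: "finite ?C" "?C \<subseteq> {0<..}"
    using Cons.prems remove_next_props[of C u] by (auto simp: alpha_step_def)
  have "?C \<inter> {0<..R} = (if u \<le> R then alpha_step u (C \<inter> {0<..R}) else C \<inter> {0<..R})"
    using Cons.prems remove_next_restrict[of C u R] remove_next_beyond[of R u C]
    by (auto simp: alpha_step_def)
  with Cons.IH[OF C] Cons.prems show ?case by simp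
qed simp

lemma filter_sorted_list_of_set:
  fixes U :: "real set"
  assumes "finite U"
  shows "filter P (sorted_list_of_set U) = sorted_list_of_set {u\<in>U. P u}"
  using assms
  by (intro sorted_distinct_set_unique) (auto intro: sorted_wrt_filter distinct_filter)

lemma finite_alpha_at:
  assumes "locally_finite A"
  shows "finite (alpha_at A R s)"
proof -
  have "finite (A \<inter> {0..R} \<times> {s})"
    using assms bounded_Times[OF bounded_closed_interval[of 0 R] finite_imp_bounded[of "{s}"]]
    by (simp add: locally_finite_def)
  then have "finite (fst ` (A \<inter> {0..R} \<times> {s}))" by simp
  then show ?thesis by (rule finite_subset[rotated]) (force simp: alpha_at_def image_iff)
qed

lemma finite_event_times:
  assumes "locally_finite T" "locally_finite A"
  shows "finite (event_times T A R t)"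
proof -
  have "finite (A \<inter> {0..R} \<times> {0..t})" "finite (T \<inter> {0..t})"
    using assms bounded_closed_interval[of 0 t]
      bounded_Times[OF bounded_closed_interval[of 0 R] bounded_closed_interval[of 0 t]]
    by (simp_all add: locally_finite_def)
  then have "finite (snd ` (A \<inter> {0..R} \<times> {0..t}) \<union> (T \<inter> {0..t}))" by simp
  then show ?thesis
    by (rule finite_subset[rotated]) (force simp: event_times_def alpha_at_def image_iff)
qed

lemma update_restrict:
  assumes "locally_finite A" "finite C" "C \<subseteq> {0<..}" "R \<le> R'"
  shows "finite (update T A R' s C) \<and> update T A R' s C \<subseteq> {0<..} \<and>
         update T A R' s C \<inter> {0<..R} = update T A R s (C \<inter> {0<..R})"
proof -
  let ?C = "if s \<in> T then sink_step C else C"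
  let ?us = "sorted_list_of_set (alpha_at A R' s)"
  have C: "finite ?C" "?C \<subseteq> {0<..}"
    using assms remove_next_props[of C 0] by (auto simp: sink_step_def split: if_splits)
  have us: "set ?us \<subseteq> {0<..}"
    using finite_alpha_at[OF assms(1)] by (auto simp: alpha_at_def)
  have "{u \<in> alpha_at A R' s. u \<le> R} = alpha_at A R s"
    using assms(4) by (auto simp: alpha_at_def)
  then have f: "filter (\<lambda>u. u \<le> R) ?us = sorted_list_of_set (alpha_at A R s)"
    by (simp add: filter_sorted_list_of_set finite_alpha_at assms(1))
  have "?C \<inter> {0<..R} = (if s \<in> T then sink_step (C \<inter> {0<..R}) else C \<inter> {0<..R})"
    using remove_next_restrict[OF assms(2,3)] by (simp add: sink_step_def)
  then show ?thesis
    using fold_alpha_restrict[OF C us, of R] f by (simp add: update_def)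
qed

lemma fold_update_restrict:
  assumes "locally_finite A" "finite C" "C \<subseteq> {0<..}" "R \<le> R'"
  shows "finite (fold (update T A R') ts C) \<and> fold (update T A R') ts C \<subseteq> {0<..} \<and>
         fold (update T A R') ts C \<inter> {0<..R} =
         fold (update T A R) (filter (\<lambda>s. s \<in> T \<or> alpha_at A R s \<noteq> {}) ts) (C \<inter> {0<..R})"
  using assms(2,3)
proof (induction ts arbitrary: C)
  case (Cons s ts)
  let ?C = "update T A R' s C"
  have C: "finite ?C" "?C \<subseteq> {0<..}" "?C \<inter> {0<..R} = update T A R s (C \<inter> {0<..R})"
    using update_restrict[OF assms(1) Cons.prems assms(4)] by blast+
  have "\<not> (s \<in> T \<or> alpha_at A R s \<noteq> {}) \<Longrightarrow> update T A R s D = D" for D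
    by (simp add: update_def)
  with Cons.IH[OF C(1,2)] C(3) show ?case by auto
qed simp

lemma window_restrict:
  assumes "locally_finite S" "locally_finite T" "locally_finite A" "R \<le> R'"
  shows "finite (window S T A R' t)" "window S T A R' t \<subseteq> {0<..}"
    and "window S T A R' t \<inter> {0<..R} = window S T A R t"
proof -
  have C: "finite (S \<inter> {0<..R'})" "S \<inter> {0<..R'} \<subseteq> {0<..}"
    using assms(1) by (auto simp: locally_finite_def)
  have "{s \<in> event_times T A R' t. s \<in> T \<or> alpha_at A R s \<noteq> {}} = event_times T A R t"
    using assms(4) by (auto simp: event_times_def alpha_at_def)
  then have f: "filter (\<lambda>s. s \<in> T \<or> alpha_at A R s \<noteq> {}) (sorted_list_of_set (event_times T A R' t))
      = sorted_list_of_set (event_times T A R t)"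
    by (simp add: filter_sorted_list_of_set finite_event_times assms(2,3))
  have "S \<inter> {0<..R'} \<inter> {0<..R} = S \<inter> {0<..R}" using assms(4) by auto
  with fold_update_restrict[OF assms(3) C assms(4), of T "sorted_list_of_set (event_times T A R' t)"] f
  show "finite (window S T A R' t)" "window S T A R' t \<subseteq> {0<..}"
    and "window S T A R' t \<inter> {0<..R} = window S T A R t"
    unfolding window_def by simp_all
qed

lemma hammersley_Int_window:
  assumes "locally_finite S" "locally_finite T" "locally_finite A" "0 < R"
  shows "hammersley S T A t \<inter> {0<..R} = window S T A R t"
proof
  show "window S T A R t \<subseteq> hammersley S T A t \<inter> {0<..R}"
    using window_restrict(3)[OF assms(1-3) order_refl[of R], of t] assms(4)
    by (auto simp: hammersley_def)
  show "hammersley S T A t \<inter> {0<..R} \<subseteq> window S T A R t"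
  proof
    fix p assume p: "p \<in> hammersley S T A t \<inter> {0<..R}"
    then obtain R' where R': "p \<in> window S T A R' t" by (auto simp: hammersley_def)
    show "p \<in> window S T A R t"
    proof (cases "R \<le> R'")
      case True
      then show ?thesis using window_restrict(3)[OF assms(1-3) True] R' p by blast
    next
      case False
      then have "R' \<le> R" by simp
      from window_restrict(3)[OF assms(1-3) this] R' show ?thesis by blast
    qed
  qed
qed

lemma hammersley_pos:
  assumes "locally_finite S" "locally_finite T" "locally_finite A"
  shows "hammersley S T A t \<subseteq> {0<..}"
  using window_restrict(2)[OF assms order_refl] by (auto simp: hammersley_def)

lemma finite_hammersley_Int:
  assumes "locally_finite S" "locally_finite T" "locally_finite A"
  shows "finite (hammersley S T A t \<inter> {0<..R})"
proof (cases "0 < R")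
  case True
  then show ?thesis
    using hammersley_Int_window[OF assms True] window_restrict(1)[OF assms order_refl] by simp
qed simp

lemma particles_of_hammersley_count:
  assumes "locally_finite S" "locally_finite T" "locally_finite A" "0 \<le> x"
  shows "particles_of (- x) (\<lambda>y. int (hammersley_count S T A (x + y) t) -
                                  int (hammersley_count S T A x t)) =
         {y. x + y \<in> hammersley S T A t}"
proof -
  let ?H = "hammersley S T A t"
  have fin: "finite (?H \<inter> {0<..r})" for r by (rule finite_hammersley_Int[OF assms(1-3)])
  have pos: "?H \<subseteq> {0<..}" by (rule hammersley_pos[OF assms(1-3)])
  have lt: "card (?H \<inter> {0<..x + z}) < card (?H \<inter> {0<..x + y})"
    if "x + y \<in> ?H" "z < y" for y z
  proof (rule psubset_card_mono[OF fin])
    show "?H \<inter> {0<..x + z} \<subset> ?H \<inter> {0<..x + y}"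
    proof
      show "?H \<inter> {0<..x + z} \<subseteq> ?H \<inter> {0<..x + y}" using that by auto
      have "x + y \<in> ?H \<inter> {0<..x + y}" "x + y \<notin> ?H \<inter> {0<..x + z}" using that pos by auto
      then show "?H \<inter> {0<..x + z} \<noteq> ?H \<inter> {0<..x + y}" by metis
    qed
  qed
  have mem: "x + y \<in> ?H"
    if y: "- x < y" and *: "\<And>z. - x \<le> z \<Longrightarrow> z < y \<Longrightarrow>
         card (?H \<inter> {0<..x + z}) < card (?H \<inter> {0<..x + y})" for y
  proof (rule ccontr)
    assume no: "x + y \<notin> ?H"
    let ?m = "Max (insert 0 (?H \<inter> {0<..x + y}))"
    have "?m \<in> insert 0 (?H \<inter> {0<..x + y})" using fin by (intro Max_in) auto
    then have m: "0 \<le> ?m" "?m < x + y" using y no by (auto simp: less_le)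
    have le: "p \<le> ?m" if "p \<in> ?H" "p \<le> x + y" for p
      using that pos fin[of "x + y"] by (intro Max_ge) auto
    then have "?H \<inter> {0<..x + (?m - x)} = ?H \<inter> {0<..x + y}" using m by fastforce
    moreover have "card (?H \<inter> {0<..x + (?m - x)}) < card (?H \<inter> {0<..x + y})"
      using m by (intro *) auto
    ultimately show False by simp
  qed
  show ?thesis
  proof (intro set_eqI iffI)
    fix y assume "y \<in> {y. x + y \<in> ?H}"
    then show "y \<in> particles_of (- x) (\<lambda>y. int (hammersley_count S T A (x + y) t) -
                                  int (hammersley_count S T A x t))"
      using lt pos by (force simp: particles_of_def hammersley_count_def)
  next
    fix y assume "y \<in> particles_of (- x) (\<lambda>y. int (hammersley_count S T A (x + y) t) -
                                  int (hammersley_count S T A x t))"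
    then show "y \<in> {y. x + y \<in> ?H}"
      using mem[of y] by (auto simp: particles_of_def hammersley_count_def)
  qed
qed

end

theory Submission
  imports Defs
begin

text \<open>
  Let \<open>N(x, t)\<close> be the number of particles in \<open>(0, x]\<close> at time \<open>t\<close> plus the number of sinks up to
  time \<open>t\<close>.  An \<open>\<alpha>\<close>-point at \<open>u\<close> replaces \<open>N(x)\<close> by \<open>max (N(x)) (N(u) + 1)\<close> for \<open>x \<ge> u\<close>, and a sink
  does the same at \<open>u = 0\<close>.  Hence \<open>N\<close> increases with the sources and the sinks, and it is the
  maximum of the two passage times obtained by deleting all sinks or all sources.

  For intensities \<open>\<rho>\<close> and \<open>1 / \<rho>\<close> the process is stationary (Burke's theorem): on a fine grid it becomes
  a system of independent bits in which each cell almost preserves a product of two Bernoulli laws,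
  with an error of third order in the mesh size.  Only the probabilities of empty sets enter.
  Stationarity gives \<open>N(x, a x) \<approx> (\<rho> + a / \<rho>) x\<close>.  The process without sinks (or without sources) is
  dominated by the stationary one with density \<open>sqrt a\<close>, so its passage time is at most about
  \<open>2 sqrt a x\<close>, which is strictly smaller if \<open>\<rho> \<noteq> sqrt a\<close>.  Therefore near \<open>(x, a x)\<close> the sources have
  no influence on a stationary process with \<open>\<rho> < sqrt a\<close>, nor have the sinks if \<open>\<rho> > sqrt a\<close>.

  Adding sources up to density \<open>1 / mu\<close> in case (i), or sinks up to \<open>1 / lam\<close> in case (iii), thus
  changes nothing locally and makes the process stationary.  In case (ii) monotonicity squeezes the
  configuration between local copies of stationary processes with densities just below and just
  above \<open>sqrt a\<close>, whose expected difference on a bounded window is small.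
\<close>

text \<open>The obstacle is that the law of the particles is needed for a process that is
  constructed pathwise. The grid makes this finite: for a fixed input its dynamics agrees exactly
  with the process once the mesh separates all points of the window, so the whole error lies in the
  law of the bits. Nor is any Poisson law computed on the way. Two configurations have the same law
  because their interval counts are limits of the same Bernoulli expectations
  (\<open>poisson_law\<close>); explicit Poisson probabilities are borrowed from the limiting
  process \<open>N\<close>, rescaled to the intensity wanted. The same \<open>N\<close> supplies the
  randomness for the couplings: added sources and sinks are affine images of its two halves. They
  live on the product \<open>M \<Otimes>\<^sub>M M'\<close>, and statements that concern the
  original input alone return to \<open>M\<close> along the projection. The recursion by maxima is
  exact only if \<alpha>-points never fall on occupied sites, which holds almost surely.\<close>

lemma remove_next_mono:
  assumes "finite C'" "C \<subseteq> C'"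
  shows "remove_next u C \<subseteq> remove_next u C'"
proof (cases "\<exists>p\<in>C. u < p")
  case True
  let ?m = "Min {p\<in>C. u < p}" and ?m' = "Min {p\<in>C'. u < p}"
  have C: "finite C" using assms finite_subset by blast
  \<comment> \<open>The inclusion could fail only if the particle taken from \<open>C'\<close>
    survived in \<open>C\<close>. But the first particle of \<open>C'\<close> beyond
    \<open>u\<close> is also the first one of \<open>C\<close> as soon as it belongs to
    \<open>C\<close>.\<close>
  have "?m' \<in> C \<Longrightarrow> ?m' = ?m"
  proof -
    assume *: "?m' \<in> C"
    have m': "?m' \<in> {p\<in>C'. u < p}" using assms True by (intro Min_in) auto
    show ?thesis using * m' assms C by (intro Min_eqI[symmetric]) (auto intro: Min_le)
  qed
  then show ?thesis using True assms unfolding remove_next_def by auto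
next
  case False
  have "?thesis" if "\<exists>p\<in>C'. u < p"
  proof -
    have "Min {p\<in>C'. u < p} \<in> {p\<in>C'. u < p}" using assms that by (intro Min_in) auto
    then show ?thesis using False assms that unfolding remove_next_def by auto
  qed
  then show ?thesis using False assms unfolding remove_next_def by auto
qed

lemma remove_next_subset: "remove_next u C \<subseteq> C"
  by (auto simp: remove_next_def)

lemma fold_alpha_step_mono:
  assumes "finite C'" "C \<subseteq> C'"
  shows "fold alpha_step us C \<subseteq> fold alpha_step us C'"
  using assms
proof (induction us arbitrary: C C')
  case (Cons u us)
  have "finite (alpha_step u C')"
    using Cons.prems finite_subset[OF remove_next_subset] by (auto simp: alpha_step_def)
  moreover have "alpha_step u C \<subseteq> alpha_step u C'"
    using remove_next_mono[OF Cons.prems] by (auto simp: alpha_step_def)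
  ultimately show ?case using Cons.IH by simp
qed simp

text \<open>The order in the sinks is reversed: a sink only deletes, so extra sinks shrink the
  configuration, although they increase the passage times.\<close>

lemma update_mono:
  assumes "finite C'" "C \<subseteq> C'" "T' \<subseteq> T"
  shows "update T A R s C \<subseteq> update T' A R s C'"
proof -
  have "finite (if s \<in> T' then sink_step C' else C')"
    using assms(1) finite_subset[OF remove_next_subset] by (auto simp: sink_step_def)
  moreover have "(if s \<in> T then sink_step C else C) \<subseteq> (if s \<in> T' then sink_step C' else C')"
    using assms remove_next_mono[OF assms(1,2), of 0] remove_next_subset[of 0 C]
    by (auto simp: sink_step_def)
  ultimately show ?thesis unfolding update_def by (rule fold_alpha_step_mono)
qed

lemma fold_update_mono:
  assumes "locally_finite A" "finite C'" "C' \<subseteq> {0<..}" "C \<subseteq> C'" "T' \<subseteq> T"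
  shows "fold (update T A R) ts C \<subseteq> fold (update T' A R) ts C'"
  using assms(2-4)
proof (induction ts arbitrary: C C')
  case (Cons s ts)
  have "finite (update T' A R s C')" "update T' A R s C' \<subseteq> {0<..}"
    using update_restrict[OF assms(1) Cons.prems(1,2) order_refl] by auto
  with Cons.IH update_mono[OF Cons.prems(1,3) assms(5)] show ?case by simp
qed simp

text \<open>Processing a time without events does nothing, so processes with different sinks can be
  compared along one common list of times.\<close>

lemma window_eq_fold:
  assumes "finite E" "event_times T A R t \<subseteq> E" "E \<subseteq> {0<..t}"
  shows "window S T A R t = fold (update T A R) (sorted_list_of_set E) (S \<inter> {0<..R})"
proof -
  let ?P = "\<lambda>s. s \<in> T \<or> alpha_at A R s \<noteq> {}"
  have *: "fold (update T A R) ts C = fold (update T A R) (filter ?P ts) C" for ts C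
    by (induction ts arbitrary: C) (auto simp: update_def)
  have "{s\<in>E. ?P s} = event_times T A R t" using assms(2,3) by (auto simp: event_times_def)
  then show ?thesis
    unfolding window_def by (subst (2) *) (simp add: filter_sorted_list_of_set assms(1))
qed

lemma window_mono:
  assumes "locally_finite S'" "locally_finite T" "locally_finite A" "S \<subseteq> S'" "T' \<subseteq> T"
  shows "window S T A R t \<subseteq> window S' T' A R t"
proof -
  let ?E = "event_times T A R t"
  have E: "finite ?E" "?E \<subseteq> {0<..t}" "event_times T' A R t \<subseteq> ?E"
    using finite_event_times[OF assms(2,3)] assms(5) by (auto simp: event_times_def)
  have "finite (S' \<inter> {0<..R})" using assms(1) by (auto simp: locally_finite_def)
  then show ?thesis
    unfolding window_eq_fold[OF E(1) order_refl E(2)] window_eq_fold[OF E(1,3,2)]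
    using assms by (intro fold_update_mono) auto
qed

lemma hammersley_mono:
  assumes "locally_finite S'" "locally_finite T" "locally_finite A" "S \<subseteq> S'" "T' \<subseteq> T"
  shows "hammersley S T A t \<subseteq> hammersley S' T' A t"
  unfolding hammersley_def using window_mono[OF assms] by blast

lemma locally_finite_subset: "locally_finite X \<Longrightarrow> Y \<subseteq> X \<Longrightarrow> locally_finite Y"
  unfolding locally_finite_def by (meson Int_mono finite_subset order_refl)

lemma locally_finite_empty [simp]: "locally_finite {}"
  by (simp add: locally_finite_def)

lemma locally_finite_Un: "locally_finite X \<Longrightarrow> locally_finite Y \<Longrightarrow> locally_finite (X \<union> Y)"
  by (simp add: locally_finite_def Int_Un_distrib2)

section \<open>Counting functions\<close>

abbreviation cnt :: "real set \<Rightarrow> real \<Rightarrow> nat" where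
  "cnt C x \<equiv> card (C \<inter> {0<..x})"

definition pull :: "real \<Rightarrow> (real \<Rightarrow> nat) \<Rightarrow> real \<Rightarrow> nat" where
  "pull u N x = (if x < u then N x else max (N x) (N u + 1))"

text \<open>This differs from \<open>pull 0\<close> only at negative arguments, where it raises
  \<open>N\<close> as well. There the particle count is zero and \<open>N\<close> is the number of
  sinks so far, so \<open>cnt_sink_step\<close> becomes an equation between functions.\<close>

definition pull_sink :: "(real \<Rightarrow> nat) \<Rightarrow> real \<Rightarrow> nat" where
  "pull_sink N x = max (N x) (N 0 + 1)"

definition pull_update ::
    "real set \<Rightarrow> (real \<times> real) set \<Rightarrow> real \<Rightarrow> real \<Rightarrow> (real \<Rightarrow> nat) \<Rightarrow> real \<Rightarrow> nat" where
  "pull_update T A R s N =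
     fold pull (sorted_list_of_set (alpha_at A R s)) (if s \<in> T then pull_sink N else N)"

text \<open>If some particle lies in \<open>(u, x]\<close>, the removed one lies there and the count
  drops by one; otherwise the counts at \<open>u\<close> and \<open>x\<close> agree and nothing
  changes. When the subtraction truncates, the second argument of the maximum takes over.\<close>

lemma cnt_remove_next:
  assumes "finite C" "C \<subseteq> {0<..}" "0 \<le> u" "u \<le> x"
  shows "cnt (remove_next u C) x = max (cnt C x - 1) (cnt C u)"
proof -
  have split: "C \<inter> {0<..x} = C \<inter> {0<..u} \<union> C \<inter> {u<..x}" using assms(3,4) by auto
  have card_split: "cnt C x = cnt C u + card (C \<inter> {u<..x})"
    unfolding split by (rule card_Un_disjoint) (use assms in auto)
  show ?thesis
  proof (cases "\<exists>p\<in>C. u < p \<and> p \<le> x")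
    case True
    then obtain q where q: "q \<in> C" "u < q" "q \<le> x" by auto
    let ?m = "Min {p\<in>C. u < p}"
    have m: "?m \<in> {p\<in>C. u < p}" using assms q by (intro Min_in) auto
    have "?m \<le> q" using assms q by (intro Min_le) auto
    with m q have mx: "?m \<in> C \<inter> {0<..x}" using assms(3) by auto
    have "remove_next u C = C - {?m}" using q by (auto simp: remove_next_def)
    then have "remove_next u C \<inter> {0<..x} = C \<inter> {0<..x} - {?m}" by auto
    then have "cnt (remove_next u C) x = cnt C x - 1" using mx assms(1) by simp
    moreover have "card (C \<inter> {u<..x}) > 0" using q assms(1) by (auto simp: card_gt_0_iff)
    ultimately show ?thesis using card_split by simp
  next
    case False
    have "remove_next u C \<inter> {0<..x} = C \<inter> {0<..x}"
    proof (cases "\<exists>p\<in>C. u < p")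
      case True
      then have "Min {p\<in>C. u < p} \<in> {p\<in>C. u < p}" using assms by (intro Min_in) auto
      with False have "x < Min {p\<in>C. u < p}" by auto
      then show ?thesis unfolding remove_next_def by auto
    qed (auto simp: remove_next_def)
    moreover have "C \<inter> {u<..x} = {}" using False by auto
    ultimately show ?thesis using card_split by simp
  qed
qed

lemma cnt_remove_next_left:
  assumes "finite C" "x \<le> u"
  shows "remove_next u C \<inter> {0<..x} = C \<inter> {0<..x}"
proof (cases "\<exists>p\<in>C. u < p")
  case True
  then have "Min {p\<in>C. u < p} \<in> {p\<in>C. u < p}" using assms by (intro Min_in) auto
  then show ?thesis using assms(2) by (auto simp: remove_next_def)
qed (auto simp: remove_next_def)

lemma cnt_mono: "finite C \<Longrightarrow> u \<le> x \<Longrightarrow> cnt C u \<le> cnt C x"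
  by (intro card_mono) auto

text \<open>Inserting \<open>u\<close> adds one to the maximum of \<open>cnt_remove_next\<close> for
  \<open>x \<ge> u\<close>, which gives the maximum in \<open>pull\<close>. The insertion counts
  only if the site was free; this is where coinciding positions have to be excluded.\<close>

lemma cnt_alpha_step:
  assumes "finite C" "C \<subseteq> {0<..}" "0 < u" "u \<notin> C"
  shows "(\<lambda>x. cnt (alpha_step u C) x + k) = pull u (\<lambda>x. cnt C x + k)"
proof
  fix x
  have fin: "finite (remove_next u C)" using assms remove_next_props by auto
  have nu: "u \<notin> remove_next u C" using assms(4) remove_next_subset by blast
  show "cnt (alpha_step u C) x + k = pull u (\<lambda>x. cnt C x + k) x"
  proof (cases "x < u")
    case True
    then have "alpha_step u C \<inter> {0<..x} = remove_next u C \<inter> {0<..x}"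
      by (auto simp: alpha_step_def)
    then show ?thesis using True cnt_remove_next_left[OF assms(1), of x u] by (simp add: pull_def)
  next
    case False
    then have "alpha_step u C \<inter> {0<..x} = insert u (remove_next u C \<inter> {0<..x})"
      using assms(3) by (auto simp: alpha_step_def)
    then have "cnt (alpha_step u C) x = Suc (cnt (remove_next u C) x)" using fin nu by simp
    then show ?thesis
      using False assms cnt_remove_next[OF assms(1,2), of u x] cnt_mono[OF assms(1), of u x]
      by (simp add: pull_def)
  qed
qed

lemma cnt_sink_step:
  assumes "finite C" "C \<subseteq> {0<..}"
  shows "(\<lambda>x. cnt (sink_step C) x + Suc k) = pull_sink (\<lambda>x. cnt C x + k)"
proof
  fix x
  show "cnt (sink_step C) x + Suc k = pull_sink (\<lambda>x. cnt C x + k) x"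
  proof (cases "0 \<le> x")
    case True
    then show ?thesis
      using cnt_remove_next[OF assms order_refl True] by (simp add: pull_sink_def sink_step_def)
  qed (simp add: pull_sink_def)
qed

lemma alpha_step_subset: "alpha_step u C \<subseteq> insert u C"
  using remove_next_subset by (auto simp: alpha_step_def)

lemma fold_alpha_step_subset: "fold alpha_step us C \<subseteq> set us \<union> C"
proof (induction us arbitrary: C)
  case (Cons u us)
  then show ?case using alpha_step_subset[of u C] by fastforce
qed simp

lemma cnt_fold_alpha_step:
  assumes "finite C" "C \<subseteq> {0<..}" "set us \<subseteq> {0<..}" "distinct us" "set us \<inter> C = {}"
  shows "(\<lambda>x. cnt (fold alpha_step us C) x + k) = fold pull us (\<lambda>x. cnt C x + k)"
  using assms
proof (induction us arbitrary: C)
  case (Cons u us)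
  have "finite (alpha_step u C)" "alpha_step u C \<subseteq> {0<..}" "set us \<inter> alpha_step u C = {}"
    using Cons.prems finite_subset[OF alpha_step_subset[of u C]] alpha_step_subset[of u C] by auto
  with Cons show ?case using cnt_alpha_step[of C u k] by simp
qed simp

lemma update_subset:
  assumes "locally_finite A"
  shows "update T A R s C \<subseteq> alpha_at A R s \<union> C"
proof -
  have "(if s \<in> T then sink_step C else C) \<subseteq> C"
    using remove_next_subset by (auto simp: sink_step_def)
  then show ?thesis
    unfolding update_def
    using fold_alpha_step_subset[of "sorted_list_of_set (alpha_at A R s)"] finite_alpha_at[OF assms]
    by fastforce
qed

lemma cnt_update:
  assumes "locally_finite A" "finite C" "C \<subseteq> {0<..}" "alpha_at A R s \<inter> C = {}"
  shows "(\<lambda>x. cnt (update T A R s C) x + (k + of_bool (s \<in> T))) =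
    pull_update T A R s (\<lambda>x. cnt C x + k)"
proof -
  let ?C = "if s \<in> T then sink_step C else C"
  have C: "finite ?C" "?C \<subseteq> {0<..}" "?C \<subseteq> C"
    using assms remove_next_props[of C 0] remove_next_subset by (auto simp: sink_step_def)
  have "(\<lambda>x. cnt (update T A R s C) x + (k + of_bool (s \<in> T))) =
    fold pull (sorted_list_of_set (alpha_at A R s)) (\<lambda>x. cnt ?C x + (k + of_bool (s \<in> T)))"
    unfolding update_def using C assms finite_alpha_at[OF assms(1), of R s]
    by (intro cnt_fold_alpha_step) (auto simp: alpha_at_def)
  also have "(\<lambda>x. cnt ?C x + (k + of_bool (s \<in> T))) =
      (if s \<in> T then pull_sink (\<lambda>x. cnt C x + k) else (\<lambda>x. cnt C x + k))"
    using cnt_sink_step[OF assms(2,3)] by simp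
  finally show ?thesis by (simp add: pull_update_def)
qed

text \<open>The offset \<open>k\<close> grows with each sink processed, so particles plus sinks obey
  an autonomous recursion. The last two assumptions keep every \<alpha>-point off the occupied
  sites, which are points of the initial \<open>C\<close> or abscissae of \<alpha>-points already
  processed.\<close>

lemma cnt_fold_update:
  assumes "locally_finite A" "finite C" "C \<subseteq> {0<..}" "distinct ts"
    and "\<And>s. alpha_at A R s \<inter> C = {}"
    and "\<And>s s'. s \<noteq> s' \<Longrightarrow> alpha_at A R s \<inter> alpha_at A R s' = {}"
  shows "(\<lambda>x. cnt (fold (update T A R) ts C) x + (k + card (T \<inter> set ts))) =
    fold (pull_update T A R) ts (\<lambda>x. cnt C x + k)"
proof -
  \<comment> \<open>The induction asks for disjointness only at times still to be processed: after
    the step at \<open>s\<close> the configuration itself contains positions from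
    \<open>alpha_at A R s\<close>.\<close>
  have "(\<lambda>x. cnt (fold (update T A R) ts C) x + (k + card (T \<inter> set ts))) =
    fold (pull_update T A R) ts (\<lambda>x. cnt C x + k)"
    if "\<And>s. s \<in> set ts \<Longrightarrow> alpha_at A R s \<inter> C = {}"
    using assms(2-4) that
  proof (induction ts arbitrary: C k)
    case (Cons s ts)
    let ?C = "update T A R s C"
    have C: "finite ?C" "?C \<subseteq> {0<..}"
      using update_restrict[OF assms(1) Cons.prems(1,2) order_refl] by auto
    have disj: "alpha_at A R s' \<inter> ?C = {}" if s': "s' \<in> set ts" for s'
    proof -
      have "s \<noteq> s'" using s' Cons.prems by auto
      then show ?thesis
        using assms(6)[of s s'] Cons.prems(4)[of s'] s' update_subset[OF assms(1), of T R s C]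
        by auto
    qed
    have "card (T \<inter> set (s # ts)) = of_bool (s \<in> T) + card (T \<inter> set ts)"
      using Cons.prems(3) by (cases "s \<in> T") auto
    then show ?case
      using Cons.IH[OF C _ disj, of "k + of_bool (s \<in> T)"] Cons.prems cnt_update[OF assms(1) Cons.prems(1,2), of R s T k]
      by (simp add: add.assoc)
  qed simp
  then show ?thesis using assms(5) by simp
qed

lemma pull_mono:
  assumes "N \<le> N'"
  shows "pull u N \<le> pull u N'"
proof (rule le_funI)
  fix x
  show "pull u N x \<le> pull u N' x"
    using assms[THEN le_funD, of x] assms[THEN le_funD, of u] by (auto simp: pull_def max_def)
qed

lemma fold_pull_mono: "N \<le> N' \<Longrightarrow> fold pull us N \<le> fold pull us N'"
  by (induction us arbitrary: N N') (auto simp: pull_mono)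

lemma pull_update_mono:
  assumes "N \<le> N'" "T \<subseteq> T'"
  shows "pull_update T A R s N \<le> pull_update T' A R s N'"
  unfolding pull_update_def
proof (rule fold_pull_mono)
  show "(if s \<in> T then pull_sink N else N) \<le> (if s \<in> T' then pull_sink N' else N')"
  proof (rule le_funI)
    fix x
    show "(if s \<in> T then pull_sink N else N) x \<le> (if s \<in> T' then pull_sink N' else N') x"
      using assms(1)[THEN le_funD, of x] assms(1)[THEN le_funD, of 0] assms(2)
      by (auto simp: pull_sink_def max_def)
  qed
qed

lemma fold_pull_update_mono:
  "N \<le> N' \<Longrightarrow> T \<subseteq> T' \<Longrightarrow> fold (pull_update T A R) ts N \<le> fold (pull_update T' A R) ts N'"
  by (induction ts arbitrary: N N') (auto simp: pull_update_mono)

text \<open>\<open>pull u\<close> commutes with pointwise maxima (it is linear in the max-plus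
  sense), so a bound by a maximum survives each step.\<close>

lemma fold_pull_max:
  assumes "\<And>x. N x \<le> max (N1 x) (N2 x)"
  shows "fold pull us N x \<le> max (fold pull us N1 x) (fold pull us N2 x)"
  using assms
proof (induction us arbitrary: N N1 N2)
  case (Cons u us)
  have "pull u N x \<le> max (pull u N1 x) (pull u N2 x)" for x
    using Cons.prems[of x] Cons.prems[of u] by (auto simp: pull_def max_def split: if_splits)
  with Cons.IH show ?case by simp
qed simp

lemma fold_pull_0: "set us \<subseteq> {0<..} \<Longrightarrow> fold pull us N 0 = N 0"
  by (induction us arbitrary: N) (auto simp: pull_def)

lemma pull_update_0:
  "locally_finite A \<Longrightarrow> pull_update T A R s N 0 = (if s \<in> T then N 0 + 1 else N 0)"
  unfolding pull_update_def using finite_alpha_at[of A R s]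
  by (subst fold_pull_0) (auto simp: pull_sink_def, auto simp: alpha_at_def)

text \<open>Each path counted by the last passage time leaves the axes through a source or through a
  sink, so one of the two kinds of boundary points may be dropped.\<close>

lemma fold_pull_update_max:
  assumes "locally_finite A" "\<And>x. N x \<le> max (N1 x) (N2 x)" "N 0 \<le> N2 0"
  shows "fold (pull_update T A R) ts N x \<le>
    max (fold (pull_update {} A R) ts N1 x) (fold (pull_update T A R) ts N2 x)"
  using assms(2,3)
proof (induction ts arbitrary: N N1 N2)
  case (Cons s ts)
  \<comment> \<open>The new term \<open>N 0 + 1\<close> is at most \<open>N2 0 + 1\<close>, hence
    absorbed by \<open>N2\<close> alone; this is why \<open>N1\<close> may evolve without
    sinks.\<close>
  have "(if s \<in> T then pull_sink N else N) x \<le> max (N1 x) ((if s \<in> T then pull_sink N2 else N2) x)" for x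
    using Cons.prems(1)[of x] Cons.prems(2) by (auto simp: pull_sink_def max_def split: if_splits)
  then have "pull_update T A R s N x \<le> max (pull_update {} A R s N1 x) (pull_update T A R s N2 x)" for x
    unfolding pull_update_def using fold_pull_max by simp
  moreover have "pull_update T A R s N 0 \<le> pull_update T A R s N2 0"
    using Cons.prems(2) by (simp add: pull_update_0 assms(1))
  ultimately show ?case using Cons.IH by simp
qed simp

section \<open>Last passage times\<close>

definition no_ties :: "real set \<Rightarrow> (real \<times> real) set \<Rightarrow> bool" where
  "no_ties S A \<longleftrightarrow> (\<forall>(u, s)\<in>A. u \<notin> S \<and> (\<forall>s'. (u, s') \<in> A \<longrightarrow> s' = s))"

definition passage :: "real set \<Rightarrow> real set \<Rightarrow> (real \<times> real) set \<Rightarrow> real \<Rightarrow> real \<Rightarrow> nat" where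
  "passage S T A x t = hammersley_count S T A x t + card (T \<inter> {0<..t})"

text \<open>Particles and counting functions treat simultaneous events in the same order, so
  \<open>no_ties\<close> speaks about positions only. The set \<open>E\<close> may contain further
  times, which lets passage times with different sinks share one list.\<close>

lemma passage_eq_fold:
  assumes "locally_finite S" "locally_finite T" "locally_finite A" "no_ties S A" "0 < x"
    and E: "finite E" "event_times T A x t \<subseteq> E" "E \<subseteq> {0<..t}"
  shows "passage S T A x t =
    fold (pull_update T A x) (sorted_list_of_set E) (cnt (S \<inter> {0<..x})) x"
proof -
  have C: "finite (S \<inter> {0<..x})" "S \<inter> {0<..x} \<subseteq> {0<..}"
    using assms(1) by (auto simp: locally_finite_def)
  have "T \<inter> E = T \<inter> {0<..t}" using E by (auto simp: event_times_def)
  moreover have "hammersley_count S T A x t = cnt (window S T A x t) x"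
    unfolding hammersley_count_def hammersley_Int_window[OF assms(1-3,5), of t, symmetric]
    by (simp add: Int_assoc)
  moreover have "(\<lambda>y. cnt (fold (update T A x) (sorted_list_of_set E) (S \<inter> {0<..x})) y
      + (0 + card (T \<inter> set (sorted_list_of_set E)))) =
    fold (pull_update T A x) (sorted_list_of_set E) (\<lambda>y. cnt (S \<inter> {0<..x}) y + 0)"
    by (rule cnt_fold_update) (use assms(3,4) C in \<open>auto simp: no_ties_def alpha_at_def\<close>)
  ultimately show ?thesis
    unfolding passage_def window_eq_fold[OF E]
    using E(1) by (auto dest: fun_cong[of _ _ x])
qed

lemma passage_mono:
  assumes "locally_finite S'" "locally_finite T'" "locally_finite A" "no_ties S' A" "0 < x"
    and "S \<subseteq> S'" "T \<subseteq> T'"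
  shows "passage S T A x t \<le> passage S' T' A x t"
proof -
  let ?E = "event_times T' A x t"
  have E: "finite ?E" "?E \<subseteq> {0<..t}" "event_times T A x t \<subseteq> ?E"
    using finite_event_times[OF assms(2,3)] assms(7) by (auto simp: event_times_def)
  have S: "locally_finite S" "locally_finite T" "no_ties S A"
    using assms locally_finite_subset by (auto simp: no_ties_def)
  have fin: "finite (S' \<inter> {0<..x})" using assms(1) by (auto simp: locally_finite_def)
  have "cnt (S \<inter> {0<..x}) \<le> cnt (S' \<inter> {0<..x})"
    unfolding le_fun_def using assms(6) fin by (auto intro!: card_mono)
  then show ?thesis
    unfolding passage_eq_fold[OF S(1,2) assms(3) S(3) assms(5) E(1,3,2)]
      passage_eq_fold[OF assms(1-5) E(1) order_refl E(2)]
    using fold_pull_update_mono[OF _ assms(7)] by (simp add: le_fun_def)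
qed

lemma passage_le_max:
  assumes "locally_finite S" "locally_finite T" "locally_finite A" "no_ties S A" "0 < x"
  shows "passage S T A x t \<le> max (passage S {} A x t) (passage {} T A x t)"
proof -
  let ?E = "event_times T A x t"
  have E: "finite ?E" "?E \<subseteq> {0<..t}" "event_times {} A x t \<subseteq> ?E"
    using finite_event_times[OF assms(2,3)] by (auto simp: event_times_def)
  have g: "no_ties {} A" using assms(4) by (auto simp: no_ties_def)
  show ?thesis
    unfolding passage_eq_fold[OF assms E(1) order_refl E(2)]
      passage_eq_fold[OF assms(1) locally_finite_empty assms(3-5) E(1,3,2)]
      passage_eq_fold[OF locally_finite_empty assms(2,3) g assms(5) E(1) order_refl E(2)]
    by (rule fold_pull_update_max) (auto simp: assms)
qed

section \<open>Discretization\<close>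

definition cell :: "real \<Rightarrow> nat \<Rightarrow> real set" where
  "cell h i = {h * real i<..h * real (Suc i)}"

definition bits :: "real \<Rightarrow> nat \<Rightarrow> real set \<Rightarrow> bool list" where
  "bits h n C = map (\<lambda>i. C \<inter> cell h i \<noteq> {}) [0..<n]"

definition resolves :: "real \<Rightarrow> real set \<Rightarrow> bool" where
  "resolves h P \<longleftrightarrow> (\<forall>k. \<forall>p\<in>P \<inter> cell h k. \<forall>q\<in>P \<inter> cell h k. p = q)"

text \<open>A cell is represented by its right end point. For particles in distinct cells an error
  therefore requires a particle within distance \<open>h\<close> of the frontier of
  \<open>I\<close>.\<close>

definition cell_count :: "real \<Rightarrow> nat \<Rightarrow> real set \<Rightarrow> bool list \<Rightarrow> nat" where
  "cell_count h n I bs = card {i. i < n \<and> bs ! i \<and> h * real (Suc i) \<in> I}"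

text \<open>A row of cells is traversed from left to right; \<open>v\<close> is the number of particles that the
  sink and the \<open>\<alpha>\<close>-points met so far in this row still pull to the left.\<close>

fun row_step :: "bool list \<Rightarrow> nat \<Rightarrow> bool list \<Rightarrow> bool list" where
  "row_step (b # bs) v (a # as) =
     (a \<or> b \<and> v = 0) # row_step bs (v - of_bool b + of_bool a) as"
| "row_step _ _ _ = []"

text \<open>The list \<open>ys\<close> comes in rows of \<open>Suc n\<close> bits, the first for a
  sink and the others for the \<alpha>-points of the row.\<close>

fun run :: "nat \<Rightarrow> nat \<Rightarrow> bool list \<Rightarrow> bool list \<Rightarrow> bool list" where
  "run n (Suc k) bs (y # ys) = run n k (row_step bs (of_bool y) (take n ys)) (drop n ys)"
| "run n _ bs _ = bs"

lemma length_bits [simp]: "length (bits h n C) = n"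
  by (simp add: bits_def)

lemma length_row [simp]: "length (row_step bs v as) = min (length bs) (length as)"
  by (induction bs v as rule: row_step.induct) auto

lemma cell_less:
  assumes "0 < h" "p \<in> cell h i" "q \<in> cell h j" "i < j"
  shows "p < q"
proof -
  have "h * real (Suc i) \<le> h * real j" using assms by (intro mult_left_mono) auto
  moreover have "p \<le> h * real (Suc i)" "h * real j < q" using assms(2,3) by (auto simp: cell_def)
  ultimately show ?thesis by linarith
qed

lemma cell_disjoint: "0 < h \<Longrightarrow> i \<noteq> j \<Longrightarrow> cell h i \<inter> cell h j = {}"
  using cell_less[of h _ i _ j] cell_less[of h _ j _ i] by (meson disjoint_iff linorder_neqE_nat order_less_irrefl)

lemma ex_cell:
  assumes "0 < h" "0 < p" "p \<le> h * real n"
  obtains i where "i < n" "p \<in> cell h i"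
proof -
  \<comment> \<open>Cells are open on the left and closed on the right, so the ceiling gives the
    correct cell also at multiples of \<open>h\<close>.\<close>
  define m where "m = \<lceil>p / h\<rceil>"
  have m: "real_of_int m - 1 < p / h" "p / h \<le> real_of_int m"
    unfolding m_def by linarith+
  have "0 < m" using m(2) divide_pos_pos[OF assms(2,1)] by linarith
  have "p / h \<le> real n" using assms by (simp add: field_simps)
  then have "m \<le> int n" unfolding m_def by (simp add: ceiling_le_iff)
  have *: "real (nat (m - 1)) = real_of_int m - 1" using \<open>0 < m\<close> by simp
  show ?thesis
  proof
    show "nat (m - 1) < n" using \<open>0 < m\<close> \<open>m \<le> int n\<close> by linarith
    show "p \<in> cell h (nat (m - 1))"
      using m assms(1) * by (auto simp: cell_def field_simps)
  qed
qed

lemma cell_subset: "0 < h \<Longrightarrow> i < n \<Longrightarrow> cell h i \<subseteq> {0<..h * real n}"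
proof -
  assume *: "0 < h" "i < n"
  then have "h * real (Suc i) \<le> h * real n" by (intro mult_left_mono) auto
  moreover have "0 \<le> h * real i" using * by simp
  ultimately show ?thesis unfolding cell_def by auto
qed

lemma cell_dist: "p \<in> cell h k \<Longrightarrow> q \<in> cell h k \<Longrightarrow> \<bar>p - q\<bar> \<le> h"
  by (auto simp: cell_def algebra_simps abs_if)

lemma cell_dist_right: "0 \<le> h \<Longrightarrow> p \<in> cell h k \<Longrightarrow> \<bar>h * real (Suc k) - p\<bar> \<le> h"
  by (auto simp: cell_def algebra_simps abs_if)

lemma resolves_subset: "resolves h P \<Longrightarrow> Q \<subseteq> P \<Longrightarrow> resolves h Q"
  unfolding resolves_def by blast

lemma eventually_resolves:
  assumes "finite P"
  shows "\<forall>\<^sub>F n in sequentially. resolves (R / real n) P"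
proof -
  have lim: "(\<lambda>n. R / real n) \<longlonglongrightarrow> 0" by (rule lim_const_over_n)
  have "\<forall>\<^sub>F n in sequentially. p \<noteq> q \<longrightarrow> R / real n < \<bar>p - q\<bar>" for p q :: real
    using order_tendstoD(2)[OF lim, of "\<bar>p - q\<bar>"] by (cases "p = q") auto
  then have "\<forall>\<^sub>F n in sequentially. \<forall>p\<in>P. \<forall>q\<in>P. p \<noteq> q \<longrightarrow> R / real n < \<bar>p - q\<bar>"
    by (intro eventually_ball_finite assms ballI)
  then show ?thesis
  proof eventually_elim
    case (elim n)
    have "\<bar>p - q\<bar> \<le> R / real n" if "p \<in> cell (R / real n) k" "q \<in> cell (R / real n) k" for p q k
      using that by (rule cell_dist)
    with elim show ?case unfolding resolves_def by (metis IntD1 IntD2 leD)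
  qed
qed

lemma cell_count_bits:
  assumes "0 < h" "finite C" "C \<subseteq> {0<..h * real n}" "resolves h C"
    and I: "\<And>p i. p \<in> C \<Longrightarrow> p \<in> cell h i \<Longrightarrow> h * real (Suc i) \<in> I \<longleftrightarrow> p \<in> I"
  shows "cell_count h n I (bits h n C) = card (C \<inter> I)"
proof -
  have "\<forall>p\<in>C. \<exists>i. i < n \<and> p \<in> cell h i" using assms(1,3) ex_cell by (metis greaterThanAtMost_iff subsetD)
  then obtain idx where idx: "\<And>p. p \<in> C \<Longrightarrow> idx p < n" "\<And>p. p \<in> C \<Longrightarrow> p \<in> cell h (idx p)"
    by metis
  have uniq: "i = idx p" if "p \<in> C" "p \<in> cell h i" for p i
    using cell_disjoint[OF assms(1), of i "idx p"] idx(2)[OF that(1)] that(2) by auto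
  have "{i. i < n \<and> bits h n C ! i \<and> h * real (Suc i) \<in> I} = idx ` (C \<inter> I)" (is "?A = ?B")
  proof (intro set_eqI iffI)
    fix i assume "i \<in> ?A"
    then obtain p where p: "p \<in> C" "p \<in> cell h i" "h * real (Suc i) \<in> I" by (auto simp: bits_def)
    then have "p \<in> I" using I by blast
    then show "i \<in> ?B" using p uniq by blast
  next
    fix i assume "i \<in> ?B"
    then obtain p where p: "p \<in> C" "p \<in> I" "i = idx p" by auto
    then show "i \<in> ?A" using idx I[OF p(1) idx(2)[OF p(1)]] by (auto simp: bits_def)
  qed
  moreover have "inj_on idx (C \<inter> I)"
  proof (rule inj_onI)
    fix p q assume "p \<in> C \<inter> I" "q \<in> C \<inter> I" "idx p = idx q"
    then have "p \<in> C \<inter> cell h (idx p)" "q \<in> C \<inter> cell h (idx p)" using idx(2)[of p] idx(2)[of q] by auto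
    then show "p = q" using assms(4) unfolding resolves_def by blast
  qed
  ultimately show ?thesis unfolding cell_count_def by (simp add: card_image)
qed

text \<open>Off the frontier each particle has a neighbourhood inside \<open>I\<close> or inside its
  complement, and for a fine mesh the right end of its cell falls into it. Particles on the frontier
  are excluded almost surely later.\<close>

lemma eventually_cell_count_bits:
  assumes "0 < R" "finite C" "C \<subseteq> {0<..R}" "C \<inter> frontier I = {}"
  shows "\<forall>\<^sub>F n in sequentially.
    cell_count (R / real n) n I (bits (R / real n) n C) = card (C \<inter> I)"
proof -
  have lim: "(\<lambda>n. R / real n) \<longlonglongrightarrow> 0" by (rule lim_const_over_n)
  have "\<forall>\<^sub>F n in sequentially. \<forall>q. \<bar>q - p\<bar> \<le> R / real n \<longrightarrow> (q \<in> I \<longleftrightarrow> p \<in> I)" if "p \<in> C" for p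
  proof -
    have "p \<in> interior I \<or> p \<in> interior (- I)"
      using assms(4) that unfolding interior_complement frontier_def by blast
    then obtain e where "e > 0" "ball p e \<subseteq> I \<or> ball p e \<subseteq> - I" unfolding mem_interior by blast
    then have "\<exists>e>0. \<forall>q. \<bar>q - p\<bar> < e \<longrightarrow> (q \<in> I \<longleftrightarrow> p \<in> I)"
      by (intro exI[of _ e]) (auto simp: dist_real_def abs_minus_commute subset_iff)
    then obtain e where e: "e > 0" "\<And>q. \<bar>q - p\<bar> < e \<Longrightarrow> (q \<in> I \<longleftrightarrow> p \<in> I)" by auto
    show ?thesis
      using order_tendstoD(2)[OF lim e(1)]
    proof eventually_elim
      case (elim n)
      then show ?case using e(2) le_less_trans by blast
    qed
  qed
  then have "\<forall>\<^sub>F n in sequentially. \<forall>p\<in>C. \<forall>q. \<bar>q - p\<bar> \<le> R / real n \<longrightarrow> (q \<in> I \<longleftrightarrow> p \<in> I)"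
    by (intro eventually_ball_finite assms ballI)
  with eventually_resolves[OF assms(2), of R] eventually_gt_at_top[of 0] show ?thesis
  proof eventually_elim
    case (elim n)
    let ?h = "R / real n"
    have h: "0 < ?h" "?h * real n = R" using assms(1) elim by auto
    show ?case
    proof (rule cell_count_bits[OF h(1) assms(2) _ elim(1)])
      show "C \<subseteq> {0<..?h * real n}" using assms(3) h by simp
      fix p i assume p: "p \<in> C" "p \<in> cell ?h i"
      then have "\<bar>?h * real (Suc i) - p\<bar> \<le> ?h" using h by (intro cell_dist_right) auto
      then show "?h * real (Suc i) \<in> I \<longleftrightarrow> p \<in> I" using elim p by blast
    qed
  qed
qed

section \<open>Exactness of the grid dynamics\<close>

lemma remove_next_cong:
  assumes "C \<subseteq> {u<..}" "C \<subseteq> {u'<..}"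
  shows "remove_next u C = remove_next u' C"
proof -
  have "{p\<in>C. u < p} = {p\<in>C. u' < p}" using assms by auto
  moreover from this have "(\<exists>p\<in>C. u < p) \<longleftrightarrow> (\<exists>p\<in>C. u' < p)" by blast
  ultimately show ?thesis unfolding remove_next_def by (simp only:)
qed

lemma funpow_remove_next_subset: "(remove_next u ^^ v) C \<subseteq> C"
proof (induction v)
  case (Suc v)
  have "(remove_next u ^^ Suc v) C \<subseteq> (remove_next u ^^ v) C"
    unfolding funpow.simps comp_apply by (rule remove_next_subset)
  then show ?case using Suc.IH by (rule subset_trans)
qed simp

lemma funpow_remove_next_cong:
  assumes "C \<subseteq> {u<..}" "C \<subseteq> {u'<..}"
  shows "(remove_next u ^^ v) C = (remove_next u' ^^ v) C"
proof (induction v)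
  case (Suc v)
  have *: "(remove_next u' ^^ v) C \<subseteq> {u<..}" "(remove_next u' ^^ v) C \<subseteq> {u'<..}"
    using funpow_remove_next_subset[of v u' C] assms by (blast intro: subset_trans)+
  show ?case
    unfolding funpow.simps comp_apply Suc by (rule remove_next_cong[OF *])
qed simp

lemma alpha_step_Un_left:
  assumes "E \<subseteq> {..<u}" "finite X"
  shows "alpha_step u (E \<union> X) = E \<union> alpha_step u X"
proof -
  have *: "{p \<in> E \<union> X. u < p} = {p \<in> X. u < p}" using assms by auto
  have "Min {p \<in> X. u < p} \<notin> E" if "{p \<in> X. u < p} \<noteq> {}"
    using Min_in[OF _ that] assms by auto
  then show ?thesis using assms unfolding alpha_step_def remove_next_def * by auto
qed

lemma fold_alpha_step_Un_left:
  assumes "E \<subseteq> {..w}" "set us \<subseteq> {w<..}" "finite X"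
  shows "fold alpha_step us (E \<union> X) = E \<union> fold alpha_step us X"
  using assms(2,3)
proof (induction us arbitrary: X)
  case (Cons u us)
  have "E \<subseteq> {..<u}" using assms(1) Cons.prems by auto
  then have "alpha_step u (E \<union> X) = E \<union> alpha_step u X"
    using Cons.prems by (intro alpha_step_Un_left)
  moreover have "finite (alpha_step u X)"
    using finite_subset[OF alpha_step_subset] Cons.prems by auto
  ultimately show ?case using Cons by simp
qed simp

text \<open>There are \<open>v\<close> pending pulls at the left end \<open>w\<close> of a cell with
  at most one particle. The first pull uses up that particle, and the others act unchanged from the
  right end \<open>w'\<close>. Truncated subtraction covers \<open>v = 0\<close>, where the particle
  stays.\<close>

lemma funpow_remove_next_split:
  assumes "finite D" "D \<subseteq> {w<..}" "w < w'" "card (D \<inter> {..w'}) \<le> 1"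
  shows "(remove_next w ^^ v) D = (if v = 0 then D \<inter> {..w'} else {}) \<union>
    (remove_next w' ^^ (v - of_bool (D \<inter> {..w'} \<noteq> {}))) (D \<inter> {w'<..})"
proof (cases "D \<inter> {..w'} = {}")
  case True
  then have "D \<inter> {w'<..} = D" by force
  moreover from this have "(remove_next w ^^ v) D = (remove_next w' ^^ v) D"
    using assms(2) by (intro funpow_remove_next_cong) auto
  ultimately show ?thesis using True by simp
next
  case False
  moreover have "finite (D \<inter> {..w'})" using assms(1) by simp
  ultimately have "card (D \<inter> {..w'}) = 1" using assms(4) by (simp add: card_gt_0_iff le_Suc_eq)
  then obtain p where p: "D \<inter> {..w'} = {p}" by (auto simp: card_1_singleton_iff)
  define E where "E = D \<inter> {w'<..}"
  have "D = D \<inter> {..w'} \<union> E" by (auto simp: E_def)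
  then have D: "D = insert p E" unfolding p by simp
  have "p \<in> D \<inter> {..w'}" using p by simp
  then have pw: "w < p" "p \<le> w'" using assms(2) by auto
  have E: "p \<notin> E" "\<And>y. y \<in> E \<Longrightarrow> p < y" "E \<subseteq> {w<..}" "E \<subseteq> {w'<..}" "finite E"
    using pw assms(1,3) by (auto simp: E_def)
  show ?thesis
  proof (cases v)
    case 0
    then show ?thesis by auto
  next
    case (Suc k)
    have "{q \<in> insert p E. w < q} = insert p E" using E pw by auto
    moreover have "Min (insert p E) = p" using E by (intro Min_eqI) (auto simp: less_imp_le)
    moreover have "\<exists>q\<in>insert p E. w < q" using pw by auto
    moreover have "insert p E - {p} = E" using E(1) by auto
    ultimately have "remove_next w D = E" unfolding D remove_next_def by simp
    then have "(remove_next w ^^ v) D = (remove_next w ^^ k) E"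
      by (simp add: Suc funpow_Suc_right del: funpow.simps)
    also have "\<dots> = (remove_next w' ^^ k) E"
      by (rule funpow_remove_next_cong[OF E(3,4)])
    finally show ?thesis using p Suc by (simp add: E_def)
  qed
qed

text \<open>\<open>resolves\<close> forbids two distinct points in a cell but lets an \<alpha>-point
  fall onto a particle. The two then merge and the \<alpha>-point still pulls from the right, in
  agreement with \<open>row_step\<close>.\<close>

lemma alpha_step_Un_right:
  assumes "Y \<subseteq> {u}" "Z \<subseteq> {u<..}"
  shows "alpha_step u (Y \<union> Z) = {u} \<union> remove_next u Z"
proof -
  have *: "{p \<in> Y \<union> Z. u < p} = {p \<in> Z. u < p}" "(\<exists>p\<in>Y \<union> Z. u < p) = (\<exists>p\<in>Z. u < p)"
    using assms by auto
  have "insert u (Y \<union> Z - {m}) = insert u (Z - {m})" "insert u (Y \<union> Z) = insert u Z" for m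
    using assms(1) by auto
  then show ?thesis unfolding alpha_step_def remove_next_def * by simp
qed

text \<open>One cell \<open>(w, w']\<close> is peeled off: \<open>X\<close> is what it contains
  afterwards, and all that remains of the row is the same problem with left end \<open>w'\<close>
  and the counter updated as in \<open>row_step\<close>. The at most one \<alpha>-point of the cell
  is the head of the sorted list.\<close>

lemma fold_alpha_step_split:
  assumes "finite D" "D \<subseteq> {w<..}" "set us \<subseteq> {w<..}" "w < w'" "sorted us" "distinct us"
    and one: "\<And>p q. p \<in> D \<union> set us \<Longrightarrow> q \<in> D \<union> set us \<Longrightarrow> p \<le> w' \<Longrightarrow> q \<le> w' \<Longrightarrow> p = q"
  defines "a \<equiv> set us \<inter> {..w'} \<noteq> {}" and "b \<equiv> D \<inter> {..w'} \<noteq> {}"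
  obtains us' X where "set us' = set us \<inter> {w'<..}" "sorted us'" "distinct us'"
    "X \<subseteq> {w<..w'}" "X \<noteq> {} \<longleftrightarrow> a \<or> b \<and> v = 0"
    "fold alpha_step us ((remove_next w ^^ v) D) =
      X \<union> fold alpha_step us' ((remove_next w' ^^ (v - of_bool b + of_bool a)) (D \<inter> {w'<..}))"
proof -
  let ?D1 = "D \<inter> {w'<..}"
  let ?Z = "\<lambda>k. (remove_next w' ^^ k) ?D1"
  let ?Y = "if v = 0 then D \<inter> {..w'} else {}"
  have D1: "finite ?D1" using assms(1) by simp
  have Z: "finite (?Z k)" "?Z k \<subseteq> {w'<..}" for k
    using finite_subset[OF funpow_remove_next_subset D1] funpow_remove_next_subset[of k w' ?D1] by auto
  have "card (D \<inter> {..w'}) \<le> 1"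
    using one card_le_Suc0_iff_eq[of "D \<inter> {..w'}"] assms(1) by auto
  from funpow_remove_next_split[OF assms(1,2,4) this, of v]
  have pull: "(remove_next w ^^ v) D = ?Y \<union> ?Z (v - of_bool b)" unfolding b_def .
  show thesis
  proof (cases a)
    case False
    then have us: "set us \<subseteq> {w'<..}" by (auto simp: a_def)
    have "fold alpha_step us ((remove_next w ^^ v) D) = ?Y \<union> fold alpha_step us (?Z (v - of_bool b))"
      unfolding pull using us Z(1) by (intro fold_alpha_step_Un_left) auto
    then have F: "fold alpha_step us ((remove_next w ^^ v) D) =
        ?Y \<union> fold alpha_step us (?Z (v - of_bool b + of_bool a))" using False by simp
    show thesis
    proof (rule that[OF _ assms(5,6) _ _ F])
      show "set us = set us \<inter> {w'<..}" using us by auto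
      show "?Y \<subseteq> {w<..w'}" using assms(2) by auto
      show "(?Y \<noteq> {}) = (a \<or> b \<and> v = 0)" using False by (simp add: b_def)
    qed
  next
    case True
    then obtain u us0 where us: "us = u # us0" by (cases us) (auto simp: a_def)
    have u: "w < u" "u \<le> w'"
      using True assms(3,5) by (auto simp: a_def us)
    have us0: "set us0 \<subseteq> {w'<..}"
    proof
      fix q assume q: "q \<in> set us0"
      then have "q \<noteq> u" using assms(6) us by auto
      moreover have "q = u" if "q \<le> w'"
        by (rule one) (use q us u that in simp_all)
      ultimately show "q \<in> {w'<..}" by (meson greaterThan_iff not_le)
    qed
    define Y where "Y = (if v = 0 then D \<inter> {..w'} else {})"
    have "Y \<subseteq> D \<inter> {..w'}" by (simp add: Y_def)
    moreover have "p = u" if "p \<in> D" "p \<le> w'" for p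
      by (rule one) (use us u that in simp_all)
    ultimately have Y: "Y \<subseteq> {u}" by blast
    have Zu: "?Z k \<subseteq> {u<..}" for k using Z(2)[of k] u by auto
    let ?k = "v - of_bool b"
    have "alpha_step u (Y \<union> ?Z ?k) = {u} \<union> remove_next w' (?Z ?k)"
      unfolding alpha_step_Un_right[OF Y Zu] remove_next_cong[OF Zu Z(2)] ..
    then have "fold alpha_step us ((remove_next w ^^ v) D) =
        fold alpha_step us0 ({u} \<union> ?Z (Suc ?k))"
      unfolding pull us Y_def[symmetric] by simp
    also have "\<dots> = {u} \<union> fold alpha_step us0 (?Z (Suc ?k))"
      by (rule fold_alpha_step_Un_left[OF _ us0 Z(1)]) (use u in auto)
    finally have F: "fold alpha_step us ((remove_next w ^^ v) D) =
        {u} \<union> fold alpha_step us0 (?Z (?k + of_bool a))" using True by simp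
    show thesis
    proof (rule that[OF _ _ _ _ _ F])
      show "set us0 = set us \<inter> {w'<..}" using us us0 u by auto
      show "sorted us0" "distinct us0" using assms(5,6) us by auto
      show "{u} \<subseteq> {w<..w'}" using u by simp
      show "({u} \<noteq> {}) = (a \<or> b \<and> v = 0)" using True by simp
    qed
  qed
qed

text \<open>The set \<open>(remove_next (h * real i) ^^ v) D\<close> gives the counter
  \<open>v\<close> of \<open>row_step\<close> its geometric meaning: \<open>v\<close> removals still
  to be made to the right of the current cell boundary. The induction runs over the cells from left
  to right.\<close>

lemma row_update_aux:
  assumes "0 < h" "finite D" "D \<subseteq> {h * real i<..}" "set us \<subseteq> {h * real i<..}"
    and "sorted us" "distinct us" "resolves h (D \<union> set us)"
  shows "map (\<lambda>k. fold alpha_step us ((remove_next (h * real i) ^^ v) D) \<inter> cell h k \<noteq> {}) [i..<i + m] =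
    row_step (map (\<lambda>k. D \<inter> cell h k \<noteq> {}) [i..<i + m]) v (map (\<lambda>k. set us \<inter> cell h k \<noteq> {}) [i..<i + m])"
  using assms(2-)
proof (induction m arbitrary: i D us v)
  case (Suc m)
  let ?w = "h * real i" and ?w' = "h * real (Suc i)" and ?E = "cell h i"
  let ?D1 = "D \<inter> {?w'<..}"
  have ww': "?w < ?w'" using assms(1) by (simp add: algebra_simps)
  define a where "a = (set us \<inter> ?E \<noteq> {})"
  define b where "b = (D \<inter> ?E \<noteq> {})"
  define v' where "v' = v - of_bool b + of_bool a"
  have E: "D \<inter> {..?w'} = D \<inter> ?E" "set us \<inter> {..?w'} = set us \<inter> ?E"
    using Suc.prems(2,3) by (auto simp: cell_def)
  have one: "p = q" if "p \<in> D \<union> set us" "q \<in> D \<union> set us" "p \<le> ?w'" "q \<le> ?w'" for p q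
  proof -
    have "p \<in> (D \<union> set us) \<inter> ?E" "q \<in> (D \<union> set us) \<inter> ?E"
      using that Suc.prems(2,3) by (auto simp: cell_def)
    then show ?thesis using Suc.prems(6) unfolding resolves_def by blast
  qed
  note split = fold_alpha_step_split[OF Suc.prems(1-3) ww' Suc.prems(4,5) one, of v,
      unfolded E, folded a_def b_def, folded v'_def]
  obtain us' X where us': "set us' = set us \<inter> {?w'<..}" "sorted us'" "distinct us'"
    and X: "X \<subseteq> ?E" "X \<noteq> {} \<longleftrightarrow> a \<or> b \<and> v = 0"
    and F: "fold alpha_step us ((remove_next ?w ^^ v) D) =
      X \<union> fold alpha_step us' ((remove_next ?w' ^^ v') ?D1)"
    unfolding cell_def by (rule split)
  let ?G = "fold alpha_step us' ((remove_next ?w' ^^ v') ?D1)"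
  have G: "?G \<subseteq> {?w'<..}"
    using fold_alpha_step_subset[of us' "(remove_next ?w' ^^ v') ?D1"] us'(1)
      funpow_remove_next_subset[of v' ?w' ?D1] by auto
  have EG: "?E \<inter> {?w'<..} = {}" by (auto simp: cell_def)
  have GE: "(X \<union> ?G) \<inter> ?E \<noteq> {} \<longleftrightarrow> a \<or> b \<and> v = 0" using G EG X by blast
  have later: "cell h k \<inter> ?E = {} \<and> cell h k \<subseteq> {?w'<..}" if "k \<in> set [Suc i..<Suc i + m]" for k
  proof -
    from that have k: "i < k" "Suc i \<le> k" by auto
    have "?w' \<le> h * real k" using k(2) assms(1) by (intro mult_left_mono) auto
    then show ?thesis
      using cell_disjoint[OF assms(1), of k i] k(1) unfolding cell_def by force
  qed
  have m1: "map (\<lambda>k. (X \<union> ?G) \<inter> cell h k \<noteq> {}) [Suc i..<Suc i + m] =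
      map (\<lambda>k. ?G \<inter> cell h k \<noteq> {}) [Suc i..<Suc i + m]"
    using later X by (intro map_cong refl) blast
  have m2: "map (\<lambda>k. D \<inter> cell h k \<noteq> {}) [Suc i..<Suc i + m] =
      map (\<lambda>k. ?D1 \<inter> cell h k \<noteq> {}) [Suc i..<Suc i + m]"
    using later by (intro map_cong refl) blast
  have m3: "map (\<lambda>k. set us \<inter> cell h k \<noteq> {}) [Suc i..<Suc i + m] =
      map (\<lambda>k. set us' \<inter> cell h k \<noteq> {}) [Suc i..<Suc i + m]"
    using later us'(1) by (intro map_cong refl) blast
  have res: "resolves h (?D1 \<union> set us')"
    using Suc.prems(6) by (rule resolves_subset) (use us'(1) in auto)
  have upt: "[i..<i + Suc m] = i # [Suc i..<Suc i + m]" by (simp add: upt_conv_Cons)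
  have IH: "map (\<lambda>k. ?G \<inter> cell h k \<noteq> {}) [Suc i..<Suc i + m] =
    row_step (map (\<lambda>k. ?D1 \<inter> cell h k \<noteq> {}) [Suc i..<Suc i + m]) v' (map (\<lambda>k. set us' \<inter> cell h k \<noteq> {}) [Suc i..<Suc i + m])"
    by (rule Suc.IH) (use Suc.prems(1) us' res in auto)
  show ?case
    unfolding F upt list.map m1 m2 m3 IH row_step.simps GE
    by (simp only: a_def[symmetric] b_def[symmetric] v'_def[symmetric])
qed simp

lemma bits_update:
  assumes "0 < h" "locally_finite A" "finite C" "C \<subseteq> {0<..}" "resolves h (C \<union> alpha_at A R s)"
  shows "bits h n (update T A R s C) = row_step (bits h n C) (of_bool (s \<in> T)) (bits h n (alpha_at A R s))"
proof -
  let ?us = "sorted_list_of_set (alpha_at A R s)"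
  have sub: "alpha_at A R s \<subseteq> {0<..}" by (auto simp: alpha_at_def)
  have us: "set ?us = alpha_at A R s" using finite_alpha_at[OF assms(2)] by simp
  \<comment> \<open>A sink is one pending pull at position 0, so the row starts with the counter 1
    or 0.\<close>
  have "update T A R s C = fold alpha_step ?us ((remove_next (h * real 0) ^^ (of_bool (s \<in> T))) C)"
    by (simp add: update_def sink_step_def)
  then show ?thesis
    using row_update_aux[OF assms(1,3), of 0 ?us "of_bool (s \<in> T)" n] assms(4,5) sub
    unfolding us by (simp add: bits_def)
qed

lemma row_all_False: "length bs \<le> n \<Longrightarrow> row_step bs 0 (replicate n False) = bs"
proof (induction bs arbitrary: n)
  case (Cons b bs)
  then show ?case by (cases n) auto
qed simp

lemma sorted_list_of_set_Un:
  assumes "finite X" "finite Y" "\<And>x y. x \<in> X \<Longrightarrow> y \<in> Y \<Longrightarrow> x < (y :: real)"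
  shows "sorted_list_of_set (X \<union> Y) = sorted_list_of_set X @ sorted_list_of_set Y"
  by (rule sorted_distinct_set_unique)
    (use assms in \<open>fastforce simp: sorted_append distinct_append\<close>)+

definition row_bits :: "real \<Rightarrow> real \<Rightarrow> nat \<Rightarrow> real set \<Rightarrow> (real \<times> real) set \<Rightarrow> nat \<Rightarrow> bool list" where
  "row_bits h h' n T A j = (T \<inter> cell h' j \<noteq> {}) #
     map (\<lambda>i. A \<inter> cell h i \<times> cell h' j \<noteq> {}) [0..<n]"

text \<open>Particles only ever sit at sources or at abscissae of \<alpha>-points. Hence one finite
  set of positions serves for all times up to \<open>t\<close>, both for choosing the mesh and for
  avoiding null sets.\<close>

lemma window_subset:
  assumes "locally_finite T" "locally_finite A" "t' \<le> t"
  shows "window S T A R t' \<subseteq> (S \<inter> {0<..R}) \<union> fst ` (A \<inter> {0<..R} \<times> {0<..t})"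
proof -
  have "fold (update T A R) ts C \<subseteq> C \<union> (\<Union>s\<in>set ts. alpha_at A R s)" for ts C
  proof (induction ts arbitrary: C)
    case (Cons s ts)
    then show ?case using update_subset[OF assms(2), of T R s C] by fastforce
  qed simp
  moreover have "set (sorted_list_of_set (event_times T A R t')) \<subseteq> {0<..t}"
    using finite_event_times[OF assms(1,2)] assms(3) by (auto simp: event_times_def)
  ultimately have "window S T A R t' \<subseteq> (S \<inter> {0<..R}) \<union> (\<Union>s\<in>{0<..t}. alpha_at A R s)"
    unfolding window_def by blast
  moreover have "(\<Union>s\<in>{0<..t}. alpha_at A R s) \<subseteq> fst ` (A \<inter> {0<..R} \<times> {0<..t})"
    by (force simp: alpha_at_def)
  ultimately show ?thesis by blast
qed

text \<open>A row of height \<open>h'\<close> contains at most one event time, though possibly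
  several \<alpha>-points at that time. Without an event all bits of the row are false and
  \<open>row_step\<close> is the identity.\<close>

lemma bits_window_Suc:
  assumes lf: "locally_finite S" "locally_finite T" "locally_finite A"
    and "0 < h" "0 < h'" "j < m"
    and P: "resolves h ((S \<inter> {0<..h * real n}) \<union> fst ` (A \<inter> {0<..h * real n} \<times> {0<..h' * real m}))"
    and Q: "resolves h' (event_times T A (h * real n) (h' * real m))"
  shows "bits h n (window S T A (h * real n) (h' * real (Suc j))) =
    run n 1 (bits h n (window S T A (h * real n) (h' * real j))) (row_bits h h' n T A j)"
proof -
  let ?R = "h * real n" and ?t = "h' * real m"
  let ?ev = "event_times T A ?R" and ?W = "window S T A ?R (h' * real j)"
  define Z where "Z = ?ev ?t \<inter> cell h' j"
  have tj: "h' * real (Suc j) \<le> ?t" "h' * real j \<le> h' * real (Suc j)"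
    using assms(5,6) by (auto intro!: mult_left_mono)
  have split: "?ev (h' * real (Suc j)) = ?ev (h' * real j) \<union> Z"
    using order_trans[OF _ tj(1)] order_trans[OF _ tj(2)] unfolding event_times_def cell_def Z_def
    by (auto simp del: of_nat_Suc)
  have fin: "finite (?ev t')" for t' using finite_event_times[OF lf(2,3)] .
  have sl: "sorted_list_of_set (?ev (h' * real (Suc j))) =
      sorted_list_of_set (?ev (h' * real j)) @ sorted_list_of_set Z"
    unfolding split using fin
    by (intro sorted_list_of_set_Un) (auto simp: Z_def event_times_def cell_def)
  have W: "finite ?W" "?W \<subseteq> {0<..}" by (rule window_restrict[OF lf order_refl])+
  have Tj: "T \<inter> cell h' j \<subseteq> Z"
    using tj cell_subset[OF assms(5,6)] by (auto simp: Z_def event_times_def)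
  have Aj: "s \<in> Z \<and> u \<in> alpha_at A ?R s" if "(u, s) \<in> A" "u \<in> cell h i" "s \<in> cell h' j" "i < n" for u s i
    using that cell_subset[OF assms(5,6)] cell_subset[OF assms(4) that(4)]
    by (auto simp: Z_def event_times_def alpha_at_def)
  show ?thesis
  proof (cases "Z = {}")
    case True
    have "row_bits h h' n T A j = False # replicate n False"
    proof -
      have "map (\<lambda>i. A \<inter> cell h i \<times> cell h' j \<noteq> {}) [0..<n] = map (\<lambda>_. False) [0..<n]"
        using Aj True by (intro map_cong) auto
      then show ?thesis unfolding row_bits_def using Tj True by (simp add: map_replicate_trivial)
    qed
    moreover have "window S T A ?R (h' * real (Suc j)) = ?W"
      unfolding window_def sl using True by simp
    ultimately show ?thesis by (simp add: row_all_False)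
  next
    case False
    then obtain s where s: "s \<in> Z" by auto
    then have Zs: "Z = {s}" using Q unfolding resolves_def Z_def by blast
    have sj: "s \<in> cell h' j" using s by (simp add: Z_def)
    have "window S T A ?R (h' * real (Suc j)) = update T A ?R s ?W"
      unfolding window_def sl Zs by simp
    moreover have "resolves h (?W \<union> alpha_at A ?R s)"
    proof (rule resolves_subset[OF P])
      have "s \<in> {0<..?t}" using s by (auto simp: Z_def event_times_def)
      then have "alpha_at A ?R s \<subseteq> fst ` (A \<inter> {0<..?R} \<times> {0<..?t})"
        by (force simp: alpha_at_def image_iff)
      then show "?W \<union> alpha_at A ?R s \<subseteq> (S \<inter> {0<..?R}) \<union> fst ` (A \<inter> {0<..?R} \<times> {0<..?t})"
        using window_subset[OF lf(2,3), of "h' * real j" ?t S ?R] tj by auto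
    qed
    moreover have "row_bits h h' n T A j = (s \<in> T) # bits h n (alpha_at A ?R s)"
    proof -
      have "T \<inter> cell h' j \<noteq> {} \<longleftrightarrow> s \<in> T" using Tj Zs sj by auto
      moreover have "A \<inter> cell h i \<times> cell h' j \<noteq> {} \<longleftrightarrow> alpha_at A ?R s \<inter> cell h i \<noteq> {}" if "i < n" for i
        using Aj[OF _ _ _ that] Zs sj by (auto simp: alpha_at_def)
      ultimately show ?thesis by (simp add: row_bits_def bits_def)
    qed
    ultimately show ?thesis
      using bits_update[OF assms(4) lf(3) W] by simp
  qed
qed

lemma run_append:
  "length ys = Suc n \<Longrightarrow> run n (Suc k) bs (ys @ zs) = run n k (run n 1 bs ys) zs"
  by (cases ys) auto

lemma bits_window:
  assumes lf: "locally_finite S" "locally_finite T" "locally_finite A"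
    and "0 < h" "0 < h'"
    and P: "resolves h ((S \<inter> {0<..h * real n}) \<union> fst ` (A \<inter> {0<..h * real n} \<times> {0<..h' * real m}))"
    and Q: "resolves h' (event_times T A (h * real n) (h' * real m))"
  shows "bits h n (window S T A (h * real n) (h' * real m)) =
    run n m (bits h n S) (concat (map (row_bits h h' n T A) [0..<m]))"
proof -
  let ?R = "h * real n"
  have "j + k = m \<Longrightarrow> bits h n (window S T A ?R (h' * real m)) =
    run n k (bits h n (window S T A ?R (h' * real j))) (concat (map (row_bits h h' n T A) [j..<m]))" for j k
  proof (induction k arbitrary: j)
    case (Suc k)
    then have "j < m" "Suc j + k = m" "[j..<m] = j # [Suc j..<m]" by (auto simp: upt_conv_Cons)
    moreover have "length (row_bits h h' n T A j) = Suc n" by (simp add: row_bits_def)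
    ultimately show ?case
      using Suc.IH[of "Suc j"] bits_window_Suc[OF assms(1-5) _ P Q, of j] run_append by simp
  qed simp
  from this[of 0 m] have "bits h n (window S T A ?R (h' * real m)) =
    run n m (bits h n (window S T A ?R 0)) (concat (map (row_bits h h' n T A) [0..<m]))" by simp
  moreover have "bits h n (window S T A ?R 0) = bits h n S"
  proof -
    have "event_times T A ?R 0 = {}" by (auto simp: event_times_def)
    then have "window S T A ?R 0 = S \<inter> {0<..?R}" by (simp add: window_def)
    moreover have "S \<inter> {0<..?R} \<inter> cell h i = S \<inter> cell h i" if "i < n" for i
      using cell_subset[OF assms(4) that] by auto
    ultimately show ?thesis by (simp add: bits_def)
  qed
  ultimately show ?thesis by simp
qed

text \<open>Only finitely many points of a fixed input matter in the window, so from some mesh on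
  the grid reproduces the occupied cells exactly. Space and time are cut into the same number
  \<open>n\<close> of intervals.\<close>

lemma eventually_bits_window:
  assumes lf: "locally_finite S" "locally_finite T" "locally_finite A"
    and "0 < R" "0 < t"
  shows "\<forall>\<^sub>F n in sequentially. bits (R / real n) n (hammersley S T A t \<inter> {0<..R}) =
    run n n (bits (R / real n) n S) (concat (map (row_bits (R / real n) (t / real n) n T A) [0..<n]))"
proof -
  have "finite (A \<inter> {0..R} \<times> {0..t})"
    using lf(3) bounded_Times[OF bounded_closed_interval[of 0 R] bounded_closed_interval[of 0 t]]
    by (simp add: locally_finite_def)
  then have "finite (A \<inter> {0<..R} \<times> {0<..t})" by (rule finite_subset[rotated]) auto
  then have fin: "finite ((S \<inter> {0<..R}) \<union> fst ` (A \<inter> {0<..R} \<times> {0<..t}))"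
    using lf(1) by (auto simp: locally_finite_def)
  show ?thesis
    using eventually_resolves[OF fin, of R] eventually_resolves[OF finite_event_times[OF lf(2,3)], of t R t]
      eventually_gt_at_top[of 0]
  proof eventually_elim
    case (elim n)
    have *: "R / real n * real n = R" "t / real n * real n = t" using elim by auto
    show ?case
      unfolding hammersley_Int_window[OF lf assms(4)]
      using bits_window[OF lf, of "R / real n" "t / real n" n n] elim assms(4,5) unfolding * by simp
  qed
qed

section \<open>Expectations over independent bits\<close>

text \<open>Expectations over independent bits are written as finite sums, without a measure; the
  estimates then are inductions over the list of success probabilities.\<close>

definition bern :: "real \<Rightarrow> (bool \<Rightarrow> real) \<Rightarrow> real" where
  "bern p f = p * f True + (1 - p) * f False"

primrec ebits :: "real list \<Rightarrow> (bool list \<Rightarrow> real) \<Rightarrow> real" where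
  "ebits [] f = f []"
| "ebits (p # ps) f = bern p (\<lambda>b. ebits ps (\<lambda>bs. f (b # bs)))"

lemma bern_diff: "bern p f - bern p g = bern p (\<lambda>b. f b - g b)"
  by (simp add: bern_def algebra_simps)

lemma bern_commute: "bern p (\<lambda>a. bern q (\<lambda>b. f a b)) = bern q (\<lambda>b. bern p (\<lambda>a. f a b))"
  by (simp add: bern_def algebra_simps)

lemma bern_ebits_commute:
  "bern p (\<lambda>a. ebits qs (\<lambda>bs. f a bs)) = ebits qs (\<lambda>bs. bern p (\<lambda>a. f a bs))"
proof (induction qs arbitrary: f)
  case (Cons q qs)
  show ?case by (simp add: bern_commute[of p q] Cons.IH)
qed simp

lemma ebits_append: "ebits (ps @ qs) f = ebits ps (\<lambda>xs. ebits qs (\<lambda>ys. f (xs @ ys)))"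
  by (induction ps arbitrary: f) simp_all

lemma ebits_cong:
  assumes "\<And>bs. length bs = length ps \<Longrightarrow> f bs = g bs"
  shows "ebits ps f = ebits ps g"
  using assms
proof (induction ps arbitrary: f g)
  case (Cons p ps)
  have "ebits ps (\<lambda>bs. f (b # bs)) = ebits ps (\<lambda>bs. g (b # bs))" for b
    by (rule Cons.IH) (simp add: Cons.prems)
  then show ?case by simp
qed simp

lemma abs_bern_le:
  assumes "0 \<le> p" "p \<le> 1" "\<And>b. \<bar>f b\<bar> \<le> B"
  shows "\<bar>bern p f\<bar> \<le> B"
proof -
  have "\<bar>bern p f\<bar> \<le> p * \<bar>f True\<bar> + (1 - p) * \<bar>f False\<bar>"
    unfolding bern_def using assms(1,2) by (intro order_trans[OF abs_triangle_ineq]) (simp add: abs_mult)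
  also have "\<dots> \<le> p * B + (1 - p) * B"
    using assms by (intro add_mono mult_left_mono) auto
  finally show ?thesis by (simp add: algebra_simps)
qed

lemma abs_ebits_le:
  assumes "\<And>p. p \<in> set ps \<Longrightarrow> 0 \<le> p \<and> p \<le> 1" "\<And>bs. length bs = length ps \<Longrightarrow> \<bar>f bs\<bar> \<le> B"
  shows "\<bar>ebits ps f\<bar> \<le> B"
  using assms
proof (induction ps arbitrary: f)
  case (Cons p ps)
  have "\<bar>ebits ps (\<lambda>bs. f (b # bs))\<bar> \<le> B" for b
    by (rule Cons.IH) (use Cons.prems in auto)
  then show ?case using Cons.prems(1)[of p] by (simp add: abs_bern_le)
qed simp

text \<open>The parameters are exchanged one bit at a time, and each exchange costs at most
  \<open>2 * B * \<bar>p - p'\<bar>\<close>.\<close>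

lemma ebits_replicate_perturb:
  assumes "0 \<le> p" "p \<le> 1" "0 \<le> p'" "p' \<le> 1" "\<And>bs. length bs = n \<Longrightarrow> \<bar>f bs\<bar> \<le> B"
  shows "\<bar>ebits (replicate n p) f - ebits (replicate n p') f\<bar> \<le> real n * (2 * B * \<bar>p - p'\<bar>)"
  using assms(5)
proof (induction n arbitrary: f)
  case (Suc n)
  let ?G = "\<lambda>b. ebits (replicate n p) (\<lambda>bs. f (b # bs))"
  let ?G' = "\<lambda>b. ebits (replicate n p') (\<lambda>bs. f (b # bs))"
  have IH: "\<bar>?G b - ?G' b\<bar> \<le> real n * (2 * B * \<bar>p - p'\<bar>)" for b
    by (rule Suc.IH) (simp add: Suc.prems)
  have G: "\<bar>?G b\<bar> \<le> B" for b
    by (rule abs_ebits_le) (use assms Suc.prems in auto)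
  have "\<bar>bern p ?G - bern p' ?G\<bar> = \<bar>p - p'\<bar> * \<bar>?G True - ?G False\<bar>"
    by (simp add: bern_def abs_mult[symmetric] algebra_simps)
  also have "\<dots> \<le> \<bar>p - p'\<bar> * (2 * B)"
    using G[of True] G[of False] by (intro mult_left_mono) auto
  finally have "\<bar>bern p ?G - bern p' ?G\<bar> \<le> 2 * B * \<bar>p - p'\<bar>" by (simp add: mult.commute)
  moreover have "\<bar>bern p' ?G - bern p' ?G'\<bar> \<le> real n * (2 * B * \<bar>p - p'\<bar>)"
    unfolding bern_diff by (rule abs_bern_le) (use assms IH in auto)
  ultimately have "\<bar>bern p ?G - bern p' ?G'\<bar> \<le> 2 * B * \<bar>p - p'\<bar> + real n * (2 * B * \<bar>p - p'\<bar>)"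
    by linarith
  then show ?case by (simp add: algebra_simps)
qed simp

text \<open>The first term is twice the defect of detailed balance; the second bounds the effect of
  an \<alpha>-point in the same cell as a particle or a pull.\<close>

definition cell_error :: "real \<Rightarrow> real \<Rightarrow> real \<Rightarrow> real" where
  "cell_error p q r = 2 * \<bar>p * q - (1 - p) * (1 - q) * r\<bar> + 2 * r * (p + q)"

text \<open>In the absence of collisions a cell maps (particle from below, pull from the left) = (1,1)
  to (0,0), maps (0,0) to (1,1) if it contains an \<open>\<alpha>\<close>-point, and does nothing otherwise.  Detailed
  balance \<open>p * q = (1 - p) * (1 - q) * r\<close> would make this stationary.\<close>

lemma cell_stationary:
  assumes "0 \<le> p" "p \<le> 1" "0 \<le> q" "q \<le> 1" "0 \<le> r" "\<And>b v. \<bar>g b v\<bar> \<le> 1"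
  shows "\<bar>bern p (\<lambda>b. bern q (\<lambda>y. bern r (\<lambda>a.
        g (a \<or> b \<and> of_bool y = (0 :: nat)) (of_bool y - of_bool b + of_bool a)))) -
      bern p (\<lambda>b. bern q (\<lambda>y. g b (of_bool y :: nat)))\<bar> \<le> cell_error p q r"
    (is "\<bar>?L - ?R\<bar> \<le> _")
proof -
  define D where "D = p * q - (1 - p) * (1 - q) * r"
  \<comment> \<open>The terms are grouped by outcome. The value 2 arises when a pull from the left
    meets an \<alpha>-point but no particle, so the outgoing counter is a bit only up to such
    collisions.\<close>
  have "?L - ?R = (D - p * q * r) * g False 0 + (p * q * r + p * (1 - q) * r - D) * g True 1 -
      p * (1 - q) * r * g True 0 - (1 - p) * q * r * g False 1 + (1 - p) * q * r * g True 2"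
    by (simp add: bern_def D_def numeral_2_eq_2) algebra
  also have "\<bar>\<dots>\<bar> \<le> (\<bar>D\<bar> + p * q * r) + (\<bar>D\<bar> + p * q * r + p * (1 - q) * r) +
      p * (1 - q) * r + (1 - p) * q * r + (1 - p) * q * r"
  proof -
    have m: "\<bar>c * g b v\<bar> \<le> C" if "\<bar>c\<bar> \<le> C" for b v c C
      using mult_mono[OF that assms(6)[of b v]] that by (simp add: abs_mult)
    have nn: "0 \<le> p * q * r" "0 \<le> p * (1 - q) * r" "0 \<le> (1 - p) * q * r" using assms by auto
    have "\<bar>(D - p * q * r) * g False 0\<bar> \<le> \<bar>D\<bar> + p * q * r" by (rule m) (use nn in auto)
    moreover have "\<bar>(p * q * r + p * (1 - q) * r - D) * g True 1\<bar> \<le> \<bar>D\<bar> + p * q * r + p * (1 - q) * r"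
      by (rule m) (use nn in auto)
    moreover have "\<bar>p * (1 - q) * r * g True 0\<bar> \<le> p * (1 - q) * r" by (rule m) (use nn in auto)
    moreover have "\<bar>(1 - p) * q * r * g False 1\<bar> \<le> (1 - p) * q * r" by (rule m) (use nn in auto)
    moreover have "\<bar>(1 - p) * q * r * g True 2\<bar> \<le> (1 - p) * q * r" by (rule m) (use nn in auto)
    ultimately show ?thesis by linarith
  qed
  also have "\<dots> \<le> cell_error p q r"
    using mult_nonneg_nonneg[OF mult_nonneg_nonneg[OF assms(1,3)] assms(5)]
    unfolding cell_error_def D_def[symmetric] by (simp add: algebra_simps)
  finally show ?thesis .
qed

text \<open>By \<open>cell_stationary\<close> the bit left in the first cell and the outgoing pull
  are, up to the cell error, again an independent pair with the laws of a particle bit and of a sink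
  bit. What remains is a shorter row with the same input.\<close>

lemma row_stationary:
  assumes p: "0 \<le> p" "p \<le> 1" and q: "0 \<le> q" "q \<le> 1" and r: "0 \<le> r" "r \<le> 1"
    and f: "\<And>bs. length bs = n \<Longrightarrow> \<bar>f bs\<bar> \<le> 1"
  shows "\<bar>bern q (\<lambda>y. ebits (replicate n p) (\<lambda>bs. ebits (replicate n r) (\<lambda>as. f (row_step bs (of_bool y) as)))) -
      ebits (replicate n p) f\<bar> \<le> real n * cell_error p q r"
  using f
proof (induction n arbitrary: f)
  case 0
  then show ?case by (simp add: bern_def algebra_simps)
next
  case (Suc n)
  define G where "G c v = ebits (replicate n p) (\<lambda>bs. ebits (replicate n r) (\<lambda>as. f (c # row_step bs v as)))" for c v
  have G: "\<bar>G c v\<bar> \<le> 1" for c v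
    unfolding G_def by (intro abs_ebits_le) (use p r Suc.prems in auto)
  have "bern q (\<lambda>y. ebits (replicate (Suc n) p) (\<lambda>bs. ebits (replicate (Suc n) r) (\<lambda>as. f (row_step bs (of_bool y) as)))) =
      bern p (\<lambda>b. bern q (\<lambda>y. bern r (\<lambda>a.
        G (a \<or> b \<and> of_bool y = (0 :: nat)) (of_bool y - of_bool b + of_bool a))))" (is "?L = ?M")
    by (simp add: G_def bern_ebits_commute bern_commute[of q p])
  moreover have "\<bar>?M - bern p (\<lambda>b. bern q (\<lambda>y. G b (of_bool y)))\<bar> \<le> cell_error p q r"
    by (rule cell_stationary[OF p q r(1) G])
  moreover have "\<bar>bern p (\<lambda>b. bern q (\<lambda>y. G b (of_bool y))) - ebits (replicate (Suc n) p) f\<bar> \<le> real n * cell_error p q r"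
    unfolding replicate_Suc ebits.simps bern_diff
  proof (rule abs_bern_le[OF p])
    fix b
    show "\<bar>bern q (\<lambda>y. G b (of_bool y)) - ebits (replicate n p) (\<lambda>bs. f (b # bs))\<bar> \<le> real n * cell_error p q r"
      unfolding G_def by (rule Suc.IH) (simp add: Suc.prems)
  qed
  ultimately have "\<bar>?L - ebits (replicate (Suc n) p) f\<bar> \<le> cell_error p q r + real n * cell_error p q r"
    by linarith
  then show ?case by (simp add: algebra_simps)
qed

text \<open>Each row uses fresh sink and \<alpha>-bits and finds, up to the row error, a product law
  of particles. The errors of \<open>k\<close> rows with \<open>n\<close> cells each simply add
  up.\<close>

lemma run_stationary:
  assumes p: "0 \<le> p" "p \<le> 1" and q: "0 \<le> q" "q \<le> 1" and r: "0 \<le> r" "r \<le> 1"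
    and f: "\<And>bs. length bs = n \<Longrightarrow> \<bar>f bs\<bar> \<le> 1"
  shows "\<bar>ebits (replicate n p @ concat (replicate k (q # replicate n r)))
        (\<lambda>bs. f (run n k (take n bs) (drop n bs))) -
      ebits (replicate n p) f\<bar> \<le> real k * (real n * cell_error p q r)"
proof -
  let ?e = "\<lambda>k bs. ebits (concat (replicate k (q # replicate n r))) (\<lambda>ys. f (run n k bs ys))"
  have e_Suc: "?e (Suc k) bs = bern q (\<lambda>y. ebits (replicate n r) (\<lambda>as. ?e k (row_step bs (of_bool y) as)))"
    for k bs
  proof -
    have "?e (Suc k) bs = bern q (\<lambda>y. ebits (replicate n r) (\<lambda>as.
        ebits (concat (replicate k (q # replicate n r))) (\<lambda>ys. f (run n (Suc k) bs (y # as @ ys)))))"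
      by (simp add: ebits_append del: run.simps)
    also have "\<dots> = bern q (\<lambda>y. ebits (replicate n r) (\<lambda>as. ?e k (row_step bs (of_bool y) as)))"
    proof (rule arg_cong[of _ _ "bern q"], rule ext, rule ebits_cong)
      fix y and as :: "bool list" assume "length as = length (replicate n r)"
      then show "ebits (concat (replicate k (q # replicate n r))) (\<lambda>ys. f (run n (Suc k) bs (y # as @ ys))) =
          ?e k (row_step bs (of_bool y) as)" by simp
    qed
    finally show ?thesis .
  qed
  have len: "length bs = n \<Longrightarrow> length (run n k bs ys) = n" if "length ys = k * Suc n" for k bs ys
    using that
  proof (induction k arbitrary: bs ys)
    case (Suc k)
    then show ?case by (cases ys) auto
  qed simp
  have e_le: "\<bar>?e k bs\<bar> \<le> 1" if "length bs = n" for k bs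
  proof (rule abs_ebits_le)
    fix ys :: "bool list" assume "length ys = length (concat (replicate k (q # replicate n r)))"
    then have "length ys = k * Suc n" by (simp add: length_concat sum_list_replicate)
    then show "\<bar>f (run n k bs ys)\<bar> \<le> 1" using len that f by simp
  qed (use q r in \<open>auto split: if_splits\<close>)
  have "\<bar>ebits (replicate n p) (?e k) - ebits (replicate n p) f\<bar> \<le> real k * (real n * cell_error p q r)"
  proof (induction k)
    case (Suc k)
    have "ebits (replicate n p) (?e (Suc k)) =
        bern q (\<lambda>y. ebits (replicate n p) (\<lambda>bs. ebits (replicate n r) (\<lambda>as. ?e k (row_step bs (of_bool y) as))))"
      unfolding e_Suc bern_ebits_commute ..
    then have "\<bar>ebits (replicate n p) (?e (Suc k)) - ebits (replicate n p) (?e k)\<bar> \<le> real n * cell_error p q r"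
      using row_stationary[OF p q r e_le, of n] by simp
    with Suc show ?case by (simp add: algebra_simps)
  qed simp
  moreover have "ebits (replicate n p @ concat (replicate k (q # replicate n r)))
      (\<lambda>bs. f (run n k (take n bs) (drop n bs))) = ebits (replicate n p) (?e k)"
    unfolding ebits_append by (rule ebits_cong) simp
  ultimately show ?thesis by simp
qed

section \<open>Size of the discretization error\<close>

lemma one_minus_exp_bounds:
  fixes x :: real
  assumes "0 \<le> x"
  shows "1 - exp (- x) \<le> x" "x - x\<^sup>2 \<le> 1 - exp (- x)" "0 \<le> 1 - exp (- x)" "1 - exp (- x) \<le> 1"
proof -
  show "1 - exp (- x) \<le> x" using exp_ge_add_one_self[of "- x"] by simp
  have "1 + x \<le> exp x" by (rule exp_ge_add_one_self)
  then have "exp (- x) \<le> 1 / (1 + x)"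
    using assms by (simp add: exp_minus inverse_eq_divide frac_le)
  also have "\<dots> \<le> 1 - x + x\<^sup>2"
  proof -
    have "1 \<le> (1 - x + x\<^sup>2) * (1 + x)" using assms by (simp add: power2_eq_square algebra_simps)
    then show ?thesis using assms by (simp add: divide_le_eq)
  qed
  finally show "x - x\<^sup>2 \<le> 1 - exp (- x)" by simp
qed (use assms in auto)

text \<open>Here \<open>x\<close> and \<open>y\<close> are the mean numbers of sources and sinks per
  cell side. With sink intensity \<open>1 / \<rho>\<close> their product is the area of the cell,
  which is the mean number of \<alpha>-points; so \<open>p * q\<close> and
  \<open>(1 - p) * (1 - q) * r\<close> have the same leading term \<open>x * y\<close> and differ in
  third order.\<close>

lemma cell_error_bound:
  fixes x y :: real
  assumes "0 \<le> x" "0 \<le> y"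
  shows "cell_error (1 - exp (- x)) (1 - exp (- y)) (1 - exp (- (x * y))) \<le>
    4 * (x * y) * (x + y) + 2 * (x * y)\<^sup>2"
proof -
  define p q r z where "p = 1 - exp (- x)" "q = 1 - exp (- y)" "r = 1 - exp (- (x * y))" "z = x * y"
  note d = this
  have z: "0 \<le> z" using assms by (simp add: d)
  have p: "p \<le> x" "x - x\<^sup>2 \<le> p" "0 \<le> p" "p \<le> 1" using one_minus_exp_bounds[OF assms(1)] by (simp_all add: d)
  have q: "q \<le> y" "y - y\<^sup>2 \<le> q" "0 \<le> q" "q \<le> 1" using one_minus_exp_bounds[OF assms(2)] by (simp_all add: d)
  have r: "r \<le> z" "z - z\<^sup>2 \<le> r" "0 \<le> r" "r \<le> 1" using one_minus_exp_bounds[OF z] by (simp_all add: d)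
  have "p * q \<le> z" unfolding d(4) using p q assms by (intro mult_mono) auto
  moreover have "z - z * (x + y) \<le> p * q"
  proof (cases "x + y < 1")
    case True
    have "x * (1 - x) * (y * (1 - y)) \<le> p * q"
      using p q True assms by (intro mult_mono) (auto simp: power2_eq_square algebra_simps mult_left_le)
    moreover have "z * (1 - x - y) \<le> z * ((1 - x) * (1 - y))"
      using z assms by (intro mult_left_mono) (auto simp: algebra_simps)
    ultimately show ?thesis by (simp add: d(4) algebra_simps)
  next
    case False
    then have "z * 1 \<le> z * (x + y)" using z by (intro mult_left_mono) auto
    then show ?thesis using mult_nonneg_nonneg[OF p(3) q(3)] by simp
  qed
  moreover have "(1 - p) * (1 - q) * r \<le> z"
  proof -
    have "(1 - p) * (1 - q) \<le> 1" using p q by (intro mult_le_one) auto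
    then have "(1 - p) * (1 - q) * r \<le> 1 * r" using r by (intro mult_right_mono) auto
    then show ?thesis using r by simp
  qed
  moreover have "z - z\<^sup>2 - z * (x + y) \<le> (1 - p) * (1 - q) * r"
  proof -
    have "1 - (x + y) \<le> exp (- (x + y))" using exp_ge_add_one_self[of "- (x + y)"] by linarith
    also have "\<dots> = (1 - p) * (1 - q)" by (simp add: d exp_add[symmetric])
    finally have "(1 - (x + y)) * r \<le> (1 - p) * (1 - q) * r" using r by (intro mult_right_mono) auto
    moreover have "(x + y) * r \<le> (x + y) * z" using r assms by (intro mult_left_mono) auto
    ultimately show ?thesis using r by (simp add: algebra_simps)
  qed
  ultimately have "\<bar>p * q - (1 - p) * (1 - q) * r\<bar> \<le> z * (x + y) + z\<^sup>2"
    using z zero_le_power2[of z] by linarith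
  moreover have "r * (p + q) \<le> z * (x + y)" using p q r z assms by (intro mult_mono) auto
  then have "2 * r * (p + q) \<le> 2 * (z * (x + y))" by simp
  ultimately have "cell_error p q r \<le> 2 * (z * (x + y) + z\<^sup>2) + 2 * (z * (x + y))"
    unfolding cell_error_def by (intro add_mono) auto
  then show ?thesis by (simp add: d)
qed

text \<open>There are \<open>n * n\<close> cells, and the error of each is of order \<open>n\<close>
  to the power -3.\<close>

lemma cell_error_limit:
  fixes \<rho> R t :: real
  assumes "0 < \<rho>" "0 < R" "0 < t"
  shows "(\<lambda>n. real n * (real n * cell_error (1 - exp (- (\<rho> * (R / real n))))
      (1 - exp (- (1 / \<rho> * (t / real n)))) (1 - exp (- (R / real n * (t / real n)))))) \<longlonglongrightarrow> 0"
    (is "?E \<longlonglongrightarrow> 0")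
proof (rule tendsto_sandwich)
  let ?b = "\<lambda>n. 4 * (R * t) * (\<rho> * (R / real n) + 1 / \<rho> * (t / real n)) + 2 * (R * t) * (R / real n * (t / real n))"
  show "\<forall>\<^sub>F n in sequentially. 0 \<le> ?E n"
    using assms unfolding cell_error_def
    by (intro always_eventually allI mult_nonneg_nonneg add_nonneg_nonneg one_minus_exp_bounds(3)) auto
  show "\<forall>\<^sub>F n in sequentially. ?E n \<le> ?b n"
    using eventually_gt_at_top[of 0]
  proof eventually_elim
    case (elim n)
    let ?x = "\<rho> * (R / real n)" and ?y = "1 / \<rho> * (t / real n)"
    have regroup: "N * (N * (4 * w * v + 2 * w\<^sup>2)) = 4 * (N * N * w) * v + 2 * (N * N * w) * w" for N w v :: real
      by (simp add: power2_eq_square algebra_simps)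
    have xy: "?x * ?y = R / real n * (t / real n)" using assms by (simp add: field_simps)
    have "?E n \<le> real n * (real n * (4 * (?x * ?y) * (?x + ?y) + 2 * (?x * ?y)\<^sup>2))"
      using cell_error_bound[of ?x ?y] assms unfolding xy by (intro mult_left_mono) auto
    also have "\<dots> = 4 * (real n * real n * (?x * ?y)) * (?x + ?y) + 2 * (real n * real n * (?x * ?y)) * (?x * ?y)"
      by (rule regroup)
    also have "real n * real n * (?x * ?y) = R * t" unfolding xy using elim by simp
    finally show ?case unfolding xy .
  qed
  show "?b \<longlonglongrightarrow> 0"
  proof -
    have "(\<lambda>n. c * (\<rho> * X n + 1 / \<rho> * Y n) + d * (X n * Y n)) \<longlonglongrightarrow> 0"
      if "X \<longlonglongrightarrow> 0" "Y \<longlonglongrightarrow> 0" for c d :: real and X Y :: "nat \<Rightarrow> real"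
      using that assms(1) by (auto intro!: tendsto_eq_intros)
    from this[OF lim_const_over_n lim_const_over_n] show ?thesis .
  qed
qed simp

section \<open>Measurability of counts\<close>

lemma measurable_nat_iff_real:
  fixes f :: "'w \<Rightarrow> nat"
  shows "f \<in> measurable M (count_space UNIV) \<longleftrightarrow> (\<lambda>\<omega>. real (f \<omega>)) \<in> borel_measurable M"
proof
  assume "(\<lambda>\<omega>. real (f \<omega>)) \<in> borel_measurable M"
  then have "(\<lambda>\<omega>. real (f \<omega>)) -` {real k} \<inter> space M \<in> sets M" for k
    by (rule measurable_sets) simp
  moreover have "(\<lambda>\<omega>. real (f \<omega>)) -` {real k} = f -` {k}" for k by auto
  ultimately show "f \<in> measurable M (count_space UNIV)"
    by (simp add: measurable_count_space_eq2_countable)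
qed simp

lemma card_UN_eventually:
  fixes D :: "nat \<Rightarrow> 'a set"
  assumes "finite F"
  shows "\<forall>\<^sub>F n in sequentially. F \<inter> (\<Union>i<n. D i) = F \<inter> (\<Union>i. D i)"
proof -
  have "\<forall>\<^sub>F n in sequentially. p \<in> (\<Union>i<n. D i) \<longleftrightarrow> p \<in> (\<Union>i. D i)" for p
  proof (cases "p \<in> (\<Union>i. D i)")
    case True
    then obtain i where "p \<in> D i" by auto
    then show ?thesis by (intro eventually_mono[OF eventually_gt_at_top[of i]]) blast
  qed auto
  then have "\<forall>\<^sub>F n in sequentially. \<forall>p\<in>F. p \<in> (\<Union>i<n. D i) \<longleftrightarrow> p \<in> (\<Union>i. D i)"
    by (intro eventually_ball_finite assms ballI)
  then show ?thesis by eventually_elim blast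
qed

text \<open>Sets with measurable counts form a Dynkin system containing the half-lines. Inside
  \<open>(0, R]\<close> the counts are finite, so complements give differences and disjoint unions
  give sums that are eventually constant.\<close>

lemma measurable_card_Int:
  fixes Y :: "'w \<Rightarrow> real set"
  assumes fin: "\<And>\<omega>. \<omega> \<in> space M \<Longrightarrow> finite (Y \<omega> \<inter> {0<..R})"
    and meas: "\<And>x. (\<lambda>\<omega>. card (Y \<omega> \<inter> {0<..x})) \<in> measurable M (count_space UNIV)"
    and "B \<in> sets borel" "B \<subseteq> {0<..R}"
  shows "(\<lambda>\<omega>. card (Y \<omega> \<inter> B)) \<in> measurable M (count_space UNIV)"
proof -
  let ?f = "\<lambda>B \<omega>. real (card (Y \<omega> \<inter> {0<..R} \<inter> B))"
  have B: "B \<in> sigma_sets UNIV (range (\<lambda>a. {..a}))"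
    using assms(3) unfolding borel_eq_atMost by (simp add: sets_measure_of)
  have "Int_stable (range (\<lambda>a::real. {..a}))"
  proof (rule Int_stableI)
    fix X Z assume "X \<in> range (\<lambda>a::real. {..a})" "Z \<in> range (\<lambda>a::real. {..a})"
    then obtain x z where "X = {..x}" "Z = {..z}" by auto
    then have "X \<inter> Z = {..min x z}" by auto
    then show "X \<inter> Z \<in> range (\<lambda>a. {..a})" by auto
  qed
  moreover have "range (\<lambda>a::real. {..a}) \<subseteq> Pow UNIV" by simp
  ultimately have "?f B \<in> borel_measurable M" using B
  proof (induction rule: sigma_sets_induct_disjoint)
    case (basic X)
    then obtain a where "X = {..a}" by auto
    then have "?f X = (\<lambda>\<omega>. real (card (Y \<omega> \<inter> {0<..min R a})))"
      by (auto intro!: ext arg_cong[of _ _ card])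
    then show ?case using meas[of "min R a"] by (simp add: measurable_nat_iff_real)
  next
    case (compl X)
    have "?f (UNIV - X) \<omega> = ?f UNIV \<omega> - ?f X \<omega>" if "\<omega> \<in> space M" for \<omega>
    proof -
      have "card (Y \<omega> \<inter> {0<..R}) = card (Y \<omega> \<inter> {0<..R} \<inter> X) + card (Y \<omega> \<inter> {0<..R} \<inter> (UNIV - X))"
        using fin[OF that] by (subst card_Un_disjoint[symmetric]) (auto intro!: arg_cong[of _ _ card])
      then show ?thesis by simp
    qed
    moreover have "?f UNIV \<in> borel_measurable M" using meas[of R] by (simp add: measurable_nat_iff_real)
    ultimately show ?case using compl.IH by (simp cong: measurable_cong)
  next
    case (union D)
    have *: "(\<lambda>n. \<Sum>i<n. ?f (D i) \<omega>) \<longlonglongrightarrow> ?f (\<Union>i. D i) \<omega>" if "\<omega> \<in> space M" for \<omega>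
    proof (rule tendsto_eventually)
      have "(\<Sum>i<n. card (Y \<omega> \<inter> {0<..R} \<inter> D i)) = card (Y \<omega> \<inter> {0<..R} \<inter> (\<Union>i<n. D i))" for n
        unfolding Int_UN_distrib
        by (rule card_UN_disjoint[symmetric])
          (use fin[OF that] union.hyps(1) in \<open>auto simp: disjoint_family_on_def\<close>)
      then have "(\<Sum>i<n. ?f (D i) \<omega>) = ?f (\<Union>i<n. D i) \<omega>" for n
        by (metis of_nat_sum)
      then show "\<forall>\<^sub>F n in sequentially. (\<Sum>i<n. ?f (D i) \<omega>) = ?f (\<Union>i. D i) \<omega>"
        using card_UN_eventually[OF fin[OF that], of D] by (auto elim!: eventually_mono)
    qed
    show ?case by (rule borel_measurable_LIMSEQ_real[OF *]) (use union.IH in auto)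
  qed simp
  moreover have "Y \<omega> \<inter> {0<..R} \<inter> B = Y \<omega> \<inter> B" for \<omega> using assms(4) by auto
  ultimately show ?thesis by (simp add: measurable_nat_iff_real)
qed

lemma measurable_map_count_space:
  fixes g :: "'b \<Rightarrow> 'w \<Rightarrow> 'c::countable"
  assumes "\<And>x. x \<in> set xs \<Longrightarrow> g x \<in> measurable M (count_space UNIV)"
  shows "(\<lambda>\<omega>. map (\<lambda>x. g x \<omega>) xs) \<in> measurable M (count_space UNIV)"
  using assms
proof (induction xs)
  case (Cons x xs)
  have "(\<lambda>\<omega>. (g x \<omega>, map (\<lambda>x. g x \<omega>) xs)) \<in> measurable M (count_space UNIV \<Otimes>\<^sub>M count_space UNIV)"
    using Cons by (intro measurable_Pair) auto
  then have "(\<lambda>\<omega>. (\<lambda>(y, ys). y # ys) (g x \<omega>, map (\<lambda>x. g x \<omega>) xs)) \<in> measurable M (count_space UNIV)"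
    by (rule measurable_compose) (simp add: pair_measure_countable)
  then show ?case by simp
qed simp

lemma finite_frontier_interval:
  fixes I :: "real set"
  assumes "is_interval I" "bounded I"
  shows "finite (frontier I)"
proof (cases "I = {}")
  case False
  have bd: "bdd_below I" "bdd_above I"
    using assms(2) by (auto intro: bounded_imp_bdd_below bounded_imp_bdd_above)
  have "{Inf I<..<Sup I} \<subseteq> I"
  proof
    fix x assume x: "x \<in> {Inf I<..<Sup I}"
    then have "\<exists>y\<in>I. y < x" "\<exists>z\<in>I. x < z"
      using False bd cInf_less_iff[of I x] less_cSup_iff[of I x] by auto
    then show "x \<in> I" using assms(1) unfolding is_interval_1 by (meson less_imp_le)
  qed
  then have "{Inf I<..<Sup I} \<subseteq> interior I" by (simp add: interior_maximal)
  moreover have "closure I \<subseteq> {Inf I..Sup I}"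
    using bd by (intro closure_minimal) (auto intro: cInf_lower cSup_upper)
  ultimately have "frontier I \<subseteq> {Inf I, Sup I}" unfolding frontier_def by force
  then show ?thesis by (rule finite_subset) simp
qed simp

lemma is_interval_borel:
  fixes I :: "real set"
  assumes "is_interval I"
  shows "I \<in> sets borel"
  using is_real_interval[OF assms] by auto

lemma bounded_cell [simp]: "bounded (cell h i)"
  unfolding cell_def by (rule bounded_subset[OF bounded_closed_interval[of "h * real i" "h * real (Suc i)"]]) auto

lemma borel_cell [measurable, simp]: "cell h i \<in> sets borel"
  by (simp add: cell_def)

lemma measure_cell [simp]: "0 \<le> h \<Longrightarrow> measure lborel (cell h i) = h"
  by (simp add: cell_def algebra_simps)

lemma measure_lborel_Times:
  fixes X Y :: "real set"
  assumes "X \<in> sets borel" "Y \<in> sets borel" "bounded Y" "bounded X"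
  shows "measure lborel (X \<times> Y) = measure lborel X * measure lborel Y"
proof -
  have "emeasure lborel (X \<times> Y) = emeasure (lborel \<Otimes>\<^sub>M lborel) (X \<times> Y)" by (simp add: lborel_prod)
  also have "\<dots> = emeasure lborel X * emeasure lborel Y"
    using assms by (intro lborel.emeasure_pair_measure_Times) auto
  finally show ?thesis by (simp add: measure_def enn2real_mult)
qed

section \<open>Random sources, sinks and \<open>\<alpha>\<close>-points\<close>

type_synonym box = "real set \<times> real set \<times> (real \<times> real) set"

definition valid_box :: "box \<Rightarrow> bool" where
  "valid_box = (\<lambda>(B, C, D). B \<in> sets borel \<and> bounded B \<and> B \<subseteq> {0<..} \<and> C \<in> sets borel \<and> bounded C \<and>
     C \<subseteq> {0<..} \<and> D \<in> sets borel \<and> bounded D \<and> D \<subseteq> {0<..} \<times> {0<..})"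

definition box_disjoint :: "box \<Rightarrow> box \<Rightarrow> bool" where
  "box_disjoint = (\<lambda>(B, C, D) (B', C', D'). B \<inter> B' = {} \<and> C \<inter> C' = {} \<and> D \<inter> D' = {})"

definition box_Un :: "box \<Rightarrow> box \<Rightarrow> box" where
  "box_Un = (\<lambda>(B, C, D) (B', C', D'). (B \<union> B', C \<union> C', D \<union> D'))"

text \<open>The order of this list is the order in which \<open>run\<close> consumes bits: all
  sources, then row by row the sink followed by the \<alpha>-cells.\<close>

definition grid :: "nat \<Rightarrow> (nat + nat \<times> nat) list" where
  "grid n = map Inl [0..<n] @ map Inr (List.product [0..<n] [0..<Suc n])"

definition grid_box :: "real \<Rightarrow> real \<Rightarrow> nat + nat \<times> nat \<Rightarrow> box" where
  "grid_box h h' c = (case c of Inl i \<Rightarrow> (cell h i, {}, {})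
     | Inr (j, 0) \<Rightarrow> ({}, cell h' j, {})
     | Inr (j, Suc i) \<Rightarrow> ({}, {}, cell h i \<times> cell h' j))"

lemma cell_unique: "0 < h \<Longrightarrow> x \<in> cell h i \<Longrightarrow> x \<in> cell h j \<Longrightarrow> i = j"
  using cell_disjoint by blast

lemma cell_positive: "0 < h \<Longrightarrow> cell h i \<subseteq> {0<..}"
  by (auto simp: cell_def intro: le_less_trans[rotated])

lemma valid_grid_box: "0 < h \<Longrightarrow> 0 < h' \<Longrightarrow> valid_box (grid_box h h' c)"
  using cell_positive[of h] cell_positive[of h']
  by (fastforce simp: valid_box_def grid_box_def split: sum.split nat.split
      intro: borel_Times bounded_Times)

lemma disjoint_grid_box:
  "0 < h \<Longrightarrow> 0 < h' \<Longrightarrow> c \<noteq> c' \<Longrightarrow> box_disjoint (grid_box h h' c) (grid_box h h' c')"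
  by (auto simp: box_disjoint_def grid_box_def split: sum.split nat.split
      dest: cell_unique[of h] cell_unique[of h'])

lemma distinct_grid: "distinct (grid n)"
  unfolding grid_def by (auto simp: distinct_map distinct_product simp del: upt_Suc)

lemma sorted_wrt_map_distinct:
  assumes "distinct xs" "\<And>x y. x \<noteq> y \<Longrightarrow> P (f x) (f y)"
  shows "sorted_wrt P (map f xs)"
  using assms(1) by (induction xs) (auto intro!: assms(2))

lemma map_grid:
  "map f (grid n) = map (\<lambda>i. f (Inl i)) [0..<n] @
    concat (map (\<lambda>j. f (Inr (j, 0)) # map (\<lambda>i. f (Inr (j, Suc i))) [0..<n]) [0..<n])"
proof -
  have prod: "List.product xs ys = concat (map (\<lambda>x. map (Pair x) ys) xs)" for xs :: "nat list" and ys :: "nat list"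
    by (induction xs) auto
  have "map (\<lambda>k. f (Inr (j, k))) [0..<Suc n] = f (Inr (j, 0)) # map (\<lambda>i. f (Inr (j, Suc i))) [0..<n]" for j
    unfolding upt_conv_Cons[OF zero_less_Suc] map_Suc_upt[symmetric] by simp
  then show ?thesis
    unfolding grid_def prod by (simp add: map_concat comp_def del: upt_Suc)
qed

text \<open>No law is fixed yet; only vacancy of triples of test sets has to be measurable. The
  counts used below are limits of functions of finitely many such events, and vacancy behaves well
  under superposition.\<close>

locale random_input = prob_space M for M :: "'w measure" +
  fixes S T :: "'w \<Rightarrow> real set" and A :: "'w \<Rightarrow> (real \<times> real) set"
  assumes subsets: "\<And>\<omega>. \<omega> \<in> space M \<Longrightarrow> S \<omega> \<subseteq> {0<..} \<and> T \<omega> \<subseteq> {0<..} \<and> A \<omega> \<subseteq> {0<..} \<times> {0<..}"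
    and loc_finite: "\<And>\<omega>. \<omega> \<in> space M \<Longrightarrow>
      locally_finite (S \<omega>) \<and> locally_finite (T \<omega>) \<and> locally_finite (A \<omega>)"
    and vacant_sets: "\<And>B C D. valid_box (B, C, D) \<Longrightarrow>
      {\<omega>\<in>space M. S \<omega> \<inter> B = {} \<and> T \<omega> \<inter> C = {} \<and> A \<omega> \<inter> D = {}} \<in> events"
begin

fun vacant :: "box \<Rightarrow> 'w set" where
  "vacant (B, C, D) = {\<omega>\<in>space M. S \<omega> \<inter> B = {} \<and> T \<omega> \<inter> C = {} \<and> A \<omega> \<inter> D = {}}"

lemma vacant_in_events: "valid_box X \<Longrightarrow> vacant X \<in> events"
  by (cases X) (auto intro: vacant_sets)

lemma vacant_Un: "vacant X \<inter> vacant Y = vacant (box_Un X Y)"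
  by (cases X; cases Y) (auto simp: box_Un_def)

definition occupancy :: "box list \<Rightarrow> 'w \<Rightarrow> bool list" where
  "occupancy Xs \<omega> = map (\<lambda>X. \<omega> \<notin> vacant X) Xs"

lemma length_occupancy [simp]: "length (occupancy Xs \<omega>) = length Xs"
  by (simp add: occupancy_def)

lemma measurable_occupancy:
  assumes "\<And>X. X \<in> set Xs \<Longrightarrow> valid_box X"
  shows "occupancy Xs \<in> measurable M (count_space UNIV)"
  unfolding occupancy_def
proof (rule measurable_map_count_space)
  fix X assume "X \<in> set Xs"
  then have "vacant X \<in> events" using assms vacant_in_events by blast
  then show "(\<lambda>\<omega>. \<omega> \<notin> vacant X) \<in> measurable M (count_space UNIV)"
    unfolding pred_def[symmetric] by measurable
qed

lemma integrable_occupancy: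
  fixes \<Phi> :: "bool list \<Rightarrow> real"
  assumes "\<And>X. X \<in> set Xs \<Longrightarrow> valid_box X"
  shows "integrable M (\<lambda>\<omega>. \<Phi> (occupancy Xs \<omega>))"
proof -
  define B where "B = Max ((\<lambda>bs. \<bar>\<Phi> bs\<bar>) ` {bs. length bs = length Xs})"
  have fin: "finite {bs :: bool list. length bs = length Xs}"
    using finite_lists_length_eq[of "UNIV :: bool set"] by simp
  have "\<bar>\<Phi> (occupancy Xs \<omega>)\<bar> \<le> B" for \<omega>
    unfolding B_def using fin by (intro Max_ge) auto
  moreover have "(\<lambda>\<omega>. \<Phi> (occupancy Xs \<omega>)) \<in> borel_measurable M"
    by (rule measurable_compose[OF measurable_occupancy[OF assms]]) auto
  ultimately show ?thesis by (intro integrable_const_bound[where B = B]) auto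
qed

lemma occupancy_grid:
  assumes "\<omega> \<in> space M"
  shows "occupancy (map (grid_box h h') (grid n)) \<omega> =
    bits h n (S \<omega>) @ concat (map (row_bits h h' n (T \<omega>) (A \<omega>)) [0..<n])"
  unfolding occupancy_def map_map comp_def map_grid
  using assms by (simp add: map_concat comp_def grid_box_def bits_def row_bits_def[abs_def])

definition grid_run :: "real \<Rightarrow> real \<Rightarrow> nat \<Rightarrow> 'w \<Rightarrow> bool list" where
  "grid_run h h' n \<omega> = (let bs = occupancy (map (grid_box h h') (grid n)) \<omega> in
     run n n (take n bs) (drop n bs))"

lemma eventually_grid_run:
  assumes "\<omega> \<in> space M" "0 < R" "0 < t"
  shows "\<forall>\<^sub>F n in sequentially. grid_run (R / real n) (t / real n) n \<omega> =
    bits (R / real n) n (hammersley (S \<omega>) (T \<omega>) (A \<omega>) t \<inter> {0<..R})"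
proof -
  note lf = loc_finite[OF assms(1)]
  show ?thesis
    using eventually_bits_window[OF conjunct1[OF lf] conjunct1[OF conjunct2[OF lf]] conjunct2[OF conjunct2[OF lf]] assms(2,3)]
    by eventually_elim (simp add: grid_run_def occupancy_grid[OF assms(1)])
qed

lemma measurable_grid_run:
  assumes "0 < R" "0 < t"
  shows "(\<lambda>\<omega>. (\<Phi> (grid_run (R / real n) (t / real n) n \<omega>) :: real)) \<in> borel_measurable M"
proof -
  let ?h = "R / real n" and ?h' = "t / real n"
  let ?Xs = "map (grid_box ?h ?h') (grid n)"
  have "occupancy ?Xs \<in> measurable M (count_space UNIV)"
  proof (cases n)
    case (Suc m)
    then have "0 < ?h" "0 < ?h'" using assms by auto
    from valid_grid_box[OF this] show ?thesis by (intro measurable_occupancy) auto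
  qed (use measurable_occupancy[of "[]"] in \<open>simp add: grid_def\<close>)
  from measurable_compose[OF this, of "\<lambda>bs. \<Phi> (run n n (take n bs) (drop n bs))"]
  show ?thesis by (simp add: grid_run_def Let_def)
qed

lemma finite_hammersley:
  "\<omega> \<in> space M \<Longrightarrow> finite (hammersley (S \<omega>) (T \<omega>) (A \<omega>) t \<inter> {0<..x})"
  using loc_finite by (intro finite_hammersley_Int) auto

text \<open>By exactness of the grid the count is a pointwise limit of functions of finitely many
  vacancy events.\<close>

lemma measurable_hammersley_count:
  assumes "0 < t"
  shows "(\<lambda>\<omega>. card (hammersley (S \<omega>) (T \<omega>) (A \<omega>) t \<inter> {0<..x})) \<in> measurable M (count_space UNIV)"
proof (cases "0 < x")
  case True
  let ?H = "\<lambda>\<omega>. hammersley (S \<omega>) (T \<omega>) (A \<omega>) t"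
  have "(\<lambda>\<omega>. real (card (?H \<omega> \<inter> {0<..x}))) \<in> borel_measurable M"
  proof (rule borel_measurable_LIMSEQ_real)
    fix \<omega> assume \<omega>: "\<omega> \<in> space M"
    have "\<forall>\<^sub>F n in sequentially. cell_count (x / real n) n UNIV (bits (x / real n) n (?H \<omega> \<inter> {0<..x})) =
        card (?H \<omega> \<inter> {0<..x} \<inter> UNIV)"
      using True finite_hammersley[OF \<omega>] by (intro eventually_cell_count_bits) auto
    with eventually_grid_run[OF \<omega> True assms]
    have "\<forall>\<^sub>F n in sequentially. real (cell_count (x / real n) n UNIV (grid_run (x / real n) (t / real n) n \<omega>)) =
        real (card (?H \<omega> \<inter> {0<..x}))"
      by eventually_elim simp
    then show "(\<lambda>n. real (cell_count (x / real n) n UNIV (grid_run (x / real n) (t / real n) n \<omega>)))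
        \<longlonglongrightarrow> real (card (?H \<omega> \<inter> {0<..x}))"
      by (rule tendsto_eventually)
  qed (use True assms in \<open>auto intro!: measurable_grid_run\<close>)
  then show ?thesis by (simp only: measurable_nat_iff_real)
qed simp

lemma measurable_hammersley_Int:
  assumes "0 < t" "B \<in> sets borel" "B \<subseteq> {0<..R}"
  shows "(\<lambda>\<omega>. card (hammersley (S \<omega>) (T \<omega>) (A \<omega>) t \<inter> B)) \<in> measurable M (count_space UNIV)"
  by (rule measurable_card_Int[OF finite_hammersley measurable_hammersley_count[OF assms(1)] assms(2,3)])

lemma occupancy_sources:
  assumes "\<omega> \<in> space M"
  shows "occupancy (map (\<lambda>i. (cell h i, {}, {})) [0..<n]) \<omega> = bits h n (S \<omega>)"
  using assms by (simp add: occupancy_def bits_def)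

lemma bits_restrict:
  assumes "0 < n"
  shows "0 < R \<Longrightarrow> bits (R / real n) n (C \<inter> {0<..R}) = bits (R / real n) n C"
proof -
  assume R: "0 < R"
  have "C \<inter> {0<..R} \<inter> cell (R / real n) i = C \<inter> cell (R / real n) i" if "i < n" for i
    using cell_subset[of "R / real n" i n] R that by auto
  then show ?thesis unfolding bits_def by (intro map_cong) auto
qed

lemma valid_source_cells: "0 < h \<Longrightarrow> X \<in> set (map (\<lambda>i. (cell h i, {}, {})) [0..<n]) \<Longrightarrow> valid_box X"
  using cell_positive[of h] by (auto simp: valid_box_def)

lemma measurable_source_bits:
  assumes "0 < R"
  shows "(\<lambda>\<omega>. (F (bits (R / real n) n (S \<omega>)) :: real)) \<in> borel_measurable M"
proof (cases n)
  case (Suc m)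
  then have "0 < R / real n" using assms by simp
  from measurable_compose[OF measurable_occupancy[of "map (\<lambda>i. (cell (R / real n) i, {}, {})) [0..<n]"], of F borel]
    valid_source_cells[OF this, of _ n]
  show ?thesis by (auto simp: occupancy_sources cong: measurable_cong)
qed (simp add: bits_def)

lemma eventually_source_bits:
  assumes "0 < R"
  shows "\<forall>\<^sub>F n in sequentially. bits (R / real n) n (S \<omega>) = bits (R / real n) n (S \<omega> \<inter> {0<..R})"
  using eventually_gt_at_top[of 0] by eventually_elim (use assms in \<open>simp add: bits_restrict\<close>)

lemma finite_source: "\<omega> \<in> space M \<Longrightarrow> finite (S \<omega> \<inter> {0<..R})"
  using loc_finite[of \<omega>] bounded_subset[OF bounded_closed_interval[of 0 R], of "{0<..R}"]
  by (auto simp: locally_finite_def)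

lemma measurable_source_count:
  "(\<lambda>\<omega>. card (S \<omega> \<inter> {0<..x})) \<in> measurable M (count_space UNIV)"
proof (cases "0 < x")
  case True
  have "(\<lambda>\<omega>. real (card (S \<omega> \<inter> {0<..x}))) \<in> borel_measurable M"
  proof (rule borel_measurable_LIMSEQ_real)
    fix \<omega> assume \<omega>: "\<omega> \<in> space M"
    have "\<forall>\<^sub>F n in sequentially. cell_count (x / real n) n UNIV (bits (x / real n) n (S \<omega> \<inter> {0<..x})) =
        card (S \<omega> \<inter> {0<..x} \<inter> UNIV)"
      using True finite_source[OF \<omega>] by (intro eventually_cell_count_bits) auto
    with eventually_source_bits[OF True, of \<omega>]
    have "\<forall>\<^sub>F n in sequentially. real (cell_count (x / real n) n UNIV (bits (x / real n) n (S \<omega>))) =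
        real (card (S \<omega> \<inter> {0<..x}))"
      by eventually_elim simp
    then show "(\<lambda>n. real (cell_count (x / real n) n UNIV (bits (x / real n) n (S \<omega>))))
        \<longlonglongrightarrow> real (card (S \<omega> \<inter> {0<..x}))"
      by (rule tendsto_eventually)
  qed (rule measurable_source_bits[OF True])
  then show ?thesis by (simp only: measurable_nat_iff_real)
qed simp

end

lemma measure_lborel_Un:
  fixes X Y :: "'c::euclidean_space set"
  assumes "X \<in> sets borel" "bounded X" "Y \<in> sets borel" "bounded Y" "X \<inter> Y = {}"
  shows "measure lborel (X \<union> Y) = measure lborel X + measure lborel Y"
  using assms emeasure_bounded_finite
  by (intro measure_Union) (auto simp: less_top)

definition box_weight :: "real \<Rightarrow> real \<Rightarrow> real \<Rightarrow> box \<Rightarrow> real" where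
  "box_weight \<rho> \<sigma> \<kappa> = (\<lambda>(B, C, D).
     \<rho> * measure lborel B + \<sigma> * measure lborel C + \<kappa> * measure lborel D)"

locale poisson_input = random_input +
  fixes \<rho> \<sigma> \<kappa> :: real
  assumes rates: "0 \<le> \<rho>" "0 \<le> \<sigma>" "0 \<le> \<kappa>"
    and prob_vacant: "\<And>B C D. valid_box (B, C, D) \<Longrightarrow>
      prob {\<omega>\<in>space M. S \<omega> \<inter> B = {} \<and> T \<omega> \<inter> C = {} \<and> A \<omega> \<inter> D = {}} =
      exp (- (\<rho> * measure lborel B + \<sigma> * measure lborel C + \<kappa> * measure lborel D))"
begin

abbreviation weight :: "box \<Rightarrow> real" where
  "weight \<equiv> box_weight \<rho> \<sigma> \<kappa>"

lemma prob_vacant_weight: "valid_box X \<Longrightarrow> prob (vacant X) = exp (- weight X)"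
  by (cases X) (auto simp: prob_vacant box_weight_def)

lemma weight_Un:
  "valid_box X \<Longrightarrow> valid_box Y \<Longrightarrow> box_disjoint X Y \<Longrightarrow> weight (box_Un X Y) = weight X + weight Y"
  by (cases X; cases Y)
    (auto simp: valid_box_def box_disjoint_def box_Un_def box_weight_def measure_lborel_Un algebra_simps)

lemma box_disjoint_Un: "box_disjoint X Z \<Longrightarrow> box_disjoint Y Z \<Longrightarrow> box_disjoint (box_Un X Y) Z"
  by (cases X; cases Y; cases Z) (auto simp: box_disjoint_def box_Un_def)

lemma valid_box_Un: "valid_box X \<Longrightarrow> valid_box Y \<Longrightarrow> valid_box (box_Un X Y)"
  by (cases X; cases Y) (auto simp: valid_box_def box_Un_def)

text \<open>Independence of occupied cells comes from void probabilities by inclusion and exclusion: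
  \<open>X\<close> is occupied if it is not vacant, and joint vacancy is vacancy of the union. The
  extra box \<open>X0\<close> collects the boxes already declared vacant and makes the induction
  work.\<close>

lemma expectation_vacant_occupancy:
  fixes \<Phi> :: "bool list \<Rightarrow> real"
  assumes "valid_box X0" "\<And>X. X \<in> set Xs \<Longrightarrow> valid_box X" "sorted_wrt box_disjoint (X0 # Xs)"
  shows "expectation (\<lambda>\<omega>. indicator (vacant X0) \<omega> * \<Phi> (occupancy Xs \<omega>)) =
    exp (- weight X0) * ebits (map (\<lambda>X. 1 - exp (- weight X)) Xs) \<Phi>"
  using assms
proof (induction Xs arbitrary: X0 \<Phi>)
  case Nil
  then show ?case by (simp add: occupancy_def prob_vacant_weight vacant_in_events)
next
  case (Cons X Xs)
  let ?Y = "box_Un X0 X" and ?e = "ebits (map (\<lambda>X. 1 - exp (- weight X)) Xs)"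
  let ?F = "\<lambda>bs. \<Phi> (False # bs)" and ?T = "\<lambda>bs. \<Phi> (True # bs)"
  have valid: "valid_box X" "valid_box ?Y" "\<And>X. X \<in> set Xs \<Longrightarrow> valid_box X"
    using Cons.prems valid_box_Un by auto
  have sorted: "sorted_wrt box_disjoint (X0 # Xs)" "sorted_wrt box_disjoint (?Y # Xs)"
    using Cons.prems(3) box_disjoint_Un by auto
  have int: "integrable M (\<lambda>\<omega>. indicator (vacant Y) \<omega> * G (occupancy Xs \<omega>))"
    if "valid_box Y" for Y and G :: "bool list \<Rightarrow> real"
    using integrable_real_mult_indicator[OF vacant_in_events[OF that] integrable_occupancy[OF valid(3), of Xs G]]
    by (simp add: mult.commute)
  have "expectation (\<lambda>\<omega>. indicator (vacant X0) \<omega> * \<Phi> (occupancy (X # Xs) \<omega>)) =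
    expectation (\<lambda>\<omega>. indicator (vacant ?Y) \<omega> * ?F (occupancy Xs \<omega>) +
      indicator (vacant X0) \<omega> * ?T (occupancy Xs \<omega>) - indicator (vacant ?Y) \<omega> * ?T (occupancy Xs \<omega>))"
    unfolding vacant_Un[symmetric]
    by (intro Bochner_Integration.integral_cong) (auto simp: occupancy_def indicator_def)
  also have "\<dots> = exp (- weight ?Y) * ?e ?F + exp (- weight X0) * ?e ?T - exp (- weight ?Y) * ?e ?T"
    using int[OF valid(2), of ?F] int[OF valid(2), of ?T] int[OF Cons.prems(1), of ?T]
    using Cons.IH[OF valid(2,3) sorted(2), of ?F] Cons.IH[OF valid(2,3) sorted(2), of ?T]
      Cons.IH[OF Cons.prems(1) valid(3) sorted(1), of ?T] by simp
  also have "exp (- weight ?Y) = exp (- weight X0) * exp (- weight X)"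
    using Cons.prems valid(1) by (simp add: weight_Un exp_add[symmetric])
  finally show ?case by (simp add: bern_def algebra_simps)
qed

lemma expectation_occupancy:
  fixes \<Phi> :: "bool list \<Rightarrow> real"
  assumes "\<And>X. X \<in> set Xs \<Longrightarrow> valid_box X" "sorted_wrt box_disjoint Xs"
  shows "expectation (\<lambda>\<omega>. \<Phi> (occupancy Xs \<omega>)) = ebits (map (\<lambda>X. 1 - exp (- weight X)) Xs) \<Phi>"
proof -
  have "expectation (\<lambda>\<omega>. indicator (vacant ({}, {}, {})) \<omega> * \<Phi> (occupancy Xs \<omega>)) =
    exp (- weight ({}, {}, {})) * ebits (map (\<lambda>X. 1 - exp (- weight X)) Xs) \<Phi>"
    using assms by (intro expectation_vacant_occupancy)
      (auto simp: valid_box_def box_disjoint_def split: prod.splits)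
  moreover have "expectation (\<lambda>\<omega>. indicator (vacant ({}, {}, {})) \<omega> * \<Phi> (occupancy Xs \<omega>)) =
      expectation (\<lambda>\<omega>. \<Phi> (occupancy Xs \<omega>))"
    by (intro Bochner_Integration.integral_cong) auto
  ultimately show ?thesis by (simp add: box_weight_def)
qed

lemma AE_vacant:
  assumes "valid_box X" "weight X = 0"
  shows "AE \<omega> in M. \<omega> \<in> vacant X"
  using prob_vacant_weight[OF assms(1)] assms(2) by (intro prob_eq_1[THEN iffD1] vacant_in_events assms) simp

lemma AE_source_avoids:
  assumes "finite F"
  shows "AE \<omega> in M. S \<omega> \<inter> F = {}"
proof -
  have "finite (F \<inter> {0<..})" using assms by simp
  then have "valid_box (F \<inter> {0<..}, {}, {})" "weight (F \<inter> {0<..}, {}, {}) = 0"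
    by (auto simp: valid_box_def box_weight_def finite_imp_bounded measure_def emeasure_lborel_countable
        countable_finite intro: borel_closed finite_imp_closed)
  from AE_vacant[OF this] AE_space show ?thesis
  proof eventually_elim
    case (elim \<omega>)
    then show ?case using subsets[OF elim(2)] by auto
  qed
qed

text \<open>A particle in \<open>F\<close> is a source in \<open>F\<close> or comes from an
  \<alpha>-point above \<open>F\<close>, and the strip over a finite set has area zero.\<close>

lemma AE_hammersley_avoids:
  assumes "finite F"
  shows "AE \<omega> in M. hammersley (S \<omega>) (T \<omega>) (A \<omega>) t \<inter> {0<..R} \<inter> F = {}"
proof -
  let ?F = "F \<inter> {0<..}" and ?X = "({}, {}, (F \<inter> {0<..}) \<times> {0<..t})"
  have fin: "finite ?F" using assms by simp
  have F: "?F \<in> sets borel" "bounded ?F" "measure lborel ?F = 0"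
    using fin by (auto simp: finite_imp_bounded measure_def emeasure_lborel_countable
        countable_finite intro: borel_closed finite_imp_closed)
  have b: "bounded {0<..t}" by (rule bounded_subset[OF bounded_closed_interval[of 0 t]]) auto
  have "valid_box ?X"
    using F b by (auto simp: valid_box_def intro: borel_Times bounded_Times)
  moreover have "weight ?X = 0"
    using F b by (simp add: box_weight_def measure_lborel_Times)
  ultimately have "AE \<omega> in M. \<omega> \<in> vacant ?X" by (rule AE_vacant)
  with AE_source_avoids[OF assms] AE_space show ?thesis
  proof eventually_elim
    case (elim \<omega>)
    note lf = loc_finite[OF elim(2)]
    show ?case
    proof (cases "0 < R")
      case True
      have "hammersley (S \<omega>) (T \<omega>) (A \<omega>) t \<inter> {0<..R} \<subseteq> S \<omega> \<union> fst ` (A \<omega> \<inter> {0<..R} \<times> {0<..t})"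
        using hammersley_Int_window[of "S \<omega>" "T \<omega>" "A \<omega>" R t] window_subset[of "T \<omega>" "A \<omega>" t t "S \<omega>" R] lf True
        by auto
      moreover have "fst ` (A \<omega> \<inter> {0<..R} \<times> {0<..t}) \<inter> F = {}" using elim(3) by auto
      ultimately show ?thesis using elim(1) by blast
    qed simp
  qed
qed

text \<open>Dominated convergence, applied both to the sources and to the evolved particles. The
  exceptional null set consists of the outcomes with a particle at an end point of one of the
  intervals.\<close>

lemma tendsto_expectation_cell_count:
  fixes f :: "nat list \<Rightarrow> real" and Y :: "'a \<Rightarrow> real set" and bs :: "nat \<Rightarrow> 'a \<Rightarrow> bool list"
  assumes "0 < R" and Is: "\<And>I. I \<in> set Is \<Longrightarrow> is_interval I \<and> I \<subseteq> {0<..R}"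
    and f: "\<And>v. \<bar>f v\<bar> \<le> 1"
    and fin: "\<And>\<omega>. \<omega> \<in> space M \<Longrightarrow> finite (Y \<omega> \<inter> {0<..R})"
    and meas: "\<And>I. I \<in> set Is \<Longrightarrow> (\<lambda>\<omega>. card (Y \<omega> \<inter> I)) \<in> measurable M (count_space UNIV)"
    and meas_bs: "\<And>n F. (\<lambda>\<omega>. (F (bs n \<omega>) :: real)) \<in> borel_measurable M"
    and avoids: "\<And>F. finite F \<Longrightarrow> AE \<omega> in M. Y \<omega> \<inter> {0<..R} \<inter> F = {}"
    and bs: "\<And>\<omega>. \<omega> \<in> space M \<Longrightarrow> \<forall>\<^sub>F n in sequentially. bs n \<omega> = bits (R / real n) n (Y \<omega> \<inter> {0<..R})"
  shows "(\<lambda>n. expectation (\<lambda>\<omega>. f (map (\<lambda>I. cell_count (R / real n) n I (bs n \<omega>)) Is))) \<longlonglongrightarrow>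
    expectation (\<lambda>\<omega>. f (map (\<lambda>I. card (Y \<omega> \<inter> I)) Is))"
proof (rule integral_dominated_convergence[where w = "\<lambda>_. 1"])
  have bnd: "bounded I" if "I \<in> set Is" for I
    using Is[OF that] bounded_subset[OF bounded_closed_interval[of 0 R], of I] by force
  then have "finite (\<Union>I\<in>set Is. frontier I)"
    using Is by (auto intro: finite_frontier_interval)
  from avoids[OF this] AE_space
  show "AE \<omega> in M. (\<lambda>n. f (map (\<lambda>I. cell_count (R / real n) n I (bs n \<omega>)) Is)) \<longlonglongrightarrow>
      f (map (\<lambda>I. card (Y \<omega> \<inter> I)) Is)"
  proof eventually_elim
    case (elim \<omega>)
    have "\<forall>\<^sub>F n in sequentially. cell_count (R / real n) n I (bits (R / real n) n (Y \<omega> \<inter> {0<..R})) =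
        card (Y \<omega> \<inter> I)" if "I \<in> set Is" for I
    proof -
      have "Y \<omega> \<inter> {0<..R} \<inter> I = Y \<omega> \<inter> I" using Is[OF that] by auto
      moreover have "Y \<omega> \<inter> {0<..R} \<inter> frontier I = {}" using elim(1) that by blast
      ultimately show ?thesis
        using eventually_cell_count_bits[OF assms(1) fin[OF elim(2)], of I] by simp
    qed
    then have "\<forall>\<^sub>F n in sequentially. \<forall>I\<in>set Is.
        cell_count (R / real n) n I (bits (R / real n) n (Y \<omega> \<inter> {0<..R})) = card (Y \<omega> \<inter> I)"
      by (intro eventually_ball_finite) auto
    with bs[OF elim(2)]
    have "\<forall>\<^sub>F n in sequentially. f (map (\<lambda>I. cell_count (R / real n) n I (bs n \<omega>)) Is) =
        f (map (\<lambda>I. card (Y \<omega> \<inter> I)) Is)"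
    proof eventually_elim
      case (elim n)
      then have "map (\<lambda>I. cell_count (R / real n) n I (bs n \<omega>)) Is = map (\<lambda>I. card (Y \<omega> \<inter> I)) Is"
        by (intro map_cong) auto
      then show ?case by (simp only:)
    qed
    then show ?case by (rule tendsto_eventually)
  qed
  show "(\<lambda>\<omega>. f (map (\<lambda>I. card (Y \<omega> \<inter> I)) Is)) \<in> borel_measurable M"
    by (rule measurable_compose[OF measurable_map_count_space[OF meas]]) auto
qed (use f in \<open>auto intro: meas_bs\<close>)

text \<open>The limit is left unidentified on purpose: the same Bernoulli expectations reappear for
  other processes, and uniqueness of limits then gives equality of laws.\<close>

theorem source_law:
  assumes "0 < R" and Is: "\<And>I. I \<in> set Is \<Longrightarrow> is_interval I \<and> I \<subseteq> {0<..R}" and f: "\<And>v. \<bar>f v\<bar> \<le> 1"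
  shows "(\<lambda>n. ebits (replicate n (1 - exp (- (\<rho> * (R / real n)))))
      (\<lambda>bs. f (map (\<lambda>I. cell_count (R / real n) n I bs) Is))) \<longlonglongrightarrow>
    expectation (\<lambda>\<omega>. f (map (\<lambda>I. card (S \<omega> \<inter> I)) Is))"
proof -
  let ?F = "\<lambda>n bs. f (map (\<lambda>I. cell_count (R / real n) n I bs) Is)"
  have "(\<lambda>n. expectation (\<lambda>\<omega>. ?F n (bits (R / real n) n (S \<omega>)))) \<longlonglongrightarrow>
      expectation (\<lambda>\<omega>. f (map (\<lambda>I. card (S \<omega> \<inter> I)) Is))"
  proof (rule tendsto_expectation_cell_count[OF assms(1) Is f finite_source])
    fix I assume "I \<in> set Is"
    then show "(\<lambda>\<omega>. card (S \<omega> \<inter> I)) \<in> measurable M (count_space UNIV)"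
      using Is by (intro measurable_card_Int[OF finite_source measurable_source_count, where R = R])
        (auto intro: is_interval_borel)
  next
    fix F :: "real set" assume "finite F"
    from AE_source_avoids[OF this] show "AE \<omega> in M. S \<omega> \<inter> {0<..R} \<inter> F = {}"
      by eventually_elim auto
  qed (use assms(1) in \<open>auto intro: measurable_source_bits eventually_source_bits\<close>)
  moreover have "\<forall>\<^sub>F n in sequentially. expectation (\<lambda>\<omega>. ?F n (bits (R / real n) n (S \<omega>))) =
      ebits (replicate n (1 - exp (- (\<rho> * (R / real n))))) (?F n)"
    using eventually_gt_at_top[of 0]
  proof eventually_elim
    case (elim n)
    let ?Xs = "map (\<lambda>i. (cell (R / real n) i, {}, {})) [0..<n] :: box list"
    have h: "0 < R / real n" using elim assms(1) by simp
    have "expectation (\<lambda>\<omega>. ?F n (bits (R / real n) n (S \<omega>))) = expectation (\<lambda>\<omega>. ?F n (occupancy ?Xs \<omega>))"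
      by (intro Bochner_Integration.integral_cong) (auto simp: occupancy_sources)
    also have "\<dots> = ebits (map (\<lambda>X. 1 - exp (- weight X)) ?Xs) (?F n)"
    proof (rule expectation_occupancy[OF valid_source_cells[OF h]])
      show "sorted_wrt box_disjoint ?Xs"
        using cell_disjoint[OF h] by (intro sorted_wrt_map_distinct) (auto simp: box_disjoint_def)
    qed auto
    also have "map (\<lambda>X. 1 - exp (- weight X)) ?Xs = map (\<lambda>_. 1 - exp (- (\<rho> * (R / real n)))) [0..<n]"
      using h by (simp add: box_weight_def)
    finally show ?case by (simp add: map_replicate_trivial)
  qed
  ultimately show ?thesis by (rule Lim_transform_eventually)
qed

text \<open>Burke's theorem, since the limit is the one in \<open>source_law\<close>.\<close>

theorem hammersley_law:
  assumes stat: "0 < \<rho>" "\<sigma> = 1 / \<rho>" "\<kappa> = 1"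
    and "0 < R" "0 < t" and Is: "\<And>I. I \<in> set Is \<Longrightarrow> is_interval I \<and> I \<subseteq> {0<..R}" and f: "\<And>v. \<bar>f v\<bar> \<le> 1"
  shows "(\<lambda>n. ebits (replicate n (1 - exp (- (\<rho> * (R / real n)))))
      (\<lambda>bs. f (map (\<lambda>I. cell_count (R / real n) n I bs) Is))) \<longlonglongrightarrow>
    expectation (\<lambda>\<omega>. f (map (\<lambda>I. card (hammersley (S \<omega>) (T \<omega>) (A \<omega>) t \<inter> I)) Is))"
proof -
  let ?F = "\<lambda>n bs. f (map (\<lambda>I. cell_count (R / real n) n I bs) Is)"
  let ?p = "\<lambda>n. 1 - exp (- (\<rho> * (R / real n)))" and ?q = "\<lambda>n. 1 - exp (- (1 / \<rho> * (t / real n)))"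
    and ?r = "\<lambda>n. 1 - exp (- (R / real n * (t / real n)))"
  let ?H = "\<lambda>\<omega>. hammersley (S \<omega>) (T \<omega>) (A \<omega>) t"
  let ?E = "\<lambda>n. expectation (\<lambda>\<omega>. ?F n (grid_run (R / real n) (t / real n) n \<omega>))"
  have "?E \<longlonglongrightarrow> expectation (\<lambda>\<omega>. f (map (\<lambda>I. card (?H \<omega> \<inter> I)) Is))"
  proof (rule tendsto_expectation_cell_count[OF assms(4) Is f finite_hammersley])
    fix I assume "I \<in> set Is"
    then show "(\<lambda>\<omega>. card (?H \<omega> \<inter> I)) \<in> measurable M (count_space UNIV)"
      using Is assms(5) by (intro measurable_hammersley_Int[where R = R]) (auto intro: is_interval_borel)
  qed (use assms(4,5) in \<open>auto intro: measurable_grid_run eventually_grid_run AE_hammersley_avoids\<close>)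
  moreover have "(\<lambda>n. ?E n - ebits (replicate n (?p n)) (?F n)) \<longlonglongrightarrow> 0"
  proof (rule Lim_null_comparison[OF _ cell_error_limit[OF stat(1) assms(4,5)]])
    show "\<forall>\<^sub>F n in sequentially. norm (?E n - ebits (replicate n (?p n)) (?F n)) \<le>
        real n * (real n * cell_error (?p n) (?q n) (?r n))"
      using eventually_gt_at_top[of 0]
    proof eventually_elim
      case (elim n)
      let ?h = "R / real n" and ?h' = "t / real n"
      let ?Xs = "map (grid_box ?h ?h') (grid n)"
      have h: "0 < ?h" "0 < ?h'" using elim assms(4,5) by auto
      have "?E n = ebits (map (\<lambda>X. 1 - exp (- weight X)) ?Xs) (\<lambda>bs. ?F n (run n n (take n bs) (drop n bs)))"
        unfolding grid_run_def Let_def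
        using valid_grid_box[OF h] disjoint_grid_box[OF h] distinct_grid[of n]
        by (intro expectation_occupancy[where \<Phi> = "\<lambda>bs. ?F n (run n n (take n bs) (drop n bs))"])
          (auto intro!: sorted_wrt_map_distinct)
      also have "map (\<lambda>X. 1 - exp (- weight X)) ?Xs =
          replicate n (?p n) @ concat (replicate n (?q n # replicate n (?r n)))"
      proof -
        have "weight (grid_box ?h ?h' (Inl i)) = \<rho> * ?h" "weight (grid_box ?h ?h' (Inr (j, 0))) = 1 / \<rho> * ?h'"
          "weight (grid_box ?h ?h' (Inr (j, Suc i))) = ?h * ?h'" for i j
          using h stat by (auto simp: grid_box_def box_weight_def measure_lborel_Times)
        then show ?thesis
          unfolding list.map_comp comp_def by (simp only: map_grid map_replicate_trivial)
      qed
      finally have E: "?E n = ebits (replicate n (?p n) @ concat (replicate n (?q n # replicate n (?r n))))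
          (\<lambda>bs. ?F n (run n n (take n bs) (drop n bs)))" .
      have "0 \<le> \<rho> * ?h" "0 \<le> 1 / \<rho> * ?h'" "0 \<le> ?h * ?h'"
        using h stat(1) by (intro mult_nonneg_nonneg; simp)+
      note b = one_minus_exp_bounds(3,4)[OF this(1)] one_minus_exp_bounds(3,4)[OF this(2)]
        one_minus_exp_bounds(3,4)[OF this(3)]
      show ?case unfolding E real_norm_def by (rule run_stationary[OF b f])
    qed
  qed
  ultimately show ?thesis using tendsto_diff[of ?E _ sequentially "\<lambda>n. ?E n - ebits (replicate n (?p n)) (?F n)" 0] by simp
qed

end

section \<open>Absence of ties\<close>

text \<open>Asking for membership in eventually all \<open>E n\<close>, instead of infinitely many,
  makes convergence to zero sufficient; the probabilities used below are of order
  \<open>1 / n\<close> and not summable.\<close>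

lemma (in prob_space) AE_not_eventually:
  assumes "\<And>n. E n \<in> events" "(\<lambda>n. prob (E n)) \<longlonglongrightarrow> 0"
  shows "AE \<omega> in M. \<not> (\<forall>\<^sub>F n in sequentially. \<omega> \<in> E n)"
proof -
  have "AE \<omega> in M. \<not> (\<forall>n\<ge>N. \<omega> \<in> E n)" for N
  proof -
    let ?Z = "\<Inter>n\<in>{N..}. E n"
    have Z: "?Z \<in> events" using assms(1) by (intro sets.countable_INT') auto
    have "prob ?Z \<le> prob (E n)" if "N \<le> n" for n
      using that assms(1) by (intro finite_measure_mono) auto
    then have "prob ?Z \<le> 0" by (intro LIMSEQ_le_const[OF assms(2)]) auto
    then have "prob ?Z = 0" by (simp add: measure_le_0_iff)
    then have "AE \<omega> in M. \<omega> \<notin> ?Z" using Z by (simp add: prob_eq_0)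
    then show ?thesis by eventually_elim auto
  qed
  then have "AE \<omega> in M. \<forall>N. \<not> (\<forall>n\<ge>N. \<omega> \<in> E n)" by (simp add: AE_all_countable)
  then show ?thesis by (simp add: eventually_sequentially)
qed

context poisson_input
begin

definition both_occupied :: "box \<Rightarrow> box \<Rightarrow> 'a set" where
  "both_occupied X Y = (space M - vacant X) \<inter> (space M - vacant Y)"

lemma both_occupied_events: "valid_box X \<Longrightarrow> valid_box Y \<Longrightarrow> both_occupied X Y \<in> events"
  unfolding both_occupied_def using vacant_in_events by auto

lemma weight_nonneg: "0 \<le> weight X"
  using rates by (cases X) (simp add: box_weight_def)

lemma prob_both_occupied_le:
  assumes "valid_box X" "valid_box Y" "box_disjoint X Y"
  shows "prob (both_occupied X Y) \<le> weight X * weight Y"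
proof -
  let ?\<Phi> = "\<lambda>bs. of_bool (bs ! 0 \<and> bs ! 1) :: real"
  have "prob (both_occupied X Y) = expectation (indicator (both_occupied X Y))"
    using both_occupied_events[OF assms(1,2)] by simp
  also have "\<dots> = expectation (\<lambda>\<omega>. ?\<Phi> (occupancy [X, Y] \<omega>))"
    by (intro Bochner_Integration.integral_cong)
      (auto simp: both_occupied_def occupancy_def indicator_def)
  also have "\<dots> = ebits (map (\<lambda>X. 1 - exp (- weight X)) [X, Y]) ?\<Phi>"
    by (rule expectation_occupancy) (use assms in auto)
  also have "\<dots> = (1 - exp (- weight X)) * (1 - exp (- weight Y))"
    by (simp add: bern_def)
  also have "\<dots> \<le> weight X * weight Y"
    using weight_nonneg one_minus_exp_bounds by (intro mult_mono) auto
  finally show ?thesis .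
qed

text \<open>A tie forces, for fine grids, either a source and an \<alpha>-point in one column, or
  \<alpha>-points in two different cells of one column. The union bounds have \<open>n\<close> terms
  of order \<open>n\<close> to the power -2 and \<open>n ^ 3\<close> terms of order \<open>n\<close>
  to the power -4, so both are of order \<open>1 / n\<close>.\<close>

lemma AE_no_ties_window:
  assumes "0 < K"
  shows "AE \<omega> in M. \<not> (\<exists>u s. (u, s) \<in> A \<omega> \<and> u \<le> K \<and> s \<le> K \<and>
    (u \<in> S \<omega> \<or> (\<exists>s'. s' \<noteq> s \<and> s' \<le> K \<and> (u, s') \<in> A \<omega>)))" (is "AE \<omega> in M. \<not> ?tie \<omega>")
proof -
  let ?h = "\<lambda>n. K / real (Suc n)"
  define X :: "nat \<Rightarrow> nat \<Rightarrow> box" where "X n i = (cell (?h n) i, {}, {})" for n i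
  define Y :: "nat \<Rightarrow> nat \<Rightarrow> box" where "Y n i = ({}, {}, cell (?h n) i \<times> {0<..K})" for n i
  define Z :: "nat \<Rightarrow> nat \<Rightarrow> nat \<Rightarrow> box" where "Z n i j = ({}, {}, cell (?h n) i \<times> cell (?h n) j)" for n i j
  define E where "E n = (\<Union>i\<in>{..n}. both_occupied (X n i) (Y n i)) \<union>
    (\<Union>i\<in>{..n}. \<Union>j\<in>{..n}. \<Union>j'\<in>{..n} - {j}. both_occupied (Z n i j) (Z n i j'))" for n
  have h: "0 < ?h n" "0 \<le> ?h n" for n using assms by auto
  have bK: "bounded {0<..K}" by (rule bounded_subset[OF bounded_closed_interval[of 0 K]]) auto
  have valid: "valid_box (X n i)" "valid_box (Y n i)" "valid_box (Z n i j)" for n i j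
    using cell_positive[OF h(1)[of n]] bK
    by (fastforce simp: valid_box_def X_def Y_def Z_def intro: borel_Times bounded_Times)+
  have w: "weight (X n i) = \<rho> * ?h n" "weight (Y n i) = \<kappa> * (?h n * K)"
    "weight (Z n i j) = \<kappa> * (?h n * ?h n)" for n i j
    using assms h(2)[of n] bK by (simp_all add: box_weight_def X_def Y_def Z_def measure_lborel_Times)
  have disj: "box_disjoint (X n i) (Y n i)" "j \<noteq> j' \<Longrightarrow> box_disjoint (Z n i j) (Z n i j')" for n i j j'
    using cell_disjoint[OF h(1)[of n], of j j'] by (auto simp: box_disjoint_def X_def Y_def Z_def)
  have E: "E n \<in> events" for n
    unfolding E_def using both_occupied_events valid by (intro sets.Un sets.finite_UN) auto
  have scaling: "x * (\<rho> * (K / x) * (\<kappa> * (K / x * K))) + x * (x * (x * ((\<kappa> * (K / x * (K / x))) * (\<kappa> * (K / x * (K / x)))))) =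
      \<rho> * \<kappa> * K ^ 3 / x + \<kappa>\<^sup>2 * K ^ 4 / x" if "x \<noteq> 0" for x :: real
    using that by (simp add: field_simps power2_eq_square power3_eq_cube power4_eq_xxxx)
  have P: "prob (E n) \<le> \<rho> * \<kappa> * K ^ 3 / real (Suc n) + \<kappa>\<^sup>2 * K ^ 4 / real (Suc n)" for n
  proof -
    have "prob (E n) \<le> (\<Sum>i\<in>{..n}. prob (both_occupied (X n i) (Y n i))) +
        (\<Sum>i\<in>{..n}. \<Sum>j\<in>{..n}. \<Sum>j'\<in>{..n} - {j}. prob (both_occupied (Z n i j) (Z n i j')))"
    proof -
      have b: "both_occupied (X n i) (Y n i) \<in> events" "both_occupied (Z n i j) (Z n i j') \<in> events" for i j j'
        using both_occupied_events valid by auto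
      show ?thesis
        unfolding E_def using b
        by (intro order_trans[OF measure_Un_le] add_mono order_trans[OF measure_UNION_le]
            sum_mono order_refl sets.finite_UN finite_atMost finite_Diff) auto
    qed
    also have "\<dots> \<le> (\<Sum>i\<in>{..n}. \<rho> * ?h n * (\<kappa> * (?h n * K))) +
        (\<Sum>i\<in>{..n}. \<Sum>j\<in>{..n}. \<Sum>j'\<in>{..n} - {j}. (\<kappa> * (?h n * ?h n)) * (\<kappa> * (?h n * ?h n)))"
      using prob_both_occupied_le[OF valid(1,2) disj(1)] prob_both_occupied_le[OF valid(3) valid(3) disj(2)]
      unfolding w by (intro add_mono sum_mono) auto
    also have "\<dots> \<le> real (Suc n) * (\<rho> * ?h n * (\<kappa> * (?h n * K))) +
        real (Suc n) * (real (Suc n) * (real (Suc n) * ((\<kappa> * (?h n * ?h n)) * (\<kappa> * (?h n * ?h n)))))"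
    proof -
      define c where "c = (\<kappa> * (?h n * ?h n)) * (\<kappa> * (?h n * ?h n))"
      have "0 \<le> c" unfolding c_def by (rule zero_le_square)
      have "(\<Sum>i\<in>{..n}. \<Sum>j\<in>{..n}. \<Sum>j'\<in>{..n} - {j}. c) = (\<Sum>i\<in>{..n}. \<Sum>j\<in>{..n}. real n * c)"
        by (intro sum.cong) auto
      also have "\<dots> = real (Suc n) * (real (Suc n) * (real n * c))"
        by (simp only: sum_constant card_atMost)
      also have "\<dots> \<le> real (Suc n) * (real (Suc n) * (real (Suc n) * c))"
        using \<open>0 \<le> c\<close> by (intro mult_left_mono mult_right_mono) auto
      finally have "(\<Sum>i\<in>{..n}. \<Sum>j\<in>{..n}. \<Sum>j'\<in>{..n} - {j}. c) \<le> real (Suc n) * (real (Suc n) * (real (Suc n) * c))" .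
      moreover have "(\<Sum>i\<in>{..n}. d) = real (Suc n) * d" for d :: real by simp
      ultimately show ?thesis unfolding c_def by (simp only: add_left_mono)
    qed
    also have "\<dots> = \<rho> * \<kappa> * K ^ 3 / real (Suc n) + \<kappa>\<^sup>2 * K ^ 4 / real (Suc n)"
      by (rule scaling) simp
    finally show ?thesis .
  qed
  have "(\<lambda>n. c / real (Suc n)) \<longlonglongrightarrow> 0" for c :: real
    by (rule LIMSEQ_Suc[OF lim_const_over_n])
  from tendsto_add[OF this[of "\<rho> * \<kappa> * K ^ 3"] this[of "\<kappa>\<^sup>2 * K ^ 4"]]
  have lim: "(\<lambda>n. \<rho> * \<kappa> * K ^ 3 / real (Suc n) + \<kappa>\<^sup>2 * K ^ 4 / real (Suc n)) \<longlonglongrightarrow> 0" by simp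
  have "(\<lambda>n. prob (E n)) \<longlonglongrightarrow> 0"
  proof (rule tendsto_sandwich[OF _ _ tendsto_const lim])
    show "\<forall>\<^sub>F n in sequentially. prob (E n) \<le> \<rho> * \<kappa> * K ^ 3 / real (Suc n) + \<kappa>\<^sup>2 * K ^ 4 / real (Suc n)"
      by (rule always_eventually, rule allI, rule P)
  qed simp
  from AE_not_eventually[OF E this] AE_space show ?thesis
  proof eventually_elim
    case (elim \<omega>)
    have "\<forall>\<^sub>F n in sequentially. \<omega> \<in> E n" if tie: "?tie \<omega>"
    proof -
      from tie obtain u s where us: "(u, s) \<in> A \<omega>" "u \<le> K" "s \<le> K"
        "u \<in> S \<omega> \<or> (\<exists>s'. s' \<noteq> s \<and> s' \<le> K \<and> (u, s') \<in> A \<omega>)" by blast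
      have pos: "0 < u" "0 < s" using subsets[OF elim(2)] us(1) by auto
      have ci: "\<exists>i\<le>n. v \<in> cell (?h n) i" if "0 < v" "v \<le> K" for v n
        using ex_cell[OF h(1)[of n] that(1), of "Suc n"] that(2) by (auto simp: less_Suc_eq_le)
      show ?thesis
      proof (cases "u \<in> S \<omega>")
        case True
        have "\<omega> \<in> E n" for n
        proof -
          obtain i where "i \<le> n" "u \<in> cell (?h n) i" using ci pos us by blast
          then have "\<omega> \<in> both_occupied (X n i) (Y n i)"
            using True us pos elim(2) by (auto simp: both_occupied_def X_def Y_def)
          then show ?thesis using \<open>i \<le> n\<close> by (auto simp: E_def)
        qed
        then show ?thesis by simp
      next
        case False
        then obtain s' where s': "s' \<noteq> s" "s' \<le> K" "(u, s') \<in> A \<omega>" using us(4) by blast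
        have pos': "0 < s'" using subsets[OF elim(2)] s' by auto
        have "\<forall>\<^sub>F n in sequentially. ?h n < \<bar>s - s'\<bar>"
          using order_tendstoD(2)[OF LIMSEQ_Suc[OF lim_const_over_n], of "\<bar>s - s'\<bar>" K] s'(1) by simp
        then show ?thesis
        proof eventually_elim
          case (elim n)
          obtain i j j' where c: "i \<le> n" "u \<in> cell (?h n) i" "j \<le> n" "s \<in> cell (?h n) j"
            "j' \<le> n" "s' \<in> cell (?h n) j'" using ci pos pos' us s' by meson
          have "j' \<noteq> j" using cell_dist[OF c(4), of s'] c(6) elim by force
          moreover have "\<omega> \<in> both_occupied (Z n i j) (Z n i j')"
            using us s' c \<open>\<omega> \<in> space M\<close> by (auto simp: both_occupied_def Z_def)
          ultimately show ?case using c unfolding E_def by blast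
        qed
      qed
    qed
    then show ?case using elim(1) by blast
  qed
qed

lemma AE_no_ties: "AE \<omega> in M. no_ties (S \<omega>) (A \<omega>)"
proof -
  have "AE \<omega> in M. \<forall>k. \<not> (\<exists>u s. (u, s) \<in> A \<omega> \<and> u \<le> real (Suc k) \<and> s \<le> real (Suc k) \<and>
      (u \<in> S \<omega> \<or> (\<exists>s'. s' \<noteq> s \<and> s' \<le> real (Suc k) \<and> (u, s') \<in> A \<omega>)))"
    unfolding AE_all_countable by (intro allI AE_no_ties_window) simp
  then show ?thesis
  proof eventually_elim
    case (elim \<omega>)
    have big: "\<exists>k. u \<le> real (Suc k) \<and> s \<le> real (Suc k) \<and> s' \<le> real (Suc k)" for u s s' :: real
    proof -
      obtain k where "max u (max s s') \<le> real k" using real_arch_simple by blast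
      then show ?thesis by (intro exI[of _ k]) auto
    qed
    show ?case unfolding no_ties_def
    proof (intro ballI, clarify, intro conjI allI impI notI)
      fix u s assume "(u, s) \<in> A \<omega>" "u \<in> S \<omega>"
      then show False using elim big[of u s s] by blast
    next
      fix u s s' assume "(u, s) \<in> A \<omega>" "(u, s') \<in> A \<omega>"
      then show "s' = s" using elim big[of u s s'] by blast
    qed
  qed
qed

end

section \<open>Affine images of Poisson processes\<close>

lemma measure_lborel_affine_image:
  fixes B :: "real set"
  assumes "B \<in> sets borel" "bounded B" "c \<noteq> 0"
  shows "(\<lambda>y. c * y + d) ` B \<in> sets borel" "bounded ((\<lambda>y. c * y + d) ` B)"
    and "measure lborel ((\<lambda>y. c * y + d) ` B) = \<bar>c\<bar> * measure lborel B"
proof -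
  let ?f = "\<lambda>y. c * y + d"
  have im: "?f ` B = (\<lambda>z. (z - d) / c) -` B"
    using assms(3) by (auto simp: image_iff field_simps intro!: bexI[of _ "(_ - d) / c"])
  show meas: "?f ` B \<in> sets borel"
    unfolding im using measurable_sets[of "\<lambda>z. (z - d) / c" borel borel B] assms(1) by simp
  obtain b where "\<And>y. y \<in> B \<Longrightarrow> \<bar>y\<bar> \<le> b" using assms(2) by (auto simp: bounded_real)
  then have "\<bar>?f y\<bar> \<le> \<bar>c\<bar> * b + \<bar>d\<bar>" if "y \<in> B" for y
    using that by (intro order_trans[OF abs_triangle_ineq] add_right_mono) (simp add: abs_mult mult_left_mono)
  then show "bounded (?f ` B)" by (auto simp: bounded_real)
  have "emeasure lborel (?f ` B) = emeasure (density (distr lborel borel (\<lambda>x. d + c * x)) (\<lambda>_. ennreal \<bar>c\<bar>)) (?f ` B)"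
    using lborel_real_affine[OF assms(3), of d] by simp
  also have "\<dots> = ennreal \<bar>c\<bar> * emeasure (distr lborel borel (\<lambda>x. d + c * x)) (?f ` B)"
    using meas by (subst emeasure_density_const) auto
  also have "emeasure (distr lborel borel (\<lambda>x. d + c * x)) (?f ` B) = emeasure lborel ((\<lambda>x. d + c * x) -` (?f ` B))"
    using meas by (subst emeasure_distr) auto
  also have "(\<lambda>x. d + c * x) -` (?f ` B) = B"
    using assms(3) by (auto simp: add.commute)
  finally show "measure lborel (?f ` B) = \<bar>c\<bar> * measure lborel B"
    by (simp add: measure_def enn2real_mult)
qed

lemma locally_finite_affine_vimage:
  fixes X :: "real set"
  assumes "locally_finite X" "c \<noteq> 0"
  shows "locally_finite {y. c * y + d \<in> X}"
  unfolding locally_finite_def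
proof (intro allI impI)
  fix B :: "real set" assume B: "bounded B"
  let ?f = "\<lambda>y. c * y + d"
  obtain b where "\<And>y. y \<in> B \<Longrightarrow> \<bar>y\<bar> \<le> b" using B by (auto simp: bounded_real)
  then have "\<bar>?f y\<bar> \<le> \<bar>c\<bar> * b + \<bar>d\<bar>" if "y \<in> B" for y
    using that by (intro order_trans[OF abs_triangle_ineq] add_right_mono) (simp add: abs_mult mult_left_mono)
  then have "bounded (?f ` B)" by (auto simp: bounded_real)
  then have "finite (X \<inter> ?f ` B)" using assms(1) by (simp add: locally_finite_def)
  then have "finite (?f ` ({y. ?f y \<in> X} \<inter> B))" by (rule finite_subset[rotated]) auto
  moreover have "inj_on ?f ({y. ?f y \<in> X} \<inter> B)" using assms(2) by (auto simp: inj_on_def)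
  ultimately show "finite ({y. ?f y \<in> X} \<inter> B)" by (rule finite_imageD)
qed

context
  fixes M :: "'w measure" and D :: "'c::euclidean_space set" and c :: real and N :: "'w \<Rightarrow> 'c set"
  assumes pp: "poisson_process M D c N"
begin

lemma poisson_process_prob_space: "prob_space M"
  and poisson_process_subset: "\<omega> \<in> space M \<Longrightarrow> N \<omega> \<subseteq> D"
  and poisson_process_locally_finite: "\<omega> \<in> space M \<Longrightarrow> locally_finite (N \<omega>)"
  and poisson_process_measurable:
    "B \<in> sets borel \<Longrightarrow> bounded B \<Longrightarrow> (\<lambda>\<omega>. card (N \<omega> \<inter> B)) \<in> measurable M (count_space UNIV)"
  and poisson_process_prob: "B \<in> sets borel \<Longrightarrow> bounded B \<Longrightarrow> B \<subseteq> D \<Longrightarrow>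
    measure M {\<omega> \<in> space M. card (N \<omega> \<inter> B) = k} =
      (c * measure lborel B) ^ k / fact k * exp (- (c * measure lborel B))"
  using pp unfolding poisson_process_def point_process_def by auto

lemma poisson_process_vacant_eq:
  "bounded B \<Longrightarrow> {\<omega> \<in> space M. N \<omega> \<inter> B = {}} = {\<omega> \<in> space M. card (N \<omega> \<inter> B) = 0}"
  using poisson_process_locally_finite by (auto simp: locally_finite_def)

lemma poisson_process_vacant_sets:
  assumes "B \<in> sets borel" "bounded B"
  shows "{\<omega> \<in> space M. N \<omega> \<inter> B = {}} \<in> sets M"
proof -
  have "(\<lambda>\<omega>. card (N \<omega> \<inter> B)) -` {0} \<inter> space M \<in> sets M"
    by (rule measurable_sets[OF poisson_process_measurable[OF assms]]) simp
  moreover have "(\<lambda>\<omega>. card (N \<omega> \<inter> B)) -` {0} \<inter> space M = {\<omega> \<in> space M. N \<omega> \<inter> B = {}}"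
    unfolding poisson_process_vacant_eq[OF assms(2)] by auto
  ultimately show ?thesis by simp
qed

lemma poisson_process_prob_vacant:
  assumes "B \<in> sets borel" "bounded B" "B \<subseteq> D"
  shows "measure M {\<omega> \<in> space M. N \<omega> \<inter> B = {}} = exp (- (c * measure lborel B))"
  unfolding poisson_process_vacant_eq[OF assms(2)] poisson_process_prob[OF assms] by simp

end

text \<open>The limiting process is presented as a source process, so that \<open>source_law\<close>
  applies to it. The points \<open>y\<close> are preimages, hence the intensity is multiplied by
  \<open>k\<close>.\<close>

lemma poisson_input_affine:
  assumes N: "poisson_process M' UNIV c N" and "0 \<le> c" "0 < k"
  shows "poisson_input M' (\<lambda>\<omega>. {y. 0 < y \<and> k * y + d \<in> N \<omega>}) (\<lambda>_. {}) (\<lambda>_. {}) (c * k) 0 0"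
proof -
  interpret prob_space M' by (rule poisson_process_prob_space[OF N])
  let ?f = "\<lambda>y. k * y + d"
  have vac: "{\<omega> \<in> space M'. {y. 0 < y \<and> ?f y \<in> N \<omega>} \<inter> B = {} \<and> {} \<inter> C = {} \<and> {} \<inter> D = {}} =
      {\<omega> \<in> space M'. N \<omega> \<inter> ?f ` B = {}}" if "B \<subseteq> {0<..}" for B C :: "real set" and D :: "(real \<times> real) set"
    using that by auto
  have k: "k \<noteq> 0" using assms(3) by simp
  show ?thesis
  proof
    fix \<omega> assume "\<omega> \<in> space M'"
    then have "locally_finite {y. ?f y \<in> N \<omega>}"
      using poisson_process_locally_finite[OF N] k by (intro locally_finite_affine_vimage)
    then show "locally_finite {y. 0 < y \<and> ?f y \<in> N \<omega>} \<and> locally_finite {} \<and> locally_finite {}"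
      by (auto elim: locally_finite_subset)
  next
    fix B C :: "real set" and D :: "(real \<times> real) set" assume v: "valid_box (B, C, D)"
    then have B: "B \<in> sets borel" "bounded B" "B \<subseteq> {0<..}" by (auto simp: valid_box_def)
    note im = measure_lborel_affine_image[OF B(1,2) k, of d]
    show "{\<omega> \<in> space M'. {y. 0 < y \<and> ?f y \<in> N \<omega>} \<inter> B = {} \<and> {} \<inter> C = {} \<and> {} \<inter> D = {}} \<in> events"
      unfolding vac[OF B(3)] using im by (intro poisson_process_vacant_sets[OF N])
    show "prob {\<omega> \<in> space M'. {y. 0 < y \<and> ?f y \<in> N \<omega>} \<inter> B = {} \<and> {} \<inter> C = {} \<and> {} \<inter> D = {}} =
      exp (- (c * k * measure lborel B + 0 * measure lborel C + 0 * measure lborel D))"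
      unfolding vac[OF B(3)] using poisson_process_prob_vacant[OF N im(1,2)] im(3) assms(3) by simp
  qed (use assms in auto)
qed

lemma (in poisson_input) no_sinks: "poisson_input M S (\<lambda>_. {}) A \<rho> 0 \<kappa>"
proof
  fix B C D assume v: "valid_box (B, C, D)"
  then have v': "valid_box (B, {}, D)" by (auto simp: valid_box_def)
  show "{\<omega> \<in> space M. S \<omega> \<inter> B = {} \<and> {} \<inter> C = {} \<and> A \<omega> \<inter> D = {}} \<in> events"
    using vacant_sets[OF v'] by simp
  show "prob {\<omega> \<in> space M. S \<omega> \<inter> B = {} \<and> {} \<inter> C = {} \<and> A \<omega> \<inter> D = {}} =
      exp (- (\<rho> * measure lborel B + 0 * measure lborel C + \<kappa> * measure lborel D))"
    using prob_vacant[OF v'] by simp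
qed (use subsets loc_finite rates in auto)

lemma (in poisson_input) no_sources: "poisson_input M (\<lambda>_. {}) T A 0 \<sigma> \<kappa>"
proof
  fix B C D assume v: "valid_box (B, C, D)"
  then have v': "valid_box ({}, C, D)" by (auto simp: valid_box_def)
  show "{\<omega> \<in> space M. {} \<inter> B = {} \<and> T \<omega> \<inter> C = {} \<and> A \<omega> \<inter> D = {}} \<in> events"
    using vacant_sets[OF v'] by simp
  show "prob {\<omega> \<in> space M. {} \<inter> B = {} \<and> T \<omega> \<inter> C = {} \<and> A \<omega> \<inter> D = {}} =
      exp (- (0 * measure lborel B + \<sigma> * measure lborel C + \<kappa> * measure lborel D))"
    using prob_vacant[OF v'] by simp
qed (use subsets loc_finite rates in auto)

text \<open>This makes the results on source counts available for the number of sinks up to a given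
  time.\<close>

lemma (in poisson_input) sinks_as_sources: "poisson_input M T (\<lambda>_. {}) (\<lambda>_. {}) \<sigma> 0 0"
proof
  fix B C :: "real set" and D :: "(real \<times> real) set" assume v: "valid_box (B, C, D)"
  then have v': "valid_box ({}, B, {})" by (auto simp: valid_box_def)
  show "{\<omega> \<in> space M. T \<omega> \<inter> B = {} \<and> {} \<inter> C = {} \<and> {} \<inter> D = {}} \<in> events"
    using vacant_sets[OF v'] by simp
  show "prob {\<omega> \<in> space M. T \<omega> \<inter> B = {} \<and> {} \<inter> C = {} \<and> {} \<inter> D = {}} =
      exp (- (\<sigma> * measure lborel B + 0 * measure lborel C + 0 * measure lborel D))"
    using prob_vacant[OF v'] by simp
qed (use subsets loc_finite rates in auto)

text \<open>The positive half of a Poisson process on the line supplies additional sources and the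
  negative half additional sinks (through a negative \<open>k\<close>); \<open>k = 0\<close> supplies none.\<close>

definition add_points :: "real \<Rightarrow> ('w \<Rightarrow> real set) \<Rightarrow> ('v \<Rightarrow> real set) \<Rightarrow> 'w \<times> 'v \<Rightarrow> real set" where
  "add_points k X N = (\<lambda>(\<omega>, \<omega>'). X \<omega> \<union> {y. 0 < y \<and> k \<noteq> 0 \<and> k * y + 0 \<in> N \<omega>'})"

text \<open>A vacancy event of the enlarged input is a rectangle in the product space. The images of
  \<open>B\<close> and \<open>C\<close> lie on opposite sides of 0, so vacancy of their union under
  \<open>N\<close> has the product probability, and the added sources and sinks are independent
  although both come from \<open>N\<close>.\<close>

lemma (in poisson_input) add_points:
  assumes N: "poisson_process M' UNIV c N" and "0 \<le> c" "0 \<le> k" "0 \<le> l"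
  shows "poisson_input (M \<Otimes>\<^sub>M M') (add_points k S N) (add_points (- l) T N) (\<lambda>z. A (fst z))
    (\<rho> + c * k) (\<sigma> + c * l) \<kappa>"
proof -
  interpret N: prob_space M' by (rule poisson_process_prob_space[OF N])
  interpret P: pair_prob_space M M' ..
  let ?S = "add_points k S N" and ?T = "add_points (- l) T N"
  define im where "im k B = (if k = 0 then {} else (\<lambda>y. k * y + 0) ` B)" for k and B :: "real set"
  have vac: "(X \<union> {y. 0 < y \<and> k \<noteq> 0 \<and> k * y + 0 \<in> Y}) \<inter> B = {} \<longleftrightarrow> X \<inter> B = {} \<and> Y \<inter> im k B = {}"
    if "B \<subseteq> {0<..}" for X Y B k
    using that by (cases "k = 0") (auto simp: im_def)
  have im: "im k B \<in> sets borel" "bounded (im k B)" "measure lborel (im k B) = \<bar>k\<bar> * measure lborel B"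
    if "B \<in> sets borel" "bounded B" for k and B :: "real set"
    using measure_lborel_affine_image[OF that, of k 0] unfolding im_def by (cases "k = 0"; simp)+
  have box: "{z \<in> space (M \<Otimes>\<^sub>M M'). ?S z \<inter> B = {} \<and> ?T z \<inter> C = {} \<and> A (fst z) \<inter> D = {}} \<in> sets (M \<Otimes>\<^sub>M M') \<and>
      measure (M \<Otimes>\<^sub>M M') {z \<in> space (M \<Otimes>\<^sub>M M'). ?S z \<inter> B = {} \<and> ?T z \<inter> C = {} \<and> A (fst z) \<inter> D = {}} =
      exp (- ((\<rho> + c * k) * measure lborel B + (\<sigma> + c * l) * measure lborel C + \<kappa> * measure lborel D))"
    if v: "valid_box (B, C, D)" for B C D
  proof -
    have B: "B \<in> sets borel" "bounded B" "B \<subseteq> {0<..}" and C: "C \<in> sets borel" "bounded C" "C \<subseteq> {0<..}"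
      using v by (auto simp: valid_box_def)
    let ?E = "im k B \<union> im (- l) C"
    have E: "?E \<in> sets borel" "bounded ?E"
      using im[OF B(1,2)] im[OF C(1,2)] by (simp_all del: Un_iff)
    have "im k B \<subseteq> {0<..}" using B(3) assms(3) by (auto simp: im_def zero_less_mult_iff)
    moreover have "im (- l) C \<subseteq> {..<0}" using C(3) assms(4) by (auto simp: im_def zero_less_mult_iff)
    ultimately have "im k B \<inter> im (- l) C = {}" by fastforce
    then have mE: "measure lborel ?E = k * measure lborel B + l * measure lborel C"
      using im[OF B(1,2)] im[OF C(1,2)] assms(3,4) by (subst measure_lborel_Un) auto
    let ?V = "{\<omega>' \<in> space M'. N \<omega>' \<inter> ?E = {}}"
    have "{z \<in> space (M \<Otimes>\<^sub>M M'). ?S z \<inter> B = {} \<and> ?T z \<inter> C = {} \<and> A (fst z) \<inter> D = {}} = vacant (B, C, D) \<times> ?V"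
      unfolding add_points_def case_prod_beta vac[OF B(3)] vac[OF C(3)] Int_Un_distrib
      by (auto simp: space_pair_measure)
    moreover have "vacant (B, C, D) \<in> sets M" "?V \<in> sets M'"
      using vacant_in_events[OF v] poisson_process_vacant_sets[OF N E] by auto
    moreover have "measure (M \<Otimes>\<^sub>M M') (vacant (B, C, D) \<times> ?V) = prob (vacant (B, C, D)) * measure M' ?V"
      using calculation by (simp add: measure_def N.emeasure_pair_measure_Times enn2real_mult)
    ultimately show ?thesis
      using prob_vacant_weight[OF v] poisson_process_prob_vacant[OF N E] mE
      by (simp add: box_weight_def exp_add[symmetric] algebra_simps)
  qed
  show ?thesis
  proof
    fix z assume z: "z \<in> space (M \<Otimes>\<^sub>M M')"
    obtain \<omega> \<omega>' where zz: "z = (\<omega>, \<omega>')" "\<omega> \<in> space M" "\<omega>' \<in> space M'"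
      using z by (auto simp: space_pair_measure)
    note * = subsets[OF zz(2)] loc_finite[OF zz(2)] poisson_process_locally_finite[OF N zz(3)]
    show "?S z \<subseteq> {0<..} \<and> ?T z \<subseteq> {0<..} \<and> A (fst z) \<subseteq> {0<..} \<times> {0<..}"
      using * by (auto simp: zz(1) add_points_def)
    have "locally_finite {y. 0 < y \<and> k \<noteq> 0 \<and> k * y + 0 \<in> N \<omega>'}" for k
    proof (cases "k = 0")
      case False
      show ?thesis
        by (rule locally_finite_subset[OF locally_finite_affine_vimage[OF *(3) False, of 0]]) auto
    qed simp
    from this[of k] this[of "- l"] show "locally_finite (?S z) \<and> locally_finite (?T z) \<and> locally_finite (A (fst z))"
      using * unfolding zz(1) add_points_def by (auto intro!: locally_finite_Un)
  qed (use box rates assms in auto)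
qed

lemma subset_add_points: "X (fst z) \<subseteq> add_points k X N z"
  by (auto simp: add_points_def split: prod.splits)

lemma add_points_0: "add_points 0 X N = (\<lambda>z. X (fst z))"
  by (auto simp: add_points_def split: prod.splits)

section \<open>Poisson distributions\<close>

definition poisson_prob :: "real \<Rightarrow> nat \<Rightarrow> real" where
  "poisson_prob m k = m ^ k / fact k * exp (- m)"

lemma poisson_sums:
  shows "(\<lambda>k. poisson_prob m k) sums 1" "(\<lambda>k. real k * poisson_prob m k) sums m"
    and "(\<lambda>k. (real k)\<^sup>2 * poisson_prob m k) sums (m\<^sup>2 + m)"
proof -
  have "(\<lambda>k. m ^ k / fact k) sums exp m"
    using exp_converges[of m] by (simp add: divide_inverse mult.commute)
  from sums_mult2[OF this, of "exp (- m)"] show s0: "(\<lambda>k. poisson_prob m k) sums 1"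
    by (simp add: poisson_prob_def exp_minus)
  have shift: "real (Suc k) * poisson_prob m (Suc k) = m * poisson_prob m k" for k
    by (simp add: poisson_prob_def field_simps del: of_nat_Suc)
  have "(\<lambda>k. real (Suc k) * poisson_prob m (Suc k)) sums m"
    unfolding shift using sums_mult[OF s0, of m] by simp
  then show s1: "(\<lambda>k. real k * poisson_prob m k) sums m"
    using sums_Suc[of "\<lambda>k. real k * poisson_prob m k" m] by simp
  have "(real (Suc k))\<^sup>2 * poisson_prob m (Suc k) = m * (real k * poisson_prob m k) + m * poisson_prob m k" for k
  proof -
    have "(real (Suc k))\<^sup>2 * poisson_prob m (Suc k) = real (Suc k) * (m * poisson_prob m k)"
      unfolding shift[symmetric] by (simp add: power2_eq_square)
    then show ?thesis by (simp add: algebra_simps)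
  qed
  then have "(\<lambda>k. (real (Suc k))\<^sup>2 * poisson_prob m (Suc k)) sums (m\<^sup>2 + m)"
    using sums_add[OF sums_mult[OF s1, of m] sums_mult[OF s0, of m]] by (simp add: power2_eq_square)
  then show "(\<lambda>k. (real k)\<^sup>2 * poisson_prob m k) sums (m\<^sup>2 + m)"
    using sums_Suc[of "\<lambda>k. (real k)\<^sup>2 * poisson_prob m k" "m\<^sup>2 + m"] by simp
qed

definition (in prob_space) poisson_variable :: "('a \<Rightarrow> nat) \<Rightarrow> real \<Rightarrow> bool" where
  "poisson_variable K m \<longleftrightarrow> 0 \<le> m \<and> K \<in> measurable M (count_space UNIV) \<and>
     (\<forall>k. prob {\<omega>\<in>space M. K \<omega> = k} = poisson_prob m k)"

context prob_space
begin

lemma poisson_variable_integral: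
  fixes g :: "nat \<Rightarrow> real"
  assumes K: "poisson_variable K m" and g: "\<And>k. 0 \<le> g k" "(\<lambda>k. g k * poisson_prob m k) sums c"
  shows "integrable M (\<lambda>\<omega>. g (K \<omega>))" "expectation (\<lambda>\<omega>. g (K \<omega>)) = c"
proof -
  have meas: "K \<in> measurable M (count_space UNIV)" and m: "0 \<le> m" using K by (auto simp: poisson_variable_def)
  have pp: "0 \<le> poisson_prob m k" for k using m by (simp add: poisson_prob_def)
  let ?V = "\<lambda>k. {\<omega>\<in>space M. K \<omega> = k}"
  have V: "?V k \<in> events" "emeasure M (?V k) = ennreal (poisson_prob m k)" for k
  proof -
    have "K -` {k} \<inter> space M \<in> events" by (rule measurable_sets[OF meas]) simp
    moreover have "K -` {k} \<inter> space M = ?V k" by auto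
    ultimately show "?V k \<in> events" by simp
    show "emeasure M (?V k) = ennreal (poisson_prob m k)"
      using K by (simp add: emeasure_eq_measure poisson_variable_def)
  qed
  have "(\<integral>\<^sup>+\<omega>. ennreal (g (K \<omega>)) \<partial>M) = (\<integral>\<^sup>+\<omega>. (\<Sum>k. ennreal (g k) * indicator (?V k) \<omega>) \<partial>M)"
  proof (rule nn_integral_cong)
    fix \<omega> assume "\<omega> \<in> space M"
    then show "ennreal (g (K \<omega>)) = (\<Sum>k. ennreal (g k) * indicator (?V k) \<omega>)"
      by (subst suminf_finite[of "{K \<omega>}"]) (auto simp: indicator_def)
  qed
  also have "\<dots> = (\<Sum>k. ennreal (g k) * ennreal (poisson_prob m k))"
    using V by (subst nn_integral_suminf) (auto simp: nn_integral_cmult_indicator)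
  also have "\<dots> = (\<Sum>k. ennreal (g k * poisson_prob m k))"
    using g(1) by (simp add: ennreal_mult' pp)
  also have "\<dots> = ennreal c"
    using g pp by (intro suminf_ennreal_eq) auto
  finally have nn: "(\<integral>\<^sup>+\<omega>. ennreal (g (K \<omega>)) \<partial>M) = ennreal c" .
  have gm: "(\<lambda>\<omega>. g (K \<omega>)) \<in> borel_measurable M"
    by (rule measurable_compose[OF meas]) simp
  show "integrable M (\<lambda>\<omega>. g (K \<omega>))"
    using nn gm g(1) by (intro integrableI_nn_integral_finite[where x = c]) auto
  have "0 \<le> c"
    using g pp by (intro sums_le[OF _ sums_zero g(2)]) auto
  then show "expectation (\<lambda>\<omega>. g (K \<omega>)) = c"
    using nn gm g(1) by (subst integral_eq_nn_integral) auto
qed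

text \<open>Chebyshev's inequality around an arbitrary \<open>y\<close>: the means in the
  applications are \<open>b * (x + w)\<close>, while the comparison is with
  \<open>b * x\<close>.\<close>

lemma poisson_variable_deviation:
  assumes K: "poisson_variable K m" and "0 < e"
  shows "prob {\<omega>\<in>space M. e \<le> \<bar>real (K \<omega>) - y\<bar>} \<le> (m + (m - y)\<^sup>2) / e\<^sup>2"
proof -
  have i0: "integrable M (\<lambda>\<omega>. real (K \<omega>))" "expectation (\<lambda>\<omega>. real (K \<omega>)) = m"
    using poisson_variable_integral[OF K _ poisson_sums(2)] by auto
  have i1: "integrable M (\<lambda>\<omega>. (real (K \<omega>))\<^sup>2)" "expectation (\<lambda>\<omega>. (real (K \<omega>))\<^sup>2) = m\<^sup>2 + m"
    using poisson_variable_integral[OF K _ poisson_sums(3)] by auto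
  have sq: "(real (K \<omega>) - y)\<^sup>2 = (real (K \<omega>))\<^sup>2 - 2 * y * real (K \<omega>) + y\<^sup>2" for \<omega>
    by (simp add: power2_eq_square algebra_simps)
  have int: "integrable M (\<lambda>\<omega>. (real (K \<omega>) - y)\<^sup>2)"
    unfolding sq using i0(1) i1(1) by simp
  have E: "expectation (\<lambda>\<omega>. (real (K \<omega>) - y)\<^sup>2) = m + (m - y)\<^sup>2"
    unfolding sq using i0 i1 by (simp add: prob_space power2_eq_square algebra_simps)
  have "{\<omega>\<in>space M. e \<le> \<bar>real (K \<omega>) - y\<bar>} = {\<omega>\<in>space M. e\<^sup>2 \<le> (real (K \<omega>) - y)\<^sup>2}"
    using assms(2) abs_le_square_iff[of e] by (auto simp: abs_of_pos)
  also have "prob \<dots> \<le> expectation (\<lambda>\<omega>. (real (K \<omega>) - y)\<^sup>2) / e\<^sup>2"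
    using assms(2) int by (intro integral_Markov_inequality_measure[where A = "{}"]) auto
  finally show ?thesis unfolding E .
qed

end

section \<open>Comparison of laws\<close>

text \<open>The approximating expectations depend on \<open>r\<close> and \<open>R\<close> only.
  Being a limit of them therefore fixes the law of the interval counts in \<open>(0, R]\<close>, and
  it can be compared across different probability spaces and different intensities.\<close>

definition poisson_law :: "'w measure \<Rightarrow> ('w \<Rightarrow> real set) \<Rightarrow> real \<Rightarrow> real \<Rightarrow> bool" where
  "poisson_law M Y r R \<longleftrightarrow> (\<forall>Is f. (\<forall>I\<in>set Is. is_interval I \<and> I \<subseteq> {0<..R}) \<longrightarrow> (\<forall>v. \<bar>f v\<bar> \<le> 1) \<longrightarrow>
     (\<lambda>n. ebits (replicate n (1 - exp (- (r * (R / real n)))))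
        (\<lambda>bs. f (map (\<lambda>I. cell_count (R / real n) n I bs) Is))) \<longlonglongrightarrow>
     (\<integral>\<omega>. f (map (\<lambda>I. card (Y \<omega> \<inter> I)) Is) \<partial>M))"

lemma (in poisson_input) poisson_law_sources: "0 < R \<Longrightarrow> poisson_law M S \<rho> R"
  unfolding poisson_law_def using source_law by blast

lemma (in poisson_input) poisson_law_hammersley:
  "0 < \<rho> \<Longrightarrow> \<sigma> = 1 / \<rho> \<Longrightarrow> \<kappa> = 1 \<Longrightarrow> 0 < R \<Longrightarrow> 0 < t \<Longrightarrow>
    poisson_law M (\<lambda>\<omega>. hammersley (S \<omega>) (T \<omega>) (A \<omega>) t) \<rho> R"
  unfolding poisson_law_def using hammersley_law by blast

lemma exp_minus_lipschitz:
  fixes x y :: real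
  assumes "0 \<le> x" "0 \<le> y"
  shows "\<bar>exp (- x) - exp (- y)\<bar> \<le> \<bar>x - y\<bar>"
proof -
  have *: "\<bar>exp (- x) - exp (- y)\<bar> \<le> y - x" if "0 \<le> x" "x \<le> y" for x y :: real
  proof -
    have "exp (- x) - exp (- y) = exp (- x) * (1 - exp (- (y - x)))"
      by (simp add: algebra_simps exp_add[symmetric])
    moreover have "\<dots> \<le> 1 * (y - x)"
      using that one_minus_exp_bounds[of "y - x"] by (intro mult_mono) auto
    moreover have "exp (- y) \<le> exp (- x)" using that by simp
    ultimately show ?thesis by simp
  qed
  show ?thesis using *[of x y] *[of y x] assms by (cases "x \<le> y") (auto simp: abs_minus_commute)
qed

text \<open>The parameters of the \<open>n\<close> bits differ by at most
  \<open>\<bar>r - r'\<bar> * (R / n)\<close>, so the total change stays bounded as the mesh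
  shrinks.\<close>

lemma poisson_law_perturb:
  fixes f :: "nat list \<Rightarrow> real"
  assumes "poisson_law M Y r R" "poisson_law M' Y' r' R" "0 \<le> r" "0 \<le> r'" "0 < R"
    and "\<And>I. I \<in> set Is \<Longrightarrow> is_interval I \<and> I \<subseteq> {0<..R}" "\<And>v. \<bar>f v\<bar> \<le> 1"
  shows "\<bar>(\<integral>\<omega>. f (map (\<lambda>I. card (Y \<omega> \<inter> I)) Is) \<partial>M) - (\<integral>\<omega>. f (map (\<lambda>I. card (Y' \<omega> \<inter> I)) Is) \<partial>M')\<bar>
    \<le> 2 * R * \<bar>r - r'\<bar>"
proof -
  let ?e = "\<lambda>r n. ebits (replicate n (1 - exp (- (r * (R / real n)))))
      (\<lambda>bs. f (map (\<lambda>I. cell_count (R / real n) n I bs) Is))"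
  have lim: "(\<lambda>n. \<bar>?e r n - ?e r' n\<bar>) \<longlonglongrightarrow>
    \<bar>(\<integral>\<omega>. f (map (\<lambda>I. card (Y \<omega> \<inter> I)) Is) \<partial>M) - (\<integral>\<omega>. f (map (\<lambda>I. card (Y' \<omega> \<inter> I)) Is) \<partial>M')\<bar>"
    using assms unfolding poisson_law_def by (intro tendsto_rabs tendsto_diff) auto
  have "\<bar>?e r n - ?e r' n\<bar> \<le> 2 * R * \<bar>r - r'\<bar>" if "0 < n" for n
  proof -
    have nn: "0 \<le> r * (R / real n)" "0 \<le> r' * (R / real n)" using assms by auto
    have "\<bar>?e r n - ?e r' n\<bar> \<le> real n * (2 * 1 * \<bar>(1 - exp (- (r * (R / real n)))) - (1 - exp (- (r' * (R / real n))))\<bar>)"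
      using one_minus_exp_bounds(3,4)[OF nn(1)] one_minus_exp_bounds(3,4)[OF nn(2)] assms(7)
      by (intro ebits_replicate_perturb) auto
    also have "\<dots> \<le> real n * (2 * (\<bar>r - r'\<bar> * (R / real n)))"
    proof -
      have "\<bar>r * (R / real n) - r' * (R / real n)\<bar> = \<bar>r - r'\<bar> * (R / real n)"
        using assms(5) unfolding left_diff_distrib[symmetric] abs_mult by simp
      moreover have d: "\<bar>(1 - u) - (1 - v)\<bar> = \<bar>u - v\<bar>" for u v :: real by linarith
      ultimately show ?thesis unfolding d using exp_minus_lipschitz[OF nn] by (intro mult_left_mono) auto
    qed
    also have "\<dots> = 2 * R * \<bar>r - r'\<bar>" using that by simp
    finally show ?thesis .
  qed
  then show ?thesis
    by (intro LIMSEQ_le_const2[OF lim]) (auto intro!: exI[of _ 1])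
qed

lemma poisson_law_eq:
  fixes f :: "nat list \<Rightarrow> real"
  assumes "poisson_law M Y r R" "poisson_law M' Y' r R"
    and "\<And>I. I \<in> set Is \<Longrightarrow> is_interval I \<and> I \<subseteq> {0<..R}" "\<And>v. \<bar>f v\<bar> \<le> 1"
  shows "(\<integral>\<omega>. f (map (\<lambda>I. card (Y \<omega> \<inter> I)) Is) \<partial>M) = (\<integral>\<omega>. f (map (\<lambda>I. card (Y' \<omega> \<inter> I)) Is) \<partial>M')"
  using LIMSEQ_unique[OF assms(1)[unfolded poisson_law_def, rule_format, of Is f]
      assms(2)[unfolded poisson_law_def, rule_format, of Is f]] assms(3,4) by blast

definition affine_part :: "real \<Rightarrow> real \<Rightarrow> ('w \<Rightarrow> real set) \<Rightarrow> 'w \<Rightarrow> real set" where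
  "affine_part k d N \<omega> = {y. 0 < y \<and> k * y + d \<in> N \<omega>}"

lemma affine_part_Int:
  assumes "0 < k" "I \<subseteq> {0<..}"
  shows "card (affine_part k d N \<omega> \<inter> I) = card (N \<omega> \<inter> (\<lambda>y. k * y + d) ` I)"
proof -
  have "(\<lambda>y. k * y + d) ` (affine_part k d N \<omega> \<inter> I) = N \<omega> \<inter> (\<lambda>y. k * y + d) ` I"
    using assms(2) by (auto simp: affine_part_def)
  moreover have "inj_on (\<lambda>y. k * y + d) (affine_part k d N \<omega> \<inter> I)"
    using assms(1) by (auto simp: inj_on_def)
  ultimately show ?thesis by (metis card_image)
qed

lemma poisson_law_affine_part:
  assumes "poisson_process M' UNIV c N" "0 \<le> c" "0 < k" "0 < R"
  shows "poisson_law M' (affine_part k d N) (c * k) R"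
  using poisson_input.poisson_law_sources[OF poisson_input_affine[OF assms(1-3), of d] assms(4)]
  by (simp add: affine_part_def[abs_def])

text \<open>The explicit Poisson probabilities come from \<open>N\<close>: scaled by
  \<open>r / c\<close> it has intensity \<open>r\<close>, hence the same law as \<open>Y\<close> on
  \<open>(0, R]\<close>, and the counts of \<open>N\<close> are Poisson by hypothesis.\<close>

lemma poisson_law_variable:
  fixes N :: "'v \<Rightarrow> real set"
  assumes "prob_space M" "poisson_law M Y r R" "0 < r" "I \<subseteq> {0<..R}" "is_interval I"
    and meas: "(\<lambda>\<omega>. card (Y \<omega> \<inter> I)) \<in> measurable M (count_space UNIV)"
    and N: "poisson_process M' UNIV c N" "0 < c" and "0 < R"
  shows "prob_space.poisson_variable M (\<lambda>\<omega>. card (Y \<omega> \<inter> I)) (r * measure lborel I)"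
proof -
  interpret prob_space M by fact
  interpret N: prob_space M' by (rule poisson_process_prob_space[OF N(1)])
  let ?k = "r / c"
  have k: "0 < ?k" "c * ?k = r" using assms by auto
  let ?J = "(\<lambda>y. ?k * y + 0) ` I"
  have I: "I \<in> sets borel" "bounded I"
    using assms(5) is_interval_borel bounded_subset[OF bounded_closed_interval[of 0 R], of I] assms(4) by force+
  have J: "?J \<in> sets borel" "bounded ?J" "c * measure lborel ?J = r * measure lborel I"
    using measure_lborel_affine_image[OF I, of ?k 0] k assms(3) N(2) by (auto simp: field_simps)
  have "prob {\<omega> \<in> space M. card (Y \<omega> \<inter> I) = m} = poisson_prob (r * measure lborel I) m" for m
  proof -
    let ?f = "\<lambda>v. of_bool (v = [m]) :: real"
    have E: "{\<omega> \<in> space M. card (Y \<omega> \<inter> I) = m} \<in> events"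
    proof -
      have "(\<lambda>\<omega>. card (Y \<omega> \<inter> I)) -` {m} \<inter> space M \<in> events" by (rule measurable_sets[OF meas]) simp
      moreover have "(\<lambda>\<omega>. card (Y \<omega> \<inter> I)) -` {m} \<inter> space M = {\<omega> \<in> space M. card (Y \<omega> \<inter> I) = m}" by auto
      ultimately show ?thesis by simp
    qed
    have E': "{\<omega> \<in> space M'. card (N \<omega> \<inter> ?J) = m} \<in> N.events"
    proof -
      have "(\<lambda>\<omega>. card (N \<omega> \<inter> ?J)) -` {m} \<inter> space M' \<in> N.events"
        by (rule measurable_sets[OF poisson_process_measurable[OF N(1) J(1,2)]]) simp
      moreover have "(\<lambda>\<omega>. card (N \<omega> \<inter> ?J)) -` {m} \<inter> space M' = {\<omega> \<in> space M'. card (N \<omega> \<inter> ?J) = m}" by auto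
      ultimately show ?thesis by simp
    qed
    have "prob {\<omega> \<in> space M. card (Y \<omega> \<inter> I) = m} = expectation (\<lambda>\<omega>. ?f (map (\<lambda>I. card (Y \<omega> \<inter> I)) [I]))"
    proof -
      have "prob {\<omega> \<in> space M. card (Y \<omega> \<inter> I) = m} = expectation (indicator {\<omega> \<in> space M. card (Y \<omega> \<inter> I) = m})"
        using E by simp
      also have "\<dots> = expectation (\<lambda>\<omega>. ?f (map (\<lambda>I. card (Y \<omega> \<inter> I)) [I]))"
        by (intro Bochner_Integration.integral_cong) (auto simp: indicator_def)
      finally show ?thesis .
    qed
    also have "\<dots> = N.expectation (\<lambda>\<omega>. ?f (map (\<lambda>I. card (affine_part ?k 0 N \<omega> \<inter> I)) [I]))"
      by (rule poisson_law_eq[OF assms(2) poisson_law_affine_part[OF N(1) less_imp_le[OF N(2)] k(1) assms(9), of 0, unfolded k(2)]])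
        (use assms(4,5) in auto)
    also have "\<dots> = N.expectation (indicator {\<omega> \<in> space M'. card (N \<omega> \<inter> ?J) = m})"
    proof -
      have "I \<subseteq> {0<..}" using assms(4) by auto
      then show ?thesis
        by (intro Bochner_Integration.integral_cong) (auto simp: indicator_def affine_part_Int[OF k(1)])
    qed
    also have "\<dots> = N.prob {\<omega> \<in> space M'. card (N \<omega> \<inter> ?J) = m}" using E' by simp
    also have "\<dots> = poisson_prob (r * measure lborel I) m"
      using poisson_process_prob[OF N(1) J(1,2)] J(3) by (simp add: poisson_prob_def)
    finally show ?thesis .
  qed
  then show ?thesis using assms(3) meas by (simp add: poisson_variable_def)
qed

section \<open>Asymptotic events\<close>

text \<open>The exceptional set is only covered by an event, so that statements such as equality of
  two configurations need no proof of measurability.\<close>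

definition whp :: "'w measure \<Rightarrow> (real \<Rightarrow> 'w \<Rightarrow> bool) \<Rightarrow> bool" where
  "whp M P \<longleftrightarrow> (\<forall>e>0. \<forall>\<^sub>F x in at_top. \<exists>E\<in>sets M. measure M E < e \<and> (\<forall>\<omega>\<in>space M - E. P x \<omega>))"

context prob_space
begin

lemma whp_conj:
  assumes "whp M P" "whp M Q"
  shows "whp M (\<lambda>x \<omega>. P x \<omega> \<and> Q x \<omega>)"
  unfolding whp_def
proof (intro allI impI)
  fix e :: real assume "e > 0"
  then have "e / 2 > 0" by simp
  then have "\<forall>\<^sub>F x in at_top. \<exists>E\<in>events. prob E < e / 2 \<and> (\<forall>\<omega>\<in>space M - E. P x \<omega>)"
    "\<forall>\<^sub>F x in at_top. \<exists>E\<in>events. prob E < e / 2 \<and> (\<forall>\<omega>\<in>space M - E. Q x \<omega>)"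
    using assms unfolding whp_def by blast+
  then show "\<forall>\<^sub>F x in at_top. \<exists>E\<in>events. prob E < e \<and> (\<forall>\<omega>\<in>space M - E. P x \<omega> \<and> Q x \<omega>)"
  proof eventually_elim
    case (elim x)
    then obtain E F where E: "E \<in> events" "prob E < e / 2" "\<forall>\<omega>\<in>space M - E. P x \<omega>"
      and F: "F \<in> events" "prob F < e / 2" "\<forall>\<omega>\<in>space M - F. Q x \<omega>" by blast
    have "prob (E \<union> F) < e" using measure_Un_le[OF E(1) F(1)] E(2) F(2) by linarith
    with E F show ?case by (intro bexI[of _ "E \<union> F"]) auto
  qed
qed

lemma whp_mono:
  assumes "whp M P" "\<forall>\<^sub>F x in at_top. \<forall>\<omega>\<in>space M. P x \<omega> \<longrightarrow> Q x \<omega>"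
  shows "whp M Q"
  unfolding whp_def
proof (intro allI impI)
  fix e :: real assume "e > 0"
  with assms(1) have "\<forall>\<^sub>F x in at_top. \<exists>E\<in>events. prob E < e \<and> (\<forall>\<omega>\<in>space M - E. P x \<omega>)"
    unfolding whp_def by blast
  with assms(2) show "\<forall>\<^sub>F x in at_top. \<exists>E\<in>events. prob E < e \<and> (\<forall>\<omega>\<in>space M - E. Q x \<omega>)"
    by eventually_elim blast
qed

lemma whp_elim:
  assumes "whp M P" "whp M Q"
    and "\<And>x \<omega>. b \<le> x \<Longrightarrow> \<omega> \<in> space M \<Longrightarrow> P x \<omega> \<Longrightarrow> Q x \<omega> \<Longrightarrow> R x \<omega>"
  shows "whp M R"
proof (rule whp_mono[OF whp_conj[OF assms(1,2)]])
  show "\<forall>\<^sub>F x in at_top. \<forall>\<omega>\<in>space M. P x \<omega> \<and> Q x \<omega> \<longrightarrow> R x \<omega>"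
    using eventually_ge_at_top[of b] by eventually_elim (use assms(3) in blast)
qed

lemma whp_AE:
  assumes "AE \<omega> in M. P \<omega>"
  shows "whp M (\<lambda>_. P)"
proof -
  obtain E where E: "{\<omega>\<in>space M. \<not> P \<omega>} \<subseteq> E" "emeasure M E = 0" "E \<in> events"
    using AE_E[OF assms] by blast
  then have "prob E = 0" by (simp add: measure_def)
  then show ?thesis using E unfolding whp_def by (intro allI impI always_eventually bexI[of _ E]) auto
qed

lemma whp_tendsto:
  assumes "\<forall>\<^sub>F x in at_top. {\<omega>\<in>space M. \<not> P x \<omega>} \<in> events"
    and "((\<lambda>x. prob {\<omega>\<in>space M. \<not> P x \<omega>}) \<longlongrightarrow> 0) at_top"
  shows "whp M P"
  unfolding whp_def
proof (intro allI impI)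
  fix e :: real assume "e > 0"
  with assms(2) have "\<forall>\<^sub>F x in at_top. prob {\<omega>\<in>space M. \<not> P x \<omega>} < e" by (rule order_tendstoD(2))
  with assms(1) show "\<forall>\<^sub>F x in at_top. \<exists>E\<in>events. prob E < e \<and> (\<forall>\<omega>\<in>space M - E. P x \<omega>)"
    by eventually_elim (auto intro: bexI[of _ "{\<omega>\<in>space M. \<not> P _ \<omega>}"])
qed

lemma whp_tendsto_prob:
  assumes "whp M P" and "\<forall>\<^sub>F x in at_top. E x \<in> events \<and> (\<forall>\<omega>\<in>E x. \<not> P x \<omega>)"
  shows "((\<lambda>x. prob (E x)) \<longlongrightarrow> 0) at_top"
proof (rule tendstoI)
  fix e :: real assume "e > 0"
  with assms(1) have "\<forall>\<^sub>F x in at_top. \<exists>E\<in>events. prob E < e \<and> (\<forall>\<omega>\<in>space M - E. P x \<omega>)"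
    unfolding whp_def by blast
  with assms(2) show "\<forall>\<^sub>F x in at_top. dist (prob (E x)) 0 < e"
  proof eventually_elim
    case (elim x)
    then obtain F where F: "F \<in> events" "prob F < e" "\<forall>\<omega>\<in>space M - F. P x \<omega>" by blast
    have "E x \<subseteq> F" using elim F(3) sets.sets_into_space by blast
    then have "prob (E x) \<le> prob F" using F(1) by (intro finite_measure_mono)
    then show ?case using F(2) by (simp add: abs_of_nonneg)
  qed
qed

text \<open>The variance is linear in \<open>x\<close> and the shift \<open>w\<close> moves the mean
  by a constant; both vanish against the square of \<open>e * x\<close>.\<close>

lemma poisson_variable_whp:
  assumes K: "\<forall>\<^sub>F x in at_top. poisson_variable (K x) (b * (x + w))" and "0 < e"
  shows "whp M (\<lambda>x \<omega>. \<bar>real (K x \<omega>) - b * x\<bar> < e * x)"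
proof (rule whp_tendsto)
  have meas: "{\<omega> \<in> space M. \<not> \<bar>real (L \<omega>) - y\<bar> < z} \<in> events" if "L \<in> measurable M (count_space UNIV)" for L :: "'a \<Rightarrow> nat" and y z
  proof -
    have "(\<lambda>\<omega>. real (L \<omega>)) \<in> borel_measurable M" using that by (simp only: measurable_nat_iff_real)
    then have "{\<omega> \<in> space M. z \<le> \<bar>real (L \<omega>) - y\<bar>} \<in> events"
      by (intro borel_measurable_le) auto
    then show ?thesis by (simp add: not_less)
  qed
  show "\<forall>\<^sub>F x in at_top. {\<omega> \<in> space M. \<not> \<bar>real (K x \<omega>) - b * x\<bar> < e * x} \<in> events"
    using K
  proof eventually_elim
    case (elim x)
    then show ?case unfolding poisson_variable_def by (intro meas) blast
  qed
  have inv: "((\<lambda>x::real. inverse x) \<longlongrightarrow> 0) at_top" by (rule tendsto_inverse_0_at_top) (rule filterlim_ident)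
  have lim: "((\<lambda>x. (b * inverse x + (b * w + (b * w)\<^sup>2) * (inverse x * inverse x)) / e\<^sup>2) \<longlongrightarrow> 0) at_top"
  proof -
    have "((\<lambda>x. (b * X x + c * (X x * X x)) / e\<^sup>2) \<longlongrightarrow> 0) at_top"
      if "(X \<longlongrightarrow> 0) at_top" for X :: "real \<Rightarrow> real" and c
      using that assms(2) by (auto intro!: tendsto_eq_intros)
    from this[OF inv] show ?thesis .
  qed
  have bound: "\<forall>\<^sub>F x in at_top. prob {\<omega> \<in> space M. \<not> \<bar>real (K x \<omega>) - b * x\<bar> < e * x} \<le>
      (b * inverse x + (b * w + (b * w)\<^sup>2) * (inverse x * inverse x)) / e\<^sup>2"
    using K eventually_gt_at_top[of 0]
  proof eventually_elim
    case (elim x)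
    have "prob {\<omega> \<in> space M. \<not> \<bar>real (K x \<omega>) - b * x\<bar> < e * x} \<le>
        (b * (x + w) + (b * (x + w) - b * x)\<^sup>2) / (e * x)\<^sup>2"
      using poisson_variable_deviation[OF elim(1), of "e * x" "b * x"] assms(2) elim(2) by (simp add: not_less)
    also have "\<dots> = (b * inverse x + (b * w + (b * w)\<^sup>2) * (inverse x * inverse x)) / e\<^sup>2"
    proof -
      have "b * (x + w) + (b * (x + w) - b * x)\<^sup>2 = b * x + (b * w + (b * w)\<^sup>2)"
        by (simp add: distrib_left)
      moreover have "(b * x + c) / (e * x)\<^sup>2 = (b * inverse x + c * (inverse x * inverse x)) / e\<^sup>2" for c
        using elim(2) assms(2) by (simp add: divide_simps power2_eq_square) (simp add: algebra_simps)?
      ultimately show ?thesis by (simp only:)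
    qed
    finally show ?case .
  qed
  show "((\<lambda>x. prob {\<omega> \<in> space M. \<not> \<bar>real (K x \<omega>) - b * x\<bar> < e * x}) \<longlongrightarrow> 0) at_top"
    by (rule tendsto_sandwich[OF always_eventually bound tendsto_const lim]) simp
qed

text \<open>If \<open>K1 \<le> K2\<close> held everywhere, integrality would give the bound
  \<open>m2 - m1\<close>. Where the order is reversed the loss is at most \<open>K1\<close>, which
  is at most \<open>k + K1 ^ 2 / k\<close>; the reversed event is rare in the application, and
  \<open>k\<close> is chosen there.\<close>

lemma prob_poisson_variable_less:
  assumes K1: "poisson_variable K1 m1" and K2: "poisson_variable K2 m2" and "0 < k"
  shows "prob {\<omega>\<in>space M. K1 \<omega> < K2 \<omega>} \<le> m2 - m1 + k * prob {\<omega>\<in>space M. K2 \<omega> < K1 \<omega>} + (m1\<^sup>2 + m1) / k"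
proof -
  have i1: "integrable M (\<lambda>\<omega>. real (K1 \<omega>))" "expectation (\<lambda>\<omega>. real (K1 \<omega>)) = m1"
    using poisson_variable_integral[OF K1 _ poisson_sums(2)] by auto
  have i2: "integrable M (\<lambda>\<omega>. real (K2 \<omega>))" "expectation (\<lambda>\<omega>. real (K2 \<omega>)) = m2"
    using poisson_variable_integral[OF K2 _ poisson_sums(2)] by auto
  have i3: "integrable M (\<lambda>\<omega>. (real (K1 \<omega>))\<^sup>2)" "expectation (\<lambda>\<omega>. (real (K1 \<omega>))\<^sup>2) = m1\<^sup>2 + m1"
    using poisson_variable_integral[OF K1 _ poisson_sums(3)] by auto
  have meas: "K1 \<in> measurable M (count_space UNIV)" "K2 \<in> measurable M (count_space UNIV)"
    using K1 K2 by (auto simp: poisson_variable_def)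
  let ?A = "{\<omega>\<in>space M. K1 \<omega> < K2 \<omega>}" and ?B = "{\<omega>\<in>space M. K2 \<omega> < K1 \<omega>}"
  have "(\<lambda>\<omega>. real (K1 \<omega>)) \<in> borel_measurable M" "(\<lambda>\<omega>. real (K2 \<omega>)) \<in> borel_measurable M"
    using meas by (simp_all only: measurable_nat_iff_real)
  from borel_measurable_less[OF this] borel_measurable_less[OF this(2,1)]
  have ev: "?A \<in> events" "?B \<in> events" by simp_all
  have "prob ?A = expectation (indicator ?A)" using ev by simp
  also have "\<dots> \<le> expectation (\<lambda>\<omega>. real (K2 \<omega>) - real (K1 \<omega>) + k * indicator ?B \<omega> + (real (K1 \<omega>))\<^sup>2 / k)"
  proof (rule integral_mono)
    show "integrable M (indicator ?A :: 'a \<Rightarrow> real)" using ev by (simp add: emeasure_eq_measure)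
    show "integrable M (\<lambda>\<omega>. real (K2 \<omega>) - real (K1 \<omega>) + k * indicator ?B \<omega> + (real (K1 \<omega>))\<^sup>2 / k)"
      using i1 i2 i3 ev by (auto simp: emeasure_eq_measure)
    fix \<omega> assume \<omega>: "\<omega> \<in> space M"
    have sq: "0 \<le> (real (K1 \<omega>))\<^sup>2 / k" using assms(3) by simp
    have le: "real (K1 \<omega>) \<le> k + (real (K1 \<omega>))\<^sup>2 / k"
    proof (cases "real (K1 \<omega>) \<le> k")
      case False
      then have "real (K1 \<omega>) * k \<le> (real (K1 \<omega>))\<^sup>2" by (simp add: power2_eq_square mult_left_mono)
      then have "real (K1 \<omega>) \<le> (real (K1 \<omega>))\<^sup>2 / k" using assms(3) by (simp add: pos_le_divide_eq)
      then show ?thesis using assms(3) by linarith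
    qed (use sq in linarith)
    consider "K1 \<omega> < K2 \<omega>" | "K1 \<omega> = K2 \<omega>" | "K2 \<omega> < K1 \<omega>" by linarith
    then show "indicator ?A \<omega> \<le> real (K2 \<omega>) - real (K1 \<omega>) + k * indicator ?B \<omega> + (real (K1 \<omega>))\<^sup>2 / k"
    proof cases
      case 1
      then have i: "indicator ?A \<omega> = (1::real)" "indicator ?B \<omega> = (0::real)" using \<omega> by auto
      have "1 \<le> real (K2 \<omega>) - real (K1 \<omega>)" using 1 by linarith
      then show ?thesis unfolding i using sq by linarith
    next
      case 2
      then have "indicator ?A \<omega> = (0::real)" "indicator ?B \<omega> = (0::real)" by auto
      note i = this
      show ?thesis unfolding i using 2 sq by linarith
    next
      case 3
      then have "indicator ?A \<omega> = (0::real)" "indicator ?B \<omega> = (1::real)" using \<omega> by auto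
      then show ?thesis using le by simp
    qed
  qed
  also have "\<dots> = m2 - m1 + k * prob ?B + (m1\<^sup>2 + m1) / k"
    using i1 i2 i3 ev by (simp add: emeasure_eq_measure)
  finally show ?thesis .
qed

end

section \<open>Laws of large numbers\<close>

context random_input
begin

lemma measurable_sinks_count: "(\<lambda>\<omega>. card (T \<omega> \<inter> {0<..x})) \<in> measurable M (count_space UNIV)"
proof -
  interpret sinks: random_input M T "\<lambda>_. {}" "\<lambda>_. {}"
  proof
    fix B C :: "real set" and D :: "(real \<times> real) set" assume v: "valid_box (B, C, D)"
    then have v': "valid_box ({}, B, {})" by (auto simp: valid_box_def)
    show "{\<omega> \<in> space M. T \<omega> \<inter> B = {} \<and> {} \<inter> C = {} \<and> {} \<inter> D = {}} \<in> events"
      using vacant_sets[OF v'] by simp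
  qed (use subsets loc_finite in auto)
  show ?thesis by (rule sinks.measurable_source_count)
qed

lemma measurable_passage:
  assumes "0 < t"
  shows "(\<lambda>\<omega>. real (passage (S \<omega>) (T \<omega>) (A \<omega>) x t)) \<in> borel_measurable M"
proof -
  have "(\<lambda>\<omega>. real (card (hammersley (S \<omega>) (T \<omega>) (A \<omega>) t \<inter> {0<..x})) + real (card (T \<omega> \<inter> {0<..t}))) \<in> borel_measurable M"
    using measurable_hammersley_count[OF assms] measurable_sinks_count
    by (intro borel_measurable_add) (simp_all only: measurable_nat_iff_real)
  then show ?thesis by (simp add: passage_def hammersley_count_def)
qed

end

text \<open>The particle number at time \<open>a * x\<close> is Poisson by stationarity and the
  number of sinks is Poisson anyway. Each concentrates by itself, so their dependence does no
  harm.\<close>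

lemma (in poisson_input) passage_lln:
  fixes M' :: "'v measure" and N :: "'v \<Rightarrow> real set"
  assumes N: "poisson_process M' UNIV c N" and c: "0 < c"
    and stat: "0 < \<rho>" "\<sigma> = 1 / \<rho>" "\<kappa> = 1" and "0 < a" "0 < e"
  shows "whp M (\<lambda>x \<omega>. \<bar>real (passage (S \<omega>) (T \<omega>) (A \<omega>) (x + w) (a * x)) - (\<rho> + a / \<rho>) * x\<bar> < e * x)"
proof -
  let ?L = "\<lambda>x \<omega>. card (hammersley (S \<omega>) (T \<omega>) (A \<omega>) (a * x) \<inter> {0<..x + w})"
  let ?T = "\<lambda>x \<omega>. card (T \<omega> \<inter> {0<..a * x})"
  have Is: "is_interval {0<..y}" for y :: real by (simp add: is_interval_1)
  have "\<forall>\<^sub>F x in at_top. poisson_variable (?L x) (\<rho> * (x + w))"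
    using eventually_gt_at_top[of 0] eventually_gt_at_top[of "- w"]
  proof eventually_elim
    case (elim x)
    then have x: "0 < x + w" "0 < a * x" using assms(6) by auto
    from poisson_law_variable[OF prob_space_axioms poisson_law_hammersley[OF stat x] stat(1) order_refl Is
        measurable_hammersley_count[OF x(2)] N c x(1)]
    show ?case using x by simp
  qed
  from poisson_variable_whp[OF this, of "e / 2"] assms(7)
  have 1: "whp M (\<lambda>x \<omega>. \<bar>real (?L x \<omega>) - \<rho> * x\<bar> < e / 2 * x)" by simp
  interpret sinks: poisson_input M T "\<lambda>_. {}" "\<lambda>_. {}" \<sigma> 0 0 by (rule sinks_as_sources)
  have "\<forall>\<^sub>F x in at_top. poisson_variable (?T x) (a / \<rho> * (x + 0))"
    using eventually_gt_at_top[of 0]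
  proof eventually_elim
    case (elim x)
    then have x: "0 < a * x" using assms(6) by auto
    have s: "0 < \<sigma>" using stat by simp
    from poisson_law_variable[OF prob_space_axioms sinks.poisson_law_sources[OF x] s order_refl Is
        measurable_sinks_count N c x]
    show ?case using x stat by simp
  qed
  from poisson_variable_whp[OF this, of "e / 2"] assms(7)
  have 2: "whp M (\<lambda>x \<omega>. \<bar>real (?T x \<omega>) - a / \<rho> * x\<bar> < e / 2 * x)" by simp
  from 1 2 show ?thesis
  proof (rule whp_elim)
    fix x \<omega>
    assume *: "\<bar>real (?L x \<omega>) - \<rho> * x\<bar> < e / 2 * x" "\<bar>real (?T x \<omega>) - a / \<rho> * x\<bar> < e / 2 * x"
    have "(\<rho> + a / \<rho>) * x = \<rho> * x + a / \<rho> * x" "e * x = e / 2 * x + e / 2 * x"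
      by (simp_all add: distrib_right)
    then show "\<bar>real (passage (S \<omega>) (T \<omega>) (A \<omega>) (x + w) (a * x)) - (\<rho> + a / \<rho>) * x\<bar> < e * x"
      using * unfolding passage_def hammersley_count_def by linarith
  qed
qed

text \<open>The set where \<open>b x \<le> f x\<close> is an event of \<open>M\<close>. Its cylinder
  in the product lies inside the exceptional event there and has the same probability.\<close>

lemma whp_fst:
  fixes M' :: "'v measure" and N :: "'v \<Rightarrow> real set" and f :: "real \<Rightarrow> 'w \<Rightarrow> real"
  assumes N: "poisson_process M' UNIV c N" and "prob_space M" and "whp (M \<Otimes>\<^sub>M M') (\<lambda>x z. f x (fst z) < b x)"
    and "\<forall>\<^sub>F x in at_top. f x \<in> borel_measurable M"
  shows "whp M (\<lambda>x \<omega>. f x \<omega> < b x)"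
  unfolding whp_def
proof (intro allI impI)
  interpret prob_space M by fact
  interpret N: prob_space M' by (rule poisson_process_prob_space[OF N])
  interpret P: pair_prob_space M M' ..
  fix e :: real assume "e > 0"
  with assms(3) have "\<forall>\<^sub>F x in at_top. \<exists>E\<in>sets (M \<Otimes>\<^sub>M M'). measure (M \<Otimes>\<^sub>M M') E < e \<and>
      (\<forall>z\<in>space (M \<Otimes>\<^sub>M M') - E. f x (fst z) < b x)"
    unfolding whp_def by blast
  with assms(4) show "\<forall>\<^sub>F x in at_top. \<exists>E\<in>events. prob E < e \<and> (\<forall>\<omega>\<in>space M - E. f x \<omega> < b x)"
  proof eventually_elim
    case (elim x)
    then obtain E where E: "E \<in> sets (M \<Otimes>\<^sub>M M')" "measure (M \<Otimes>\<^sub>M M') E < e"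
      "\<forall>z\<in>space (M \<Otimes>\<^sub>M M') - E. f x (fst z) < b x" by blast
    let ?F = "{\<omega>\<in>space M. b x \<le> f x \<omega>}"
    have F: "?F \<in> events" using elim(1) by (intro borel_measurable_le) auto
    have "prob ?F = measure (distr (M \<Otimes>\<^sub>M M') M fst) ?F" by (simp add: N.distr_pair_fst)
    also have "\<dots> = measure (M \<Otimes>\<^sub>M M') (fst -` ?F \<inter> space (M \<Otimes>\<^sub>M M'))"
      using F by (intro measure_distr) auto
    also have "\<dots> \<le> measure (M \<Otimes>\<^sub>M M') E"
      using E(1,3) by (intro P.finite_measure_mono) (auto simp: not_less[symmetric])
    finally show ?case using E(2) F by (intro bexI[of _ ?F]) auto
  qed
qed

text \<open>The dominating process is the stationary one with the characteristic density \<open>sqrt a\<close>.\<close>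

lemma (in poisson_input) passage_upper:
  fixes M' :: "'v measure" and N :: "'v \<Rightarrow> real set"
  assumes N: "poisson_process M' UNIV c N" and c: "0 < c"
    and a: "0 < a" "\<rho> \<le> sqrt a" "\<sigma> \<le> 1 / sqrt a" and "\<kappa> = 1" "0 < e"
  shows "whp M (\<lambda>x \<omega>. real (passage (S \<omega>) (T \<omega>) (A \<omega>) (x + w) (a * x)) < (2 * sqrt a + e) * x)"
proof (rule whp_fst[OF N prob_space_axioms])
  let ?r = "sqrt a" and ?k = "(sqrt a - \<rho>) / c" and ?l = "(1 / sqrt a - \<sigma>) / c"
  let ?S = "add_points ?k S N" and ?T = "add_points (- ?l) T N"
  have r: "0 < ?r" "?r * ?r = a" using a(1) by auto
  have nn: "0 \<le> c" "0 \<le> ?k" "0 \<le> ?l" using c a by auto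
  interpret P: poisson_input "M \<Otimes>\<^sub>M M'" ?S ?T "\<lambda>z. A (fst z)" "\<rho> + c * ?k" "\<sigma> + c * ?l" \<kappa>
    by (rule add_points[OF N nn])
  have rates': "\<rho> + c * ?k = ?r" "\<sigma> + c * ?l = 1 / ?r" using c by auto
  have m: "?r + a / ?r = 2 * ?r" using r by (simp add: field_simps)
  from P.passage_lln[OF N c, unfolded rates', OF r(1) refl assms(6) a(1) assms(7), of w] P.whp_AE[OF P.AE_no_ties]
  show "whp (M \<Otimes>\<^sub>M M') (\<lambda>x z. real (passage (S (fst z)) (T (fst z)) (A (fst z)) (x + w) (a * x)) < (2 * ?r + e) * x)"
  proof (rule P.whp_elim[where b = "1 - w"])
    fix x z assume "1 - w \<le> x" "z \<in> space (M \<Otimes>\<^sub>M M')" "no_ties (?S z) (A (fst z))"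
      and *: "\<bar>real (passage (?S z) (?T z) (A (fst z)) (x + w) (a * x)) - (?r + a / ?r) * x\<bar> < e * x"
    then have "passage (S (fst z)) (T (fst z)) (A (fst z)) (x + w) (a * x) \<le>
        passage (?S z) (?T z) (A (fst z)) (x + w) (a * x)"
      using P.loc_finite[of z] by (intro passage_mono subset_add_points) auto
    then show "real (passage (S (fst z)) (T (fst z)) (A (fst z)) (x + w) (a * x)) < (2 * ?r + e) * x"
      using * unfolding m distrib_right by linarith
  qed
  show "\<forall>\<^sub>F x in at_top. (\<lambda>\<omega>. real (passage (S \<omega>) (T \<omega>) (A \<omega>) (x + w) (a * x))) \<in> borel_measurable M"
    using eventually_gt_at_top[of 0]
    by eventually_elim (use a(1) in \<open>auto intro: measurable_passage\<close>)
qed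

section \<open>Boundary points without influence\<close>

context poisson_input
begin

lemma hammersley_mono_input:
  assumes "\<omega> \<in> space M" "S0 \<subseteq> S \<omega>" "T0 \<subseteq> T \<omega>"
  shows "hammersley S0 (T \<omega>) (A \<omega>) t \<subseteq> hammersley (S \<omega>) (T \<omega>) (A \<omega>) t"
    and "hammersley (S \<omega>) (T \<omega>) (A \<omega>) t \<subseteq> hammersley (S \<omega>) T0 (A \<omega>) t"
  using loc_finite[OF assms(1)] assms(2,3)
    hammersley_mono[of "S \<omega>" "T \<omega>" "A \<omega>" S0 "T \<omega>" t]
    hammersley_mono[of "S \<omega>" "T \<omega>" "A \<omega>" "S \<omega>" T0 t] by simp_all

lemma characteristic_gap:
  assumes "0 < \<rho>" "0 < a" "\<rho> \<noteq> sqrt a"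
  shows "0 < \<rho> + a / \<rho> - 2 * sqrt a"
proof -
  have "\<rho> + a / \<rho> - 2 * sqrt a = (\<rho> - sqrt a)\<^sup>2 / \<rho>"
    using assms(1,2) by (simp add: power2_diff field_simps) (simp add: power2_eq_square)
  then show ?thesis using assms by simp
qed

text \<open>With high probability the passage time without sinks is below the full one, so the full
  one is at most the one without sources, hence at most the one with sources \<open>S0\<close>. The
  sinks are the same on both sides; thus the particle counts on \<open>(0, x + w]\<close> satisfy
  the inequality opposite to the inclusion of the configurations, and equality follows.\<close>

lemma sources_irrelevant:
  fixes M' :: "'v measure" and N :: "'v \<Rightarrow> real set"
  assumes N: "poisson_process M' UNIV c N" and c: "0 < c"
    and stat: "0 < \<rho>" "\<sigma> = 1 / \<rho>" "\<kappa> = 1" and a: "0 < a" "\<rho> < sqrt a"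
    and S0: "\<And>\<omega>. \<omega> \<in> space M \<Longrightarrow> S0 \<omega> \<subseteq> S \<omega>"
  shows "whp M (\<lambda>x \<omega>. hammersley (S0 \<omega>) (T \<omega>) (A \<omega>) (a * x) \<inter> {0<..x + w} =
    hammersley (S \<omega>) (T \<omega>) (A \<omega>) (a * x) \<inter> {0<..x + w})"
proof -
  \<comment> \<open>Half of the gap: the lower bound for the full passage time and the upper bound
    for the one without sinks then meet.\<close>
  define e where "e = (\<rho> + a / \<rho> - 2 * sqrt a) / 2"
  have e: "0 < e" "\<rho> + a / \<rho> = 2 * sqrt a + 2 * e"

    proof -
      show "0 < e" using characteristic_gap[OF stat(1) a(1)] a(2) by (simp add: e_def)
      show "\<rho> + a / \<rho> = 2 * sqrt a + 2 * e"
      proof -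
        have "y = 2 * (y / 2)" for y :: real by simp
        from this[of "\<rho> + a / \<rho> - 2 * sqrt a"] show ?thesis unfolding e_def by linarith
      qed
    qed
  note lln = passage_lln[OF N c stat a(1) e(1), of w]
    and upper = poisson_input.passage_upper[OF no_sinks N c a(1) less_imp_le[OF a(2)] _ stat(3) e(1), of w]
  have "0 \<le> 1 / sqrt a" using a by simp
  from whp_conj[OF lln upper[OF this]] whp_AE[OF AE_no_ties] show ?thesis
  proof (rule whp_elim[where b = "1 - w"])
    fix x \<omega> assume x: "1 - w \<le> x" and \<omega>: "\<omega> \<in> space M" and ties: "no_ties (S \<omega>) (A \<omega>)"
      and *: "\<bar>real (passage (S \<omega>) (T \<omega>) (A \<omega>) (x + w) (a * x)) - (\<rho> + a / \<rho>) * x\<bar> < e * x \<and>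
        real (passage (S \<omega>) {} (A \<omega>) (x + w) (a * x)) < (2 * sqrt a + e) * x"
      let ?P = "\<lambda>S T. passage S T (A \<omega>) (x + w) (a * x)"
      let ?H = "\<lambda>S T. hammersley S T (A \<omega>) (a * x)"
      have lf: "locally_finite (S \<omega>)" "locally_finite (T \<omega>)" "locally_finite (A \<omega>)"
        "locally_finite (S0 \<omega>)" "no_ties (S \<omega>) (A \<omega>)" "no_ties (S0 \<omega>) (A \<omega>)" "0 < x + w"
        using loc_finite[OF \<omega>] locally_finite_subset[OF _ S0[OF \<omega>]] S0[OF \<omega>] ties x
        by (auto simp: no_ties_def)
      have "(2 * sqrt a + e) * x = (\<rho> + a / \<rho>) * x - e * x" unfolding e(2) by (simp add: algebra_simps)
      then have "real (?P (S \<omega>) {}) < real (?P (S \<omega>) (T \<omega>))" using * by linarith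
      then have "?P (S \<omega>) (T \<omega>) \<le> ?P {} (T \<omega>)"
        using passage_le_max[OF lf(1-3,5,7), of "a * x"] by simp
      also have "\<dots> \<le> ?P (S0 \<omega>) (T \<omega>)" using lf by (intro passage_mono) auto
      finally have le: "card (?H (S \<omega>) (T \<omega>) \<inter> {0<..x + w}) \<le> card (?H (S0 \<omega>) (T \<omega>) \<inter> {0<..x + w})"
        by (simp add: passage_def hammersley_count_def)
      have sub: "?H (S0 \<omega>) (T \<omega>) \<inter> {0<..x + w} \<subseteq> ?H (S \<omega>) (T \<omega>) \<inter> {0<..x + w}"
        using hammersley_mono_input(1)[OF \<omega> S0[OF \<omega>] order_refl] by auto
      show "?H (S0 \<omega>) (T \<omega>) \<inter> {0<..x + w} = ?H (S \<omega>) (T \<omega>) \<inter> {0<..x + w}"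
        using card_seteq[OF finite_hammersley[OF \<omega>] sub le] .
  qed
qed

text \<open>Here equality cannot hold on all of \<open>(0, x + K]\<close>, because deleting sinks
  leaves extra particles behind near the origin. Passage times agree at \<open>x + K\<close> and at
  \<open>x - K\<close>, so the two particle counts differ by the same number of sinks at both ends.
  Subtracting shows that the window counts coincide, and the inclusion of configurations does the
  rest.\<close>

lemma sinks_irrelevant:
  fixes M' :: "'v measure" and N :: "'v \<Rightarrow> real set"
  assumes N: "poisson_process M' UNIV c N" and c: "0 < c"
    and stat: "0 < \<rho>" "\<sigma> = 1 / \<rho>" "\<kappa> = 1" and a: "0 < a" "sqrt a < \<rho>"
    and T0: "\<And>\<omega>. \<omega> \<in> space M \<Longrightarrow> T0 \<omega> \<subseteq> T \<omega>"
  shows "whp M (\<lambda>x \<omega>. hammersley (S \<omega>) (T0 \<omega>) (A \<omega>) (a * x) \<inter> {x - K<..x + K} =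
    hammersley (S \<omega>) (T \<omega>) (A \<omega>) (a * x) \<inter> {x - K<..x + K})"
proof -
  have "whp M (\<lambda>x \<omega>. hammersley_count (S \<omega>) (T \<omega>) (A \<omega>) (x + w) (a * x) + card (T \<omega> \<inter> {0<..a * x}) =
    hammersley_count (S \<omega>) (T0 \<omega>) (A \<omega>) (x + w) (a * x) + card (T0 \<omega> \<inter> {0<..a * x}))" for w
  proof -
    define e where "e = (\<rho> + a / \<rho> - 2 * sqrt a) / 2"
    have e: "0 < e" "\<rho> + a / \<rho> = 2 * sqrt a + 2 * e"

    proof -
      show "0 < e" using characteristic_gap[OF stat(1) a(1)] a(2) by (simp add: e_def)
      show "\<rho> + a / \<rho> = 2 * sqrt a + 2 * e"
      proof -
        have "y = 2 * (y / 2)" for y :: real by simp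
        from this[of "\<rho> + a / \<rho> - 2 * sqrt a"] show ?thesis unfolding e_def by linarith
      qed
    qed
    have "\<sigma> < 1 / sqrt a" unfolding stat(2) using a stat(1) by (intro divide_strict_left_mono) auto
    note lln = passage_lln[OF N c stat a(1) e(1), of w]
      and upper = poisson_input.passage_upper[OF no_sources N c a(1) _ less_imp_le[OF this] stat(3) e(1), of w]
    have "0 \<le> sqrt a" using a by simp
    from whp_conj[OF lln upper[OF this]] whp_AE[OF AE_no_ties] show ?thesis
    proof (rule whp_elim[where b = "1 - w"])
      fix x \<omega> assume x: "1 - w \<le> x" and \<omega>: "\<omega> \<in> space M" and ties: "no_ties (S \<omega>) (A \<omega>)"
        and *: "\<bar>real (passage (S \<omega>) (T \<omega>) (A \<omega>) (x + w) (a * x)) - (\<rho> + a / \<rho>) * x\<bar> < e * x \<and>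
          real (passage {} (T \<omega>) (A \<omega>) (x + w) (a * x)) < (2 * sqrt a + e) * x"
        let ?P = "\<lambda>S T. passage S T (A \<omega>) (x + w) (a * x)"
        have lf: "locally_finite (S \<omega>)" "locally_finite (T \<omega>)" "locally_finite (A \<omega>)"
          "locally_finite (T0 \<omega>)" "no_ties (S \<omega>) (A \<omega>)" "0 < x + w"
          using loc_finite[OF \<omega>] locally_finite_subset[OF _ T0[OF \<omega>]] ties x by auto
        have "(2 * sqrt a + e) * x = (\<rho> + a / \<rho>) * x - e * x" unfolding e(2) by (simp add: algebra_simps)
        then have "real (?P {} (T \<omega>)) < real (?P (S \<omega>) (T \<omega>))" using * by linarith
        then have "?P (S \<omega>) (T \<omega>) \<le> ?P (S \<omega>) {}"
          using passage_le_max[OF lf(1-3,5,6), of "a * x"] by simp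
        also have "\<dots> \<le> ?P (S \<omega>) (T0 \<omega>)" using lf by (intro passage_mono) auto
        finally have "?P (S \<omega>) (T \<omega>) \<le> ?P (S \<omega>) (T0 \<omega>)" .
        moreover have "?P (S \<omega>) (T0 \<omega>) \<le> ?P (S \<omega>) (T \<omega>)"
          using lf T0[OF \<omega>] by (intro passage_mono) auto
        ultimately have "?P (S \<omega>) (T \<omega>) = ?P (S \<omega>) (T0 \<omega>)" by simp
        then show "hammersley_count (S \<omega>) (T \<omega>) (A \<omega>) (x + w) (a * x) + card (T \<omega> \<inter> {0<..a * x}) =
          hammersley_count (S \<omega>) (T0 \<omega>) (A \<omega>) (x + w) (a * x) + card (T0 \<omega> \<inter> {0<..a * x})"
          by (simp add: passage_def)
    qed
  qed
  from this[of K] this[of "- K"] show ?thesis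
  proof (rule whp_elim[where b = "\<bar>K\<bar>"])
    fix x \<omega> assume x: "\<bar>K\<bar> \<le> x" and \<omega>: "\<omega> \<in> space M"
      and *: "hammersley_count (S \<omega>) (T \<omega>) (A \<omega>) (x + K) (a * x) + card (T \<omega> \<inter> {0<..a * x}) =
        hammersley_count (S \<omega>) (T0 \<omega>) (A \<omega>) (x + K) (a * x) + card (T0 \<omega> \<inter> {0<..a * x})"
        "hammersley_count (S \<omega>) (T \<omega>) (A \<omega>) (x + - K) (a * x) + card (T \<omega> \<inter> {0<..a * x}) =
        hammersley_count (S \<omega>) (T0 \<omega>) (A \<omega>) (x + - K) (a * x) + card (T0 \<omega> \<inter> {0<..a * x})"
      let ?H = "\<lambda>T. hammersley (S \<omega>) T (A \<omega>) (a * x)" and ?W = "{x - K<..x + K}"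
      have lf: "locally_finite (S \<omega>)" "locally_finite (T \<omega>)" "locally_finite (A \<omega>)" "locally_finite (T0 \<omega>)"
        using loc_finite[OF \<omega>] locally_finite_subset[OF _ T0[OF \<omega>]] by auto
      have fin: "finite (?H (T \<omega>) \<inter> {0<..y})" "finite (?H (T0 \<omega>) \<inter> {0<..y})" for y
        using lf by (auto intro: finite_hammersley_Int)
      have finW: "finite (?H (T0 \<omega>) \<inter> ?W)"
        by (rule finite_subset[OF _ fin(2)[of "x + K"]]) (use x in auto)
      have sub: "?H (T \<omega>) \<inter> ?W \<subseteq> ?H (T0 \<omega>) \<inter> ?W"
        using hammersley_mono_input(2)[OF \<omega> order_refl T0[OF \<omega>]] by auto
      show "?H (T0 \<omega>) \<inter> ?W = ?H (T \<omega>) \<inter> ?W"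
      proof (cases "0 \<le> K")
        case True
        have split: "card (H \<inter> {0<..x + K}) = card (H \<inter> {0<..x + - K}) + card (H \<inter> ?W)"
          if "finite (H \<inter> {0<..x + K})" for H
        proof -
          have "H \<inter> {0<..x + K} = H \<inter> {0<..x + - K} \<union> H \<inter> ?W" using True x by auto
          then show ?thesis using that by (subst card_Un_disjoint[symmetric]) auto
        qed
        have "card (?H (T0 \<omega>) \<inter> ?W) = card (?H (T \<omega>) \<inter> ?W)"
          using * split[OF fin(1)] split[OF fin(2)] unfolding hammersley_count_def by linarith
        then show ?thesis using card_seteq[OF finW sub] by simp
      qed simp
  qed
qed

end

section \<open>Local limits\<close>

lemma image_add_affine: "(\<lambda>y. k * y + - (k * x)) ` ((+) x ` I) = (\<lambda>y. k * y) ` (I :: real set)"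
  by (auto simp: image_image algebra_simps)

text \<open>The number \<open>e\<close> bounds both the error of the density and the probability of
  disagreement. The density is exact in the two outer regimes and slightly too small in the fan. The
  same \<open>S'\<close>, \<open>T'\<close> and \<open>\<rho>'\<close> serve for all large
  \<open>x\<close>.\<close>

definition locally_stationary ::
    "'w measure \<Rightarrow> 'v measure \<Rightarrow> ('w \<Rightarrow> real set) \<Rightarrow> ('w \<Rightarrow> real set) \<Rightarrow> ('w \<Rightarrow> (real \<times> real) set) \<Rightarrow>
      real \<Rightarrow> real \<Rightarrow> real \<Rightarrow> real \<Rightarrow> bool" where
  "locally_stationary M M' S T A a r e K \<longleftrightarrow> (\<exists>S' T' \<rho>'. 0 < \<rho>' \<and> \<bar>\<rho>' - r\<bar> < e \<and>
     poisson_input (M \<Otimes>\<^sub>M M') S' T' (\<lambda>z. A (fst z)) \<rho>' (1 / \<rho>') 1 \<and>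
     (\<forall>\<^sub>F x in at_top. \<exists>E\<in>sets (M \<Otimes>\<^sub>M M'). measure (M \<Otimes>\<^sub>M M') E < e \<and>
       (\<forall>z\<in>space (M \<Otimes>\<^sub>M M') - E.
         hammersley (S (fst z)) (T (fst z)) (A (fst z)) (a * x) \<inter> {x - K<..x + K} =
         hammersley (S' z) (T' z) (A (fst z)) (a * x) \<inter> {x - K<..x + K})))"

text \<open>Two errors occur. Replacing the process by the stationary one costs
  \<open>2 * e\<close>, twice the probability of disagreement; replacing density
  \<open>\<rho>'\<close> by \<open>r\<close> costs a multiple of \<open>e\<close> that depends only
  on the window.\<close>

lemma local_limit:
  fixes M :: "'w measure" and M' :: "'v measure" and N :: "'v \<Rightarrow> real set" and f :: "nat list \<Rightarrow> real"
  assumes "random_input M S T A" and N: "poisson_process M' UNIV r N" and r: "0 < r" and a: "0 < a"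
    and approx: "\<And>e K. 0 < e \<Longrightarrow> 0 < K \<Longrightarrow> locally_stationary M M' S T A a r e K"
    and Is: "\<And>I. I \<in> set Is \<Longrightarrow> is_interval I \<and> bounded I" and f: "\<And>v. \<bar>f v\<bar> \<le> 1"
  shows "((\<lambda>x. \<integral>\<omega>. f (map (\<lambda>I. card (hammersley (S \<omega>) (T \<omega>) (A \<omega>) (a * x) \<inter> (+) x ` I)) Is) \<partial>M) \<longlongrightarrow>
    (\<integral>\<omega>. f (map (\<lambda>I. card (N \<omega> \<inter> I)) Is) \<partial>M')) at_top"
proof (rule tendstoI)
  interpret random_input M S T A by fact
  interpret N: prob_space M' by (rule poisson_process_prob_space[OF N])
  let ?P = "M \<Otimes>\<^sub>M M'"
  let ?H = "\<lambda>x \<omega>. hammersley (S \<omega>) (T \<omega>) (A \<omega>) (a * x)"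
  fix \<epsilon> :: real assume "0 < \<epsilon>"
  have "bounded (\<Union>(set Is))" using Is by auto
  then obtain b where b: "\<And>y. y \<in> \<Union>(set Is) \<Longrightarrow> \<bar>y\<bar> \<le> b" by (auto simp: bounded_real)
  define K where "K = \<bar>b\<bar> + 1"
  have K: "0 < K" "\<And>I. I \<in> set Is \<Longrightarrow> I \<subseteq> {- K<..K}"
    using b by (force simp: K_def)+
  \<comment> \<open>The two errors add up to \<open>2 * e + 4 * K * e\<close>; the 3 in place of 2
    makes the inequality strict.\<close>
  define e where "e = \<epsilon> / (3 + 4 * K)"
  have e: "0 < e" "2 * e + 4 * K * e < \<epsilon>"
  proof -
    show "0 < e" using \<open>0 < \<epsilon>\<close> K(1) by (simp add: e_def)
    moreover have "e * (3 + 4 * K) = \<epsilon>" using K(1) by (simp add: e_def)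
    ultimately show "2 * e + 4 * K * e < \<epsilon>" by (simp add: distrib_left mult.commute)
  qed
  obtain S' T' \<rho>' where \<rho>': "0 < \<rho>'" "\<bar>\<rho>' - r\<bar> < e"
    and stat: "poisson_input ?P S' T' (\<lambda>z. A (fst z)) \<rho>' (1 / \<rho>') 1"
    and close: "\<forall>\<^sub>F x in at_top. \<exists>E\<in>sets ?P. measure ?P E < e \<and>
        (\<forall>z\<in>space ?P - E. ?H x (fst z) \<inter> {x - K<..x + K} =
          hammersley (S' z) (T' z) (A (fst z)) (a * x) \<inter> {x - K<..x + K})"
    using approx[OF e(1) K(1)] unfolding locally_stationary_def by blast
  interpret P: poisson_input ?P S' T' "\<lambda>z. A (fst z)" \<rho>' "1 / \<rho>'" 1 by (rule stat)
  let ?H' = "\<lambda>x z. hammersley (S' z) (T' z) (A (fst z)) (a * x)"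
  let ?k = "\<rho>' / r"
  have k: "0 < ?k" "r * ?k = \<rho>'" using \<rho>' r by auto
  have shift: "is_interval ((+) x ` I) \<and> (+) x ` I \<subseteq> {0<..R}" if "I \<in> set Is" "K \<le> x" "x + K \<le> R" for I x R
  proof
    show "is_interval ((+) x ` I)"
      using Is[OF that(1)] by (simp add: is_interval_translation)
    show "(+) x ` I \<subseteq> {0<..R}" using K(2)[OF that(1)] that(2,3) by force
  qed
  have aff: "card (affine_part k (- (k * x)) N \<omega> \<inter> (+) x ` I) = card (N \<omega> \<inter> (\<lambda>y. k * y) ` I)"
    if "0 < k" "I \<in> set Is" "K \<le> x" for k x I \<omega>
  proof -
    have "(+) x ` I \<subseteq> {0<..}" using shift[OF that(2,3) order_refl] by auto
    from affine_part_Int[OF that(1) this, of "- (k * x)" N \<omega>] show ?thesis unfolding image_add_affine .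
  qed
  \<comment> \<open>\<open>poisson_law\<close> lives on the positive half-line, so the intervals are
    moved into \<open>(0, 2 * K]\<close>. There \<open>N\<close> stretched by \<open>?k\<close> has
    intensity \<open>\<rho>'\<close> and \<open>N\<close> itself has intensity
    \<open>r\<close>.\<close>
  have N_eq: "\<bar>(\<integral>\<omega>. f (map (\<lambda>I. card (N \<omega> \<inter> (\<lambda>y. ?k * y) ` I)) Is) \<partial>M') - (\<integral>\<omega>. f (map (\<lambda>I. card (N \<omega> \<inter> I)) Is) \<partial>M')\<bar>
      \<le> 4 * K * e"
  proof -
    let ?Is = "map (\<lambda>I. (+) K ` I) Is"
    have "0 < 2 * K" using K(1) by simp
    note l1 = poisson_law_affine_part[OF N less_imp_le[OF r] k(1) this, of "- (?k * K)", unfolded k(2)]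
      and l2 = poisson_law_affine_part[OF N less_imp_le[OF r] zero_less_one this, of "- (1 * K)"]
    have 1: "map (\<lambda>I. card (affine_part ?k (- (?k * K)) N \<omega> \<inter> I)) ?Is = map (\<lambda>I. card (N \<omega> \<inter> (\<lambda>y. ?k * y) ` I)) Is" for \<omega>
      using aff[OF k(1) _ order_refl] by simp
    have 2: "map (\<lambda>I. card (affine_part 1 (- (1 * K)) N \<omega> \<inter> I)) ?Is = map (\<lambda>I. card (N \<omega> \<inter> I)) Is" for \<omega>
      using aff[OF zero_less_one _ order_refl, of _ \<omega>] by simp
    have "\<bar>(\<integral>\<omega>. f (map (\<lambda>I. card (affine_part ?k (- (?k * K)) N \<omega> \<inter> I)) ?Is) \<partial>M') -
        (\<integral>\<omega>. f (map (\<lambda>I. card (affine_part 1 (- (1 * K)) N \<omega> \<inter> I)) ?Is) \<partial>M')\<bar> \<le> 2 * (2 * K) * \<bar>\<rho>' - r * 1\<bar>"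
      by (rule poisson_law_perturb[OF l1 l2]) (use \<rho>' r K(1) f shift[of _ K "2 * K"] in auto)
    also have "\<dots> \<le> 4 * K * e" using \<rho>'(2) K(1) by simp
    finally show ?thesis unfolding 1 2 .
  qed
  show "\<forall>\<^sub>F x in at_top. dist (\<integral>\<omega>. f (map (\<lambda>I. card (?H x \<omega> \<inter> (+) x ` I)) Is) \<partial>M)
    (\<integral>\<omega>. f (map (\<lambda>I. card (N \<omega> \<inter> I)) Is) \<partial>M') < \<epsilon>"
    using close eventually_gt_at_top[of K]
  proof eventually_elim
    case (elim x)
    then obtain E where E: "E \<in> sets ?P" "measure ?P E < e"
      "\<And>z. z \<in> space ?P - E \<Longrightarrow> ?H x (fst z) \<inter> {x - K<..x + K} = ?H' x z \<inter> {x - K<..x + K}" by blast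
    have x: "0 < a * x" "0 < x + K" "K \<le> x" using elim(2) K(1) a by auto
    note sh = shift[OF _ x(3) order_refl]
    let ?g = "\<lambda>\<omega>. f (map (\<lambda>I. card (?H x \<omega> \<inter> (+) x ` I)) Is)"
    let ?h = "\<lambda>z. f (map (\<lambda>I. card (?H' x z \<inter> (+) x ` I)) Is)"
    have mg: "?g \<in> borel_measurable M"
    proof (rule measurable_compose[OF measurable_map_count_space])
      fix I assume "I \<in> set Is"
      with sh[OF this] show "(\<lambda>\<omega>. card (?H x \<omega> \<inter> (+) x ` I)) \<in> measurable M (count_space UNIV)"
        by (intro measurable_hammersley_Int[OF x(1), where R = "x + K"]) (auto intro: is_interval_borel)
    qed simp
    have mh: "?h \<in> borel_measurable ?P"
    proof (rule measurable_compose[OF measurable_map_count_space])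
      fix I assume "I \<in> set Is"
      with sh[OF this] show "(\<lambda>z. card (?H' x z \<inter> (+) x ` I)) \<in> measurable ?P (count_space UNIV)"
        by (intro P.measurable_hammersley_Int[OF x(1), where R = "x + K"]) (auto intro: is_interval_borel)
    qed simp
    have mgf: "(\<lambda>z. ?g (fst z)) \<in> borel_measurable ?P"
      by (rule measurable_compose[OF measurable_fst mg])
    have "(\<integral>\<omega>. ?g \<omega> \<partial>M) = (\<integral>\<omega>. ?g \<omega> \<partial>distr ?P M fst)" by (simp add: N.distr_pair_fst)
    also have "\<dots> = (\<integral>z. ?g (fst z) \<partial>?P)" by (rule integral_distr[OF measurable_fst mg])
    finally have g_eq: "(\<integral>\<omega>. ?g \<omega> \<partial>M) = (\<integral>z. ?g (fst z) \<partial>?P)" .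
    have ig: "integrable ?P (\<lambda>z. ?g (fst z))" "integrable ?P ?h"
      using mgf mh f by (auto intro!: P.integrable_const_bound[where B = 1])
    have "\<bar>(\<integral>z. ?g (fst z) \<partial>?P) - (\<integral>z. ?h z \<partial>?P)\<bar> = \<bar>\<integral>z. ?g (fst z) - ?h z \<partial>?P\<bar>"
      using ig by simp
    also have "\<dots> \<le> (\<integral>z. \<bar>?g (fst z) - ?h z\<bar> \<partial>?P)" by (rule integral_abs_bound)
    also have "\<dots> \<le> (\<integral>z. 2 * indicator E z \<partial>?P)"
    proof (rule integral_mono)
      show "integrable ?P (\<lambda>z. \<bar>?g (fst z) - ?h z\<bar>)" using ig by simp
      show "integrable ?P (\<lambda>z. 2 * indicator E z :: real)" using E(1) by (simp add: P.emeasure_eq_measure)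
      fix z assume z: "z \<in> space ?P"
      show "\<bar>?g (fst z) - ?h z\<bar> \<le> 2 * indicator E z"
      proof (cases "z \<in> E")
        case True
        then show ?thesis using f[of "map (\<lambda>I. card (?H x (fst z) \<inter> (+) x ` I)) Is"]
          f[of "map (\<lambda>I. card (?H' x z \<inter> (+) x ` I)) Is"] by simp
      next
        case False
        have "?H x (fst z) \<inter> (+) x ` I = ?H' x z \<inter> (+) x ` I" if "I \<in> set Is" for I
        proof -
          have "(+) x ` I \<subseteq> {x - K<..x + K}" using K(2)[OF that] by auto
          then show ?thesis using E(3)[of z] z False by blast
        qed
        then have "map (\<lambda>I. card (?H x (fst z) \<inter> (+) x ` I)) Is = map (\<lambda>I. card (?H' x z \<inter> (+) x ` I)) Is"
          by (intro map_cong) auto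
        then show ?thesis by (simp only:) simp
      qed
    qed
    also have "\<dots> = 2 * measure ?P E" using E(1) by (simp add: P.emeasure_eq_measure)
    finally have gh: "\<bar>(\<integral>\<omega>. ?g \<omega> \<partial>M) - (\<integral>z. ?h z \<partial>?P)\<bar> \<le> 2 * e" unfolding g_eq using E(2) by linarith
    \<comment> \<open>The shift \<open>- (?k * x)\<close> undoes the translation of the intervals by
      \<open>x\<close>, so the right-hand side no longer depends on \<open>x\<close>.\<close>
    have "(\<integral>z. ?h z \<partial>?P) = (\<integral>\<omega>. f (map (\<lambda>I. card (N \<omega> \<inter> (\<lambda>y. ?k * y) ` I)) Is) \<partial>M')"
    proof -
      let ?Is = "map (\<lambda>I. (+) x ` I) Is"
      note l1 = P.poisson_law_hammersley[OF \<rho>'(1) refl refl x(2,1)]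
        and l2 = poisson_law_affine_part[OF N less_imp_le[OF r] k(1) x(2), of "- (?k * x)", unfolded k(2)]
      have 1: "map (\<lambda>I. card (affine_part ?k (- (?k * x)) N \<omega> \<inter> I)) ?Is = map (\<lambda>I. card (N \<omega> \<inter> (\<lambda>y. ?k * y) ` I)) Is" for \<omega>
        using aff[OF k(1) _ x(3)] by simp
      have 2: "map (\<lambda>I. card (?H' x z \<inter> I)) ?Is = map (\<lambda>I. card (?H' x z \<inter> (+) x ` I)) Is" for z by simp
      have "(\<integral>z. f (map (\<lambda>I. card (?H' x z \<inter> I)) ?Is) \<partial>?P) =
        (\<integral>\<omega>. f (map (\<lambda>I. card (affine_part ?k (- (?k * x)) N \<omega> \<inter> I)) ?Is) \<partial>M')"
        by (rule poisson_law_eq[OF l1 l2]) (use f sh in auto)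
      then show ?thesis unfolding 1 2 .
    qed
    then show ?case using gh N_eq e(2) unfolding dist_real_def by linarith
  qed
qed

section \<open>The three regimes\<close>

lemma poisson_input_of_processes:
  fixes M :: "'w measure" and S T :: "'w \<Rightarrow> real set" and A :: "'w \<Rightarrow> (real \<times> real) set"
  assumes S: "poisson_process M {0<..} lam S" and T: "poisson_process M {0<..} mu T"
    and A: "poisson_process M ({0<..} \<times> {0<..}) 1 A" and indep: "independent_processes M S T A"
    and "0 \<le> lam" "0 \<le> mu"
  shows "poisson_input M S T A lam mu 1"
proof -
  interpret prob_space M by (rule poisson_process_prob_space[OF S])
  have vac: "{\<omega>\<in>space M. S \<omega> \<inter> B = {} \<and> T \<omega> \<inter> C = {} \<and> A \<omega> \<inter> D = {}} \<in> events"
    "prob {\<omega>\<in>space M. S \<omega> \<inter> B = {} \<and> T \<omega> \<inter> C = {} \<and> A \<omega> \<inter> D = {}} =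
      exp (- (lam * measure lborel B + mu * measure lborel C + 1 * measure lborel D))"
    if "valid_box (B, C, D)" for B C D
  proof -
    have B: "B \<in> sets borel" "bounded B" "B \<subseteq> {0<..}" and C: "C \<in> sets borel" "bounded C" "C \<subseteq> {0<..}"
      and D: "D \<in> sets borel" "bounded D" "D \<subseteq> {0<..} \<times> {0<..}"
      using that by (auto simp: valid_box_def)
    let ?S = "{\<omega>\<in>space M. S \<omega> \<inter> B = {}}" and ?T = "{\<omega>\<in>space M. T \<omega> \<inter> C = {}}"
      and ?A = "{\<omega>\<in>space M. A \<omega> \<inter> D = {}}"
    have eq: "{\<omega>\<in>space M. S \<omega> \<inter> B = {} \<and> T \<omega> \<inter> C = {} \<and> A \<omega> \<inter> D = {}} = ?S \<inter> ?T \<inter> ?A" by auto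
    show "{\<omega>\<in>space M. S \<omega> \<inter> B = {} \<and> T \<omega> \<inter> C = {} \<and> A \<omega> \<inter> D = {}} \<in> events"
      unfolding eq using poisson_process_vacant_sets[OF S B(1,2)] poisson_process_vacant_sets[OF T C(1,2)]
        poisson_process_vacant_sets[OF A D(1,2)] by auto
    have "?S \<in> generated_sigma M S" "?T \<in> generated_sigma M T" "?A \<in> generated_sigma M A"
      unfolding generated_sigma_def poisson_process_vacant_eq[OF S B(2)]
        poisson_process_vacant_eq[OF T C(2)] poisson_process_vacant_eq[OF A D(2)]
      using B C D by (auto intro!: sigma_sets.Basic)
    then have "prob (\<Inter>j\<in>{..<3}. [?S, ?T, ?A] ! j) = (\<Prod>j\<in>{..<3}. prob ([?S, ?T, ?A] ! j))"
      using indep unfolding independent_processes_def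
      by (intro indep_setsD) (auto simp: numeral_3_eq_3 less_Suc_eq)
    moreover have "{..<3::nat} = {0, 1, 2}" by auto
    ultimately have "prob (?S \<inter> ?T \<inter> ?A) = prob ?S * prob ?T * prob ?A"
      by (simp add: Int_assoc mult.assoc)
    then show "prob {\<omega>\<in>space M. S \<omega> \<inter> B = {} \<and> T \<omega> \<inter> C = {} \<and> A \<omega> \<inter> D = {}} =
      exp (- (lam * measure lborel B + mu * measure lborel C + 1 * measure lborel D))"
      unfolding eq poisson_process_prob_vacant[OF S B] poisson_process_prob_vacant[OF T C]
        poisson_process_prob_vacant[OF A D] by (simp add: exp_add[symmetric])
  qed
  show ?thesis
  proof
    fix \<omega> assume "\<omega> \<in> space M"
    then show "S \<omega> \<subseteq> {0<..} \<and> T \<omega> \<subseteq> {0<..} \<and> A \<omega> \<subseteq> {0<..} \<times> {0<..}"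
      "locally_finite (S \<omega>) \<and> locally_finite (T \<omega>) \<and> locally_finite (A \<omega>)"
      using poisson_process_subset[OF S] poisson_process_subset[OF T] poisson_process_subset[OF A]
        poisson_process_locally_finite[OF S] poisson_process_locally_finite[OF T]
        poisson_process_locally_finite[OF A] by auto
  qed (use vac assms(5,6) in auto)
qed

text \<open>In the rarefaction fan the process is squeezed between two processes that look locally like
  stationary ones with densities \<open>r - s\<close> and \<open>r + s\<close>.\<close>

lemma (in poisson_input) rarefaction_fan:
  fixes M' :: "'v measure" and N :: "'v \<Rightarrow> real set"
  assumes N: "poisson_process M' UNIV c N" and c: "0 < c" and "\<kappa> = 1" and a: "0 < a"
    and fan: "\<rho> < sqrt a" "sqrt a < 1 / \<sigma>" "0 < \<sigma>" and e: "0 < e" and K: "0 < K"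
  shows "locally_stationary M M' S T A a (sqrt a) e K"
proof -
  let ?P = "M \<Otimes>\<^sub>M M'"
  define r where "r = sqrt a"
  have r: "0 < r" "\<rho> < r" "r < 1 / \<sigma>" using a fan by (auto simp: r_def)
  \<comment> \<open>The mean number of particles of density \<open>r\<close> in a window of length
    \<open>2 * K\<close>.\<close>
  define m where "m = 2 * K * r"
  \<comment> \<open>The truncation level for \<open>prob_poisson_variable_less\<close>, large enough
    to make the second moment term smaller than \<open>e / 4\<close>.\<close>
  define k where "k = 4 * (m\<^sup>2 + m) / e + 1"
  have m: "0 < m" using K r by (simp add: m_def)
  have k: "0 < k" "(m\<^sup>2 + m) / k < e / 4"
  proof -
    have p: "0 < m\<^sup>2 + m" using m by (simp add: add_pos_pos)
    then show k: "0 < k" using e by (simp add: k_def add_pos_pos)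
    have "e / 4 * k = m\<^sup>2 + m + e / 4" using e by (simp add: k_def field_simps)
    then show "(m\<^sup>2 + m) / k < e / 4" using e k by (simp add: pos_divide_less_eq)
  qed
  \<comment> \<open>Both densities \<open>r - s\<close> and \<open>r + s\<close> must stay positive
    and between \<open>\<rho>\<close> and \<open>1 / \<sigma>\<close>, so that points only have to
    be added. The last entry of the minimum makes the difference \<open>4 * K * s\<close> of the
    mean window counts less than \<open>e / 4\<close>.\<close>
  define s where "s = Min {e, r, r - \<rho>, 1 / \<sigma> - r, e / (16 * K)} / 2"
  have "0 < Min {e, r, r - \<rho>, 1 / \<sigma> - r, e / (16 * K)}" using e r K by simp
  moreover have "Min {e, r, r - \<rho>, 1 / \<sigma> - r, e / (16 * K)} \<le> y" if "y \<in> {e, r, r - \<rho>, 1 / \<sigma> - r, e / (16 * K)}" for y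
    using that by (intro Min_le) auto
  ultimately have s: "0 < s" "s < e" "s < r" "s < r - \<rho>" "s < 1 / \<sigma> - r" "s < e / (16 * K)"
    unfolding s_def by force+
  then have sK: "4 * K * s < e / 4" using K by (simp add: field_simps)
  define \<rho>1 where "\<rho>1 = r - s"
  define \<rho>2 where "\<rho>2 = r + s"
  have ss: "\<sigma> * (r + s) < 1" using s(5) fan(3) by (simp add: field_simps)
  have "0 < \<sigma> * s" using fan(3) s(1) by simp
  then have "\<sigma> * (r - s) < 1" using ss unfolding distrib_left right_diff_distrib by linarith
  then have "\<sigma> < 1 / \<rho>1" "\<sigma> < 1 / \<rho>2"
    using ss s r by (auto simp: \<rho>1_def \<rho>2_def pos_less_divide_eq)
  then have \<rho>1: "0 < \<rho>1" "\<rho> < \<rho>1" "\<rho>1 < r" "\<sigma> < 1 / \<rho>1" and \<rho>2: "0 < \<rho>2" "\<rho> < \<rho>2" "r < \<rho>2" "\<sigma> < 1 / \<rho>2"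
    using s r by (auto simp: \<rho>1_def \<rho>2_def)
  let ?k1 = "(\<rho>1 - \<rho>) / c" and ?l1 = "(1 / \<rho>1 - \<sigma>) / c" and ?k2 = "(\<rho>2 - \<rho>) / c" and ?l2 = "(1 / \<rho>2 - \<sigma>) / c"
  have nn: "0 \<le> c" "0 \<le> ?k1" "0 \<le> ?l1" "0 \<le> ?k2" "0 \<le> ?l2" using c \<rho>1 \<rho>2 by auto
  have rates': "\<rho> + c * ?k1 = \<rho>1" "\<sigma> + c * ?l1 = 1 / \<rho>1" "\<rho> + c * ?k2 = \<rho>2" "\<sigma> + c * ?l2 = 1 / \<rho>2"
    using c by auto
  define S1 where "S1 = add_points ?k1 S N"
  define T1 where "T1 = add_points (- ?l1) T N"
  define S2 where "S2 = add_points ?k2 S N"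
  define T2 where "T2 = add_points (- ?l2) T N"
  define A' where "A' = (\<lambda>z::'a \<times> 'v. A (fst z))"
  interpret P1: poisson_input ?P S1 T1 A' \<rho>1 "1 / \<rho>1" 1
    using add_points[OF N nn(1-3)] unfolding rates' assms(3) S1_def T1_def A'_def .
  interpret P2: poisson_input ?P S2 T2 A' \<rho>2 "1 / \<rho>2" 1
    using add_points[OF N nn(1,4,5)] unfolding rates' assms(3) S2_def T2_def A'_def .
  have sub: "S (fst z) \<subseteq> S1 z" "T (fst z) \<subseteq> T1 z" "S (fst z) \<subseteq> S2 z" "T (fst z) \<subseteq> T2 z" for z
    unfolding S1_def T1_def S2_def T2_def by (rule subset_add_points)+
  define H where "H S T x z = hammersley (S z) (T z) (A' z) (a * x)" for S T x z
  let ?S = "\<lambda>z. S (fst z)" and ?T = "\<lambda>z. T (fst z)"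
  let ?W = "\<lambda>x. {x - K<..x + K}"
  \<comment> \<open>Extra sinks alone give a lower process, extra sources alone an upper one. On
    \<open>Q\<close> the first agrees locally with the stationary process of density
    \<open>\<rho>1\<close>, whose added sources have no influence, and the second with that of
    density \<open>\<rho>2\<close>, whose added sinks have none.\<close>
  define Q where "Q x z \<longleftrightarrow> H ?S T1 x z \<inter> {0<..x + K} = H S1 T1 x z \<inter> {0<..x + K} \<and>
    H S2 ?T x z \<inter> ?W x = H S2 T2 x z \<inter> ?W x" for x z
  have whpQ: "whp ?P Q"
  proof -
    have "whp ?P (\<lambda>x z. H ?S T1 x z \<inter> {0<..x + K} = H S1 T1 x z \<inter> {0<..x + K})"
      unfolding H_def
      by (rule P1.sources_irrelevant[OF N c \<rho>1(1) refl refl a]) (use \<rho>1 sub in \<open>auto simp: r_def\<close>)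
    moreover have "whp ?P (\<lambda>x z. H S2 ?T x z \<inter> ?W x = H S2 T2 x z \<inter> ?W x)"
      unfolding H_def
      by (rule P2.sinks_irrelevant[OF N c \<rho>2(1) refl refl a]) (use \<rho>2 sub in \<open>auto simp: r_def\<close>)
    ultimately show ?thesis unfolding Q_def by (rule P1.whp_conj)
  qed
  have mono: "H ?S T1 x z \<subseteq> H ?S ?T x z" "H ?S ?T x z \<subseteq> H S2 ?T x z" if "z \<in> space ?P" for x z
  proof -
    have lf: "locally_finite (S1 z)" "locally_finite (T1 z)" "locally_finite (A' z)" "locally_finite (S2 z)" "locally_finite (T2 z)"
      using P1.loc_finite[OF that] P2.loc_finite[OF that] by auto
    show "H ?S T1 x z \<subseteq> H ?S ?T x z" "H ?S ?T x z \<subseteq> H S2 ?T x z"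
      unfolding H_def using lf locally_finite_subset[OF lf(1) sub(1)] locally_finite_subset[OF lf(2) sub(2)] sub[of z]
      by (simp_all add: hammersley_mono)
  qed
  let ?c1 = "\<lambda>x z. card (H S1 T1 x z \<inter> ?W x)" and ?c2 = "\<lambda>x z. card (H S2 T2 x z \<inter> ?W x)"
  have squeeze: "H ?S T1 x z \<inter> ?W x = H S1 T1 x z \<inter> ?W x \<and> ?c1 x z \<le> ?c2 x z \<and>
      (?c2 x z \<le> ?c1 x z \<longrightarrow> H ?S ?T x z \<inter> ?W x = H S1 T1 x z \<inter> ?W x)"
    if "Q x z" "z \<in> space ?P" "K < x" for x z
  proof -
    have W: "?W x \<subseteq> {0<..x + K}" using that(3) by auto
    have fin: "finite (H S2 T2 x z \<inter> ?W x)"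
      using finite_subset[OF _ P2.finite_hammersley[OF that(2), of "a * x" "x + K"]] W
      unfolding H_def by blast
    have 1: "H ?S T1 x z \<inter> ?W x = H S1 T1 x z \<inter> ?W x" using that(1) W unfolding Q_def by blast
    have 2: "H S2 ?T x z \<inter> ?W x = H S2 T2 x z \<inter> ?W x" using that(1) unfolding Q_def by blast
    have 3: "H S1 T1 x z \<inter> ?W x \<subseteq> H ?S ?T x z \<inter> ?W x" "H ?S ?T x z \<inter> ?W x \<subseteq> H S2 T2 x z \<inter> ?W x"
      using 1 2 mono[OF that(2), of x] by blast+
    have "?c1 x z \<le> ?c2 x z" using 3 fin by (intro card_mono) auto
    moreover have "H ?S ?T x z \<inter> ?W x = H S1 T1 x z \<inter> ?W x" if "?c2 x z \<le> ?c1 x z"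
      using card_seteq[OF fin _ that] 3 by blast
    ultimately show ?thesis using 1 by blast
  qed
  have poisson: "P1.poisson_variable (?c1 x) (\<rho>1 * (2 * K)) \<and> P1.poisson_variable (?c2 x) (\<rho>2 * (2 * K))"
    if "K < x" for x
  proof -
    have x: "0 < x + K" "0 < a * x" "?W x \<subseteq> {0<..x + K}" "is_interval (?W x)" "measure lborel (?W x) = 2 * K"
      using that K a by (auto simp: is_interval_1)
    have meas: "?c1 x \<in> measurable ?P (count_space UNIV)" "?c2 x \<in> measurable ?P (count_space UNIV)"
      using P1.measurable_hammersley_Int[OF x(2) is_interval_borel[OF x(4)] x(3)]
        P2.measurable_hammersley_Int[OF x(2) is_interval_borel[OF x(4)] x(3)] unfolding H_def by auto
    have laws: "poisson_law ?P (H S1 T1 x) \<rho>1 (x + K)" "poisson_law ?P (H S2 T2 x) \<rho>2 (x + K)"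
      using P1.poisson_law_hammersley[OF \<rho>1(1) refl refl x(1,2)]
        P2.poisson_law_hammersley[OF \<rho>2(1) refl refl x(1,2)] by (simp_all add: H_def[abs_def])
    show ?thesis
      using poisson_law_variable[OF P1.prob_space_axioms laws(1) \<rho>1(1) x(3,4) meas(1) N c x(1)]
        poisson_law_variable[OF P1.prob_space_axioms laws(2) \<rho>2(1) x(3,4) meas(2) N c x(1)]
      unfolding x(5) by blast
  qed
  \<comment> \<open>On \<open>Q\<close> the inclusions hold, so a reversed order of the counts is
    confined to the exceptional events of \<open>Q\<close>.\<close>
  have lim: "((\<lambda>x. measure ?P {z\<in>space ?P. ?c2 x z < ?c1 x z}) \<longlongrightarrow> 0) at_top"
  proof (rule P1.whp_tendsto_prob[OF whpQ])
    show "\<forall>\<^sub>F x in at_top. {z\<in>space ?P. ?c2 x z < ?c1 x z} \<in> sets ?P \<and> (\<forall>z\<in>{z\<in>space ?P. ?c2 x z < ?c1 x z}. \<not> Q x z)"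
      using eventually_gt_at_top[of K]
    proof eventually_elim
      case (elim x)
      have "(\<lambda>z. real (?c1 x z)) \<in> borel_measurable ?P" "(\<lambda>z. real (?c2 x z)) \<in> borel_measurable ?P"
        using poisson[OF elim] unfolding P1.poisson_variable_def by (simp_all only: measurable_nat_iff_real)
      from borel_measurable_less[OF this(2,1)] have "{z\<in>space ?P. ?c2 x z < ?c1 x z} \<in> sets ?P" by simp
      then show ?case using squeeze[OF _ _ elim] by fastforce
    qed
  qed
  have "e / (4 * k) > 0" using e k by simp
  with lim have ev1: "\<forall>\<^sub>F x in at_top. measure ?P {z\<in>space ?P. ?c2 x z < ?c1 x z} < e / (4 * k)"
    by (rule order_tendstoD(2))
  have "e / 4 > 0" using e by simp
  with whpQ have ev2: "\<forall>\<^sub>F x in at_top. \<exists>E\<in>sets ?P. measure ?P E < e / 4 \<and> (\<forall>z\<in>space ?P - E. Q x z)"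
    unfolding whp_def by blast
  have "\<forall>\<^sub>F x in at_top. \<exists>E\<in>sets ?P. measure ?P E < e \<and>
      (\<forall>z\<in>space ?P - E. H ?S ?T x z \<inter> ?W x = H S1 T1 x z \<inter> ?W x)"
    using ev1 ev2 eventually_gt_at_top[of K]
  proof eventually_elim
    case (elim x)
    obtain E where E: "E \<in> sets ?P" "measure ?P E < e / 4" "\<forall>z\<in>space ?P - E. Q x z" using elim(2) by blast
    let ?F = "{z\<in>space ?P. ?c1 x z < ?c2 x z}"
    note pv = poisson[OF elim(3)]
    have "(\<lambda>z. real (?c1 x z)) \<in> borel_measurable ?P" "(\<lambda>z. real (?c2 x z)) \<in> borel_measurable ?P"
      using pv unfolding P1.poisson_variable_def by (simp_all only: measurable_nat_iff_real)
    from borel_measurable_less[OF this] have F: "?F \<in> sets ?P" by simp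
    let ?m1 = "\<rho>1 * (2 * K)" and ?m2 = "\<rho>2 * (2 * K)"
    \<comment> \<open>Each of the three contributions is below \<open>e / 4\<close>: the difference
      of the means, the reversed order and the truncation. The exceptional event \<open>E\<close>
      takes the remaining quarter.\<close>
    have "measure ?P ?F \<le> ?m2 - ?m1 + k * measure ?P {z\<in>space ?P. ?c2 x z < ?c1 x z} + (?m1\<^sup>2 + ?m1) / k"
      using P1.prob_poisson_variable_less[OF conjunct1[OF pv] conjunct2[OF pv] k(1)] .
    moreover have "?m2 - ?m1 = 4 * K * s" by (simp add: \<rho>1_def \<rho>2_def algebra_simps)
    moreover have "k * measure ?P {z\<in>space ?P. ?c2 x z < ?c1 x z} < e / 4"
      using elim(1) k(1) by (simp add: field_simps)
    moreover have "(?m1\<^sup>2 + ?m1) / k \<le> (m\<^sup>2 + m) / k"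
    proof -
      have "0 \<le> ?m1" "?m1 \<le> m" using \<rho>1 K by (auto simp: m_def)
      then have "?m1\<^sup>2 \<le> m\<^sup>2" by (intro power_mono)
      then show ?thesis using \<open>?m1 \<le> m\<close> k(1) by (intro divide_right_mono) auto
    qed
    ultimately have "measure ?P ?F < e / 4 + e / 4 + e / 4" using sK k(2) by linarith
    then have "measure ?P (E \<union> ?F) < e"
      using measure_Un_le[OF E(1) F] E(2) by linarith
    moreover have "H ?S ?T x z \<inter> ?W x = H S1 T1 x z \<inter> ?W x" if "z \<in> space ?P - (E \<union> ?F)" for z
      using squeeze[OF _ _ elim(3), of z] E(3) that by auto
    ultimately show ?case using E(1) F by blast
  qed
  moreover have "\<bar>\<rho>1 - sqrt a\<bar> < e" using s by (simp add: \<rho>1_def r_def)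
  ultimately show ?thesis
    using \<rho>1(1) P1.poisson_input_axioms unfolding H_def A'_def locally_stationary_def by blast
qed

theorem theorem2p2:
  fixes M :: "'w measure" and M' :: "'v measure"
    and S T :: "'w \<Rightarrow> real set" and A :: "'w \<Rightarrow> (real \<times> real) set"
    and L :: "'w \<Rightarrow> real \<Rightarrow> real \<Rightarrow> nat"
    and X :: "real \<Rightarrow> 'w \<Rightarrow> real set"
    and lam mu a :: real
  assumes "prob_space M"
    and "lam > 0" and "mu > 0" and "lam * mu < 1" and "a > 0"
    and sources: "poisson_process M {0<..} lam S"
    and sinks: "poisson_process M {0<..} mu T"
    and alpha_points: "poisson_process M ({0<..} \<times> {0<..}) 1 A"
    and indep: "independent_processes M S T A"
    and L: "L = (\<lambda>\<omega> x t. hammersley_count (S \<omega>) (T \<omega>) (A \<omega>) x t)"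
    and X: "X = (\<lambda>x \<omega>. particles_of (- x) (\<lambda>y. int (L \<omega> (x + y) (a * x)) - int (L \<omega> x (a * x))))"
  shows "(a > 1 / mu^2 \<longrightarrow>
            (\<forall>N. poisson_process M' UNIV (1 / mu) N \<longrightarrow> converges_in_distribution M X M' N)) \<and>
         (1 / mu^2 > a \<and> a > lam^2 \<longrightarrow>
            (\<forall>N. poisson_process M' UNIV (sqrt a) N \<longrightarrow> converges_in_distribution M X M' N)) \<and>
         (lam^2 > a \<longrightarrow>
            (\<forall>N. poisson_process M' UNIV lam N \<longrightarrow> converges_in_distribution M X M' N))"
proof -
  interpret I: poisson_input M S T A lam mu 1
    by (rule poisson_input_of_processes[OF sources sinks alpha_points indep]) (use assms(2,3) in auto)
  let ?H = "\<lambda>x \<omega>. hammersley (S \<omega>) (T \<omega>) (A \<omega>) (a * x)"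
  have converges: "converges_in_distribution M X M' N"
    if N: "poisson_process M' UNIV r N" and "0 < r"
      and approx: "\<And>e K. 0 < e \<Longrightarrow> 0 < K \<Longrightarrow> locally_stationary M M' S T A a r e K"
    for N :: "'v \<Rightarrow> real set" and r
    unfolding converges_in_distribution_def
  proof (intro allI impI)
    fix Is :: "real set list" and f :: "nat list \<Rightarrow> real"
    assume Is: "\<forall>I\<in>set Is. is_interval I \<and> bounded I" and "bounded (range f)"
    then obtain b where b: "\<And>v. \<bar>f v\<bar> \<le> b" by (auto simp: bounded_real)
    \<comment> \<open>Dividing by \<open>B\<close> reduces to test functions bounded by 1; the
      summand 1 keeps \<open>B\<close> positive.\<close>
    define B where "B = \<bar>b\<bar> + 1"
    have B: "0 < B" "\<bar>f v / B\<bar> \<le> 1" for v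
      using b[of v] by (auto simp: B_def field_simps)
    have "((\<lambda>x. \<integral>\<omega>. f (map (\<lambda>I. card (?H x \<omega> \<inter> (+) x ` I)) Is) / B \<partial>M) \<longlongrightarrow>
      (\<integral>\<omega>. f (map (\<lambda>I. card (N \<omega> \<inter> I)) Is) / B \<partial>M')) at_top"
      using Is B(2) by (intro local_limit[OF I.random_input_axioms N \<open>0 < r\<close> assms(5) approx, of Is "\<lambda>v. f v / B"]) auto
    from tendsto_mult[OF this tendsto_const[of B]]
    have "((\<lambda>x. \<integral>\<omega>. f (map (\<lambda>I. card (?H x \<omega> \<inter> (+) x ` I)) Is) \<partial>M) \<longlongrightarrow>
      (\<integral>\<omega>. f (map (\<lambda>I. card (N \<omega> \<inter> I)) Is) \<partial>M')) at_top"
      using B(1) by simp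
    moreover have "\<forall>\<^sub>F x in at_top. (\<integral>\<omega>. f (map (\<lambda>I. card (?H x \<omega> \<inter> (+) x ` I)) Is) \<partial>M) =
        (\<integral>\<omega>. f (map (\<lambda>I. card (X x \<omega> \<inter> I)) Is) \<partial>M)"
      using eventually_ge_at_top[of 0]
    proof eventually_elim
      case (elim x)
      have "card (X x \<omega> \<inter> I) = card (?H x \<omega> \<inter> (+) x ` I)" if "\<omega> \<in> space M" for \<omega> I
      proof -
        have "X x \<omega> = {y. x + y \<in> ?H x \<omega>}"
          unfolding X L using I.loc_finite[OF that] elim by (intro particles_of_hammersley_count) auto
        then have "(+) x ` (X x \<omega> \<inter> I) = ?H x \<omega> \<inter> (+) x ` I" by auto
        moreover have "card ((+) x ` (X x \<omega> \<inter> I)) = card (X x \<omega> \<inter> I)" by (rule card_image) simp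
        ultimately show ?thesis by simp
      qed
      then show ?case by (intro Bochner_Integration.integral_cong) auto
    qed
    ultimately show "((\<lambda>x. \<integral>\<omega>. f (map (\<lambda>I. card (X x \<omega> \<inter> I)) Is) \<partial>M) \<longlongrightarrow>
        (\<integral>\<omega>. f (map (\<lambda>I. card (N \<omega> \<inter> I)) Is) \<partial>M')) at_top"
      by (rule Lim_transform_eventually)
  qed
  have lam: "lam < 1 / mu" "mu < 1 / lam" using assms(2-4) by (auto simp: field_simps)
  show ?thesis
  proof (intro conjI impI allI)
    fix N :: "'v \<Rightarrow> real set" assume a: "a > 1 / mu^2" and N: "poisson_process M' UNIV (1 / mu) N"
    have c: "0 < 1 / mu" using assms(3) by simp
    have "1 / mu < sqrt a" using a assms(3) by (intro real_less_rsqrt) (simp add: power_divide)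
    \<comment> \<open>\<open>N\<close> has intensity \<open>1 / mu\<close>, so the factor
      \<open>?k\<close> yields added sources of intensity \<open>1 / mu - lam\<close>, which the
      sinks of intensity \<open>mu\<close> balance. No sinks are added.\<close>
    let ?k = "(1 / mu - lam) / (1 / mu)"
    have "poisson_input (M \<Otimes>\<^sub>M M') (add_points ?k S N) (add_points (- 0) T N) (\<lambda>z. A (fst z))
        (lam + 1 / mu * ?k) (mu + 1 / mu * 0) 1"
      by (rule I.add_points[OF N]) (use c lam in auto)
    moreover have "lam + 1 / mu * ?k = 1 / mu" "mu + 1 / mu * 0 = 1 / (1 / mu)" "- 0 = (0::real)"
      using assms(3) by (auto simp: field_simps)
    ultimately have stat: "poisson_input (M \<Otimes>\<^sub>M M') (add_points ?k S N) (\<lambda>z. T (fst z)) (\<lambda>z. A (fst z))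
        (1 / mu) (1 / (1 / mu)) 1" by (simp only: add_points_0)
    have "whp (M \<Otimes>\<^sub>M M') (\<lambda>x z. ?H x (fst z) \<inter> {0<..x + K} =
        hammersley (add_points ?k S N z) (T (fst z)) (A (fst z)) (a * x) \<inter> {0<..x + K})" for K
      by (rule poisson_input.sources_irrelevant[OF stat N c c refl refl assms(5) \<open>1 / mu < sqrt a\<close> subset_add_points])
    then have "whp (M \<Otimes>\<^sub>M M') (\<lambda>x z. ?H x (fst z) \<inter> {x - K<..x + K} =
        hammersley (add_points ?k S N z) (T (fst z)) (A (fst z)) (a * x) \<inter> {x - K<..x + K})" for K
    proof (rule prob_space.whp_mono[OF poisson_input.axioms(1)[OF stat, THEN random_input.axioms(1)]])
      show "\<forall>\<^sub>F x in at_top. \<forall>z\<in>space (M \<Otimes>\<^sub>M M'). ?H x (fst z) \<inter> {0<..x + K} =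
          hammersley (add_points ?k S N z) (T (fst z)) (A (fst z)) (a * x) \<inter> {0<..x + K} \<longrightarrow>
        ?H x (fst z) \<inter> {x - K<..x + K} =
          hammersley (add_points ?k S N z) (T (fst z)) (A (fst z)) (a * x) \<inter> {x - K<..x + K}"
        using eventually_ge_at_top[of K]
      proof eventually_elim
        case (elim x)
        then have "{x - K<..x + K} \<subseteq> {0<..x + K}" by auto
        then show ?case by blast
      qed
    qed
    then show "converges_in_distribution M X M' N"
      using stat c unfolding whp_def locally_stationary_def
      by (intro converges[OF N c, unfolded locally_stationary_def] exI[of _ "add_points ?k S N"] exI[of _ "\<lambda>z. T (fst z)"] exI[of _ "1 / mu"]) auto
  next
    fix N :: "'v \<Rightarrow> real set" assume a: "1 / mu^2 > a \<and> a > lam^2" and N: "poisson_process M' UNIV (sqrt a) N"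
    have c: "0 < sqrt a" using assms(5) by simp
    have "lam < sqrt a" using a by (intro real_less_rsqrt) auto
    moreover have "sqrt a < 1 / mu"
      using a assms(3) by (intro real_less_lsqrt) (auto simp: power_divide)
    ultimately show "converges_in_distribution M X M' N"
      by (intro converges[OF N c] I.rarefaction_fan[OF N c refl assms(5) _ _ assms(3)])
  next
    fix N :: "'v \<Rightarrow> real set" assume a: "lam^2 > a" and N: "poisson_process M' UNIV lam N"
    have "sqrt a < lam" using a assms(2) by (intro real_less_lsqrt) auto
    \<comment> \<open>Now \<open>N\<close> has intensity \<open>lam\<close>; its negative half,
      scaled by \<open>?l\<close>, supplies sinks of intensity \<open>1 / lam - mu\<close>, and the
      sources stay as they are.\<close>
    let ?l = "(1 / lam - mu) / lam"
    have "poisson_input (M \<Otimes>\<^sub>M M') (add_points 0 S N) (add_points (- ?l) T N) (\<lambda>z. A (fst z))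
        (lam + lam * 0) (mu + lam * ?l) 1"
      by (rule I.add_points[OF N]) (use assms(2) lam in auto)
    moreover have "lam + lam * 0 = lam" "mu + lam * ?l = 1 / lam"
      using assms(2) by (auto simp: field_simps)
    ultimately have stat: "poisson_input (M \<Otimes>\<^sub>M M') (\<lambda>z. S (fst z)) (add_points (- ?l) T N) (\<lambda>z. A (fst z))
        lam (1 / lam) 1" by (simp only: add_points_0)
    have "whp (M \<Otimes>\<^sub>M M') (\<lambda>x z. ?H x (fst z) \<inter> {x - K<..x + K} =
        hammersley (S (fst z)) (add_points (- ?l) T N z) (A (fst z)) (a * x) \<inter> {x - K<..x + K})" for K
      by (rule poisson_input.sinks_irrelevant[OF stat N assms(2,2) refl refl assms(5) \<open>sqrt a < lam\<close> subset_add_points])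
    then show "converges_in_distribution M X M' N"
      using stat assms(2) unfolding whp_def locally_stationary_def
      by (intro converges[OF N assms(2), unfolded locally_stationary_def] exI[of _ "\<lambda>z. S (fst z)"] exI[of _ "add_points (- ?l) T N"] exI[of _ lam]) auto
  qed
qed

end
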